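(* The multiplication map induces an isomorphism of vector spaces $$P_n\otimes \mathbb{F}G^n\otimes \mathbb{F}S_n\longrightarrow \mathcal{H}_n(G).$$ That is, the elements $\{x^{\alpha}gw \mid \alpha\in\mathbb{Z}_+^n,\ g\in G^n,\ w\in S_n\}$ form a linear basis of the wreath Hecke algebra $\mathcal{H}_n(G)$.
   Context: Let $\mathbb{F}$ be an algebraically closed field of characteristic $p\ge 0$, $G$ a finite group, $n\ge 1$. $S_n$ acts on $G^n$ by ${}^{w}(g_1,\ldots,g_n)=(g_{w^{-1}(1)},\ldots,g_{w^{-1}(n)})$. For $g\in G$, $g^{(i)}\in G^n$ has $g$ in the $i$-th factor and $1$ elsewhere; $t_{ij}=\sum_{h\in G}h^{(i)}(h^{-1})^{(j)}\in\mathbb{F}G^n$ for $i<j$. The wreath Hecke algebra $\mathcal{H}_n(G)$ is the associative unital $\mathbb{F}$-algebra generated by $G^n$, $s_1,\ldots,s_{n-1}$, $x_1,\ldots,x_n$ subject to the relations of the group $G^n$ and: $x_ix_j=x_jx_i$; $x_ig=gx_i$ for $g\in G^n$; $s_i^2=1$, $s_is_j=s_js_i$ if $|i-j|>1$, $s_is_{i+1}s_i=s_{i+1}s_is_{i+1}$; $s_ix_i=x_{i+1}s_i-t_{i,i+1}$; $s_ix_j=x_js_i$ for $j\ne i,i+1$; $s_ig={}^{s_i}g\,s_i$ for $g\in G^n$. Here $P_n=\mathbb{F}[x_1,\ldots,x_n]$ is the polynomial algebra, $x^\alpha=x_1^{\alpha_1}\cdots x_n^{\alpha_n}$ for $\alpha\in\mathbb{Z}_+^n$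 ($\mathbb{Z}_+$ the non-negative integers), and $S_n$ is generated by the simple reflections $s_1,\ldots,s_{n-1}$. *)

theory Defs
  imports "HOL-Algebra.Algebra" "Jordan_Normal_Form.Missing_VectorSpace"
begin

section \<open>Free modules, quotients and tensor products\<close>

definition delta :: "('f, 'e) ring_scheme \<Rightarrow> 'x \<Rightarrow> 'x \<Rightarrow> 'f"
  where "delta F x = (\<lambda>y. if y = x then \<one>\<^bsub>F\<^esub> else \<zero>\<^bsub>F\<^esub>)"

definition fin_supp :: "('f, 'e) ring_scheme \<Rightarrow> 'x set \<Rightarrow> ('x \<Rightarrow> 'f) set"
  where "fin_supp F Y = {f. (\<forall>x. f x \<in> carrier F) \<and>
    {x. f x \<noteq> \<zero>\<^bsub>F\<^esub>} \<subseteq> Y \<and> finite {x. f x \<noteq> \<zero>\<^bsub>F\<^esub>}}"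

text \<open>The record type of modules extends that of rings; as in \<^const>\<open>direct_sum\<close>, the
  multiplicative fields of a mere module are dummies.\<close>

definition free_module :: "('f, 'e) ring_scheme \<Rightarrow> 'x set \<Rightarrow> ('f, 'x \<Rightarrow> 'f) module"
  where "free_module F Y =
    \<lparr>carrier = fin_supp F Y,
     monoid.mult = (\<lambda>f g x. \<zero>\<^bsub>F\<^esub>),
     one = (\<lambda>x. \<zero>\<^bsub>F\<^esub>),
     ring.zero = (\<lambda>x. \<zero>\<^bsub>F\<^esub>),
     ring.add = (\<lambda>f g x. f x \<oplus>\<^bsub>F\<^esub> g x),
     smult = (\<lambda>a f x. a \<otimes>\<^bsub>F\<^esub> f x)\<rparr>"

text \<open>The ring structure is that of \<open>M Quot N\<close>, and \<open>a (N + x) = N + a x\<close>. This is used both for a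
  module modulo a submodule (where the multiplicative fields are irrelevant) and for an algebra
  modulo a two-sided ideal.\<close>

definition quot_module :: "('f, 'v, 'e) module_scheme \<Rightarrow> 'v set \<Rightarrow> ('f, 'v set) module"
  where "quot_module M N = ring.extend (M Quot N)
    (module.fields (\<lambda>a C. \<Union>x\<in>C. N +>\<^bsub>M\<^esub> (a \<odot>\<^bsub>M\<^esub> x)))"

definition bilinear_relators ::
    "('f, 'e) ring_scheme \<Rightarrow> ('f, 'v, 'a) module_scheme \<Rightarrow> ('f, 'w, 'b) module_scheme
      \<Rightarrow> ('v \<times> 'w \<Rightarrow> 'f) set"
  where "bilinear_relators F V W =
    (let M = free_module F (carrier V \<times> carrier W) in
      {delta F (v \<oplus>\<^bsub>V\<^esub> v', w) \<ominus>\<^bsub>M\<^esub> (delta F (v, w) \<oplus>\<^bsub>M\<^esub> delta F (v', w)) | v v' w.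
          v \<in> carrier V \<and> v' \<in> carrier V \<and> w \<in> carrier W}
      \<union> {delta F (v, w \<oplus>\<^bsub>W\<^esub> w') \<ominus>\<^bsub>M\<^esub> (delta F (v, w) \<oplus>\<^bsub>M\<^esub> delta F (v, w')) | v w w'.
          v \<in> carrier V \<and> w \<in> carrier W \<and> w' \<in> carrier W}
      \<union> {delta F (a \<odot>\<^bsub>V\<^esub> v, w) \<ominus>\<^bsub>M\<^esub> a \<odot>\<^bsub>M\<^esub> delta F (v, w) | a v w.
          a \<in> carrier F \<and> v \<in> carrier V \<and> w \<in> carrier W}
      \<union> {delta F (v, a \<odot>\<^bsub>W\<^esub> w) \<ominus>\<^bsub>M\<^esub> a \<odot>\<^bsub>M\<^esub> delta F (v, w) | a v w.
          a \<in> carrier F \<and> v \<in> carrier V \<and> w \<in> carrier W})"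

definition bilinear_kernel ::
    "('f, 'e) ring_scheme \<Rightarrow> ('f, 'v, 'a) module_scheme \<Rightarrow> ('f, 'w, 'b) module_scheme
      \<Rightarrow> ('v \<times> 'w \<Rightarrow> 'f) set"
  where "bilinear_kernel F V W =
    module.span F (free_module F (carrier V \<times> carrier W)) (bilinear_relators F V W)"

definition tensor ::
    "('f, 'e) ring_scheme \<Rightarrow> ('f, 'v, 'a) module_scheme \<Rightarrow> ('f, 'w, 'b) module_scheme
      \<Rightarrow> ('f, ('v \<times> 'w \<Rightarrow> 'f) set) module"
  where "tensor F V W =
    quot_module (free_module F (carrier V \<times> carrier W)) (bilinear_kernel F V W)"

definition pure_tensor ::
    "('f, 'e) ring_scheme \<Rightarrow> ('f, 'v, 'a) module_scheme \<Rightarrow> ('f, 'w, 'b) module_scheme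
      \<Rightarrow> 'v \<Rightarrow> 'w \<Rightarrow> ('v \<times> 'w \<Rightarrow> 'f) set"
  where "pure_tensor F V W v w =
    bilinear_kernel F V W +>\<^bsub>free_module F (carrier V \<times> carrier W)\<^esub> delta F (v, w)"

section \<open>Monoid algebras\<close>

definition monoid_algebra ::
    "('f, 'e) ring_scheme \<Rightarrow> ('m, 'c) monoid_scheme \<Rightarrow> ('f, 'm \<Rightarrow> 'f) module"
  where "monoid_algebra F M = (free_module F (carrier M))
    \<lparr>monoid.mult := (\<lambda>f g m. finsum F (\<lambda>(a, b). f a \<otimes>\<^bsub>F\<^esub> g b)
       {(a, b). f a \<noteq> \<zero>\<^bsub>F\<^esub> \<and> g b \<noteq> \<zero>\<^bsub>F\<^esub> \<and> a \<otimes>\<^bsub>M\<^esub> b = m}),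
     one := delta F \<one>\<^bsub>M\<^esub>\<rparr>"

text \<open>The linear map from the free module to \<open>V\<close> that sends each basis element \<open>m\<close> to \<open>\<phi> m\<close>.\<close>

definition linear_ext ::
    "('f, 'e) ring_scheme \<Rightarrow> ('f, 'v, 'a) module_scheme \<Rightarrow> ('m \<Rightarrow> 'v) \<Rightarrow> ('m \<Rightarrow> 'f) \<Rightarrow> 'v"
  where "linear_ext F V \<phi> f = (\<Oplus>\<^bsub>V\<^esub>m \<in> {m. f m \<noteq> \<zero>\<^bsub>F\<^esub>}. f m \<odot>\<^bsub>V\<^esub> \<phi> m)"

definition list_prod :: "('m, 'c) monoid_scheme \<Rightarrow> 'm list \<Rightarrow> 'm"
  where "list_prod M xs = foldr (\<otimes>\<^bsub>M\<^esub>) xs \<one>\<^bsub>M\<^esub>"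

definition free_monoid :: "'x set \<Rightarrow> 'x list monoid"
  where "free_monoid Y = \<lparr>carrier = lists Y, monoid.mult = (@), one = []\<rparr>"

definition free_algebra :: "('f, 'e) ring_scheme \<Rightarrow> 'x set \<Rightarrow> ('f, 'x list \<Rightarrow> 'f) module"
  where "free_algebra F Y = monoid_algebra F (free_monoid Y)"

definition exponent_monoid :: "nat \<Rightarrow> (nat \<Rightarrow> nat) monoid"
  where "exponent_monoid n = product_group {1..n} (\<lambda>_. \<lparr>carrier = UNIV, monoid.mult = (+), one = 0\<rparr>)"

definition poly_algebra :: "('f, 'e) ring_scheme \<Rightarrow> nat \<Rightarrow> ('f, (nat \<Rightarrow> nat) \<Rightarrow> 'f) module"
  where "poly_algebra F n = monoid_algebra F (exponent_monoid n)"

section \<open>The wreath Hecke algebra\<close>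

definition group_pow :: "('g, 'c) monoid_scheme \<Rightarrow> nat \<Rightarrow> (nat \<Rightarrow> 'g) monoid"
  where "group_pow G n = product_group {1..n} (\<lambda>_. G)"

definition in_factor :: "('g, 'c) monoid_scheme \<Rightarrow> nat \<Rightarrow> nat \<Rightarrow> 'g \<Rightarrow> nat \<Rightarrow> 'g"
  where "in_factor G n i g = (\<lambda>k\<in>{1..n}. if k = i then g else \<one>\<^bsub>G\<^esub>)"

definition perm_act :: "nat \<Rightarrow> (nat \<Rightarrow> nat) \<Rightarrow> (nat \<Rightarrow> 'g) \<Rightarrow> nat \<Rightarrow> 'g"
  where "perm_act n w g = (\<lambda>k\<in>{1..n}. g (inv' w k))"

definition simple_refl :: "nat \<Rightarrow> nat \<Rightarrow> nat"
  where "simple_refl i = transpose i (Suc i)"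

datatype 'g wreath_gen = GenG "nat \<Rightarrow> 'g" | GenS nat | GenX nat

definition wreath_gens :: "('g, 'c) monoid_scheme \<Rightarrow> nat \<Rightarrow> 'g wreath_gen set"
  where "wreath_gens G n = GenG ` carrier (group_pow G n) \<union> GenS ` {1..<n} \<union> GenX ` {1..n}"

abbreviation wreath_free ::
    "('f, 'e) ring_scheme \<Rightarrow> ('g, 'c) monoid_scheme \<Rightarrow> nat
      \<Rightarrow> ('f, 'g wreath_gen list \<Rightarrow> 'f) module"
  where "wreath_free F G n \<equiv> free_algebra F (wreath_gens G n)"

abbreviation free_g :: "('f, 'e) ring_scheme \<Rightarrow> (nat \<Rightarrow> 'g) \<Rightarrow> 'g wreath_gen list \<Rightarrow> 'f"
  where "free_g F g \<equiv> delta F [GenG g]"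

abbreviation free_s :: "('f, 'e) ring_scheme \<Rightarrow> nat \<Rightarrow> 'g wreath_gen list \<Rightarrow> 'f"
  where "free_s F i \<equiv> delta F [GenS i]"

abbreviation free_x :: "('f, 'e) ring_scheme \<Rightarrow> nat \<Rightarrow> 'g wreath_gen list \<Rightarrow> 'f"
  where "free_x F i \<equiv> delta F [GenX i]"

definition free_t :: "('f, 'e) ring_scheme \<Rightarrow> ('g, 'c) monoid_scheme \<Rightarrow> nat \<Rightarrow> nat \<Rightarrow> nat
    \<Rightarrow> 'g wreath_gen list \<Rightarrow> 'f"
  where "free_t F G n i j = (\<Oplus>\<^bsub>wreath_free F G n\<^esub>h \<in> carrier G.
    free_g F (in_factor G n i h \<otimes>\<^bsub>group_pow G n\<^esub> in_factor G n j (inv\<^bsub>G\<^esub> h)))"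

inductive wreath_rel ::
    "('f, 'e) ring_scheme \<Rightarrow> ('g, 'c) monoid_scheme \<Rightarrow> nat
      \<Rightarrow> ('g wreath_gen list \<Rightarrow> 'f) \<Rightarrow> ('g wreath_gen list \<Rightarrow> 'f) \<Rightarrow> bool"
  for F G n
  where
    g_mult: "\<lbrakk>g \<in> carrier (group_pow G n); h \<in> carrier (group_pow G n)\<rbrakk> \<Longrightarrow>
      wreath_rel F G n
        (free_g F g \<otimes>\<^bsub>wreath_free F G n\<^esub> free_g F h)
        (free_g F (g \<otimes>\<^bsub>group_pow G n\<^esub> h))"
  | g_one:
      "wreath_rel F G n (free_g F \<one>\<^bsub>group_pow G n\<^esub>) \<one>\<^bsub>wreath_free F G n\<^esub>"
  | x_x: "\<lbrakk>i \<in> {1..n}; j \<in> {1..n}\<rbrakk> \<Longrightarrow>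
      wreath_rel F G n
        (free_x F i \<otimes>\<^bsub>wreath_free F G n\<^esub> free_x F j)
        (free_x F j \<otimes>\<^bsub>wreath_free F G n\<^esub> free_x F i)"
  | x_g: "\<lbrakk>i \<in> {1..n}; g \<in> carrier (group_pow G n)\<rbrakk> \<Longrightarrow>
      wreath_rel F G n
        (free_x F i \<otimes>\<^bsub>wreath_free F G n\<^esub> free_g F g)
        (free_g F g \<otimes>\<^bsub>wreath_free F G n\<^esub> free_x F i)"
  | s_sq: "i \<in> {1..<n} \<Longrightarrow>
      wreath_rel F G n
        (free_s F i \<otimes>\<^bsub>wreath_free F G n\<^esub> free_s F i)
        \<one>\<^bsub>wreath_free F G n\<^esub>"
  | s_comm: "\<lbrakk>i \<in> {1..<n}; j \<in> {1..<n}; \<bar>int i - int j\<bar> > 1\<rbrakk> \<Longrightarrow>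
      wreath_rel F G n
        (free_s F i \<otimes>\<^bsub>wreath_free F G n\<^esub> free_s F j)
        (free_s F j \<otimes>\<^bsub>wreath_free F G n\<^esub> free_s F i)"
  | s_braid: "\<lbrakk>i \<in> {1..<n}; Suc i \<in> {1..<n}\<rbrakk> \<Longrightarrow>
      wreath_rel F G n
        (free_s F i \<otimes>\<^bsub>wreath_free F G n\<^esub> free_s F (Suc i)
          \<otimes>\<^bsub>wreath_free F G n\<^esub> free_s F i)
        (free_s F (Suc i) \<otimes>\<^bsub>wreath_free F G n\<^esub> free_s F i
          \<otimes>\<^bsub>wreath_free F G n\<^esub> free_s F (Suc i))"
  | s_x: "i \<in> {1..<n} \<Longrightarrow>
      wreath_rel F G n
        (free_s F i \<otimes>\<^bsub>wreath_free F G n\<^esub> free_x F i)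
        (free_x F (Suc i) \<otimes>\<^bsub>wreath_free F G n\<^esub> free_s F i
          \<ominus>\<^bsub>wreath_free F G n\<^esub> free_t F G n i (Suc i))"
  | s_x_far: "\<lbrakk>i \<in> {1..<n}; j \<in> {1..n}; j \<noteq> i; j \<noteq> Suc i\<rbrakk> \<Longrightarrow>
      wreath_rel F G n
        (free_s F i \<otimes>\<^bsub>wreath_free F G n\<^esub> free_x F j)
        (free_x F j \<otimes>\<^bsub>wreath_free F G n\<^esub> free_s F i)"
  | s_g: "\<lbrakk>i \<in> {1..<n}; g \<in> carrier (group_pow G n)\<rbrakk> \<Longrightarrow>
      wreath_rel F G n
        (free_s F i \<otimes>\<^bsub>wreath_free F G n\<^esub> free_g F g)
        (free_g F (perm_act n (simple_refl i) g) \<otimes>\<^bsub>wreath_free F G n\<^esub> free_s F i)"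

definition wreath_ideal ::
    "('f, 'e) ring_scheme \<Rightarrow> ('g, 'c) monoid_scheme \<Rightarrow> nat \<Rightarrow> ('g wreath_gen list \<Rightarrow> 'f) set"
  where "wreath_ideal F G n =
    Idl\<^bsub>wreath_free F G n\<^esub> {l \<ominus>\<^bsub>wreath_free F G n\<^esub> r | l r. wreath_rel F G n l r}"

definition wreath_hecke ::
    "('f, 'e) ring_scheme \<Rightarrow> ('g, 'c) monoid_scheme \<Rightarrow> nat
      \<Rightarrow> ('f, ('g wreath_gen list \<Rightarrow> 'f) set) module"
  where "wreath_hecke F G n = quot_module (wreath_free F G n) (wreath_ideal F G n)"

definition hecke_gen ::
    "('f, 'e) ring_scheme \<Rightarrow> ('g, 'c) monoid_scheme \<Rightarrow> nat \<Rightarrow> 'g wreath_gen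
      \<Rightarrow> ('g wreath_gen list \<Rightarrow> 'f) set"
  where "hecke_gen F G n z = wreath_ideal F G n +>\<^bsub>wreath_free F G n\<^esub> delta F [z]"

definition hecke_monom ::
    "('f, 'e) ring_scheme \<Rightarrow> ('g, 'c) monoid_scheme \<Rightarrow> nat \<Rightarrow> (nat \<Rightarrow> nat)
      \<Rightarrow> ('g wreath_gen list \<Rightarrow> 'f) set"
  where "hecke_monom F G n \<alpha> = list_prod (wreath_hecke F G n)
    (map (\<lambda>i. hecke_gen F G n (GenX i) [^]\<^bsub>wreath_hecke F G n\<^esub> \<alpha> i) [1..<Suc n])"

text \<open>The image of a permutation \<open>w\<close> in the algebra: write \<open>w\<close> as any product of simple reflections
  and multiply the corresponding generators. By the Coxeter relations, which are among the defining
  ones, the value does not depend on the word.\<close>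

definition hecke_perm ::
    "('f, 'e) ring_scheme \<Rightarrow> ('g, 'c) monoid_scheme \<Rightarrow> nat \<Rightarrow> (nat \<Rightarrow> nat)
      \<Rightarrow> ('g wreath_gen list \<Rightarrow> 'f) set"
  where "hecke_perm F G n w = (THE y. \<exists>ks. set ks \<subseteq> {1..<n} \<and>
    w = list_prod (sym_group n) (map simple_refl ks) \<and>
    y = list_prod (wreath_hecke F G n) (map (\<lambda>i. hecke_gen F G n (GenS i)) ks))"

definition hecke_basis_elem ::
    "('f, 'e) ring_scheme \<Rightarrow> ('g, 'c) monoid_scheme \<Rightarrow> nat
      \<Rightarrow> (nat \<Rightarrow> nat) \<times> (nat \<Rightarrow> 'g) \<times> (nat \<Rightarrow> nat) \<Rightarrow> ('g wreath_gen list \<Rightarrow> 'f) set"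
  where "hecke_basis_elem F G n = (\<lambda>(\<alpha>, g, w).
    hecke_monom F G n \<alpha> \<otimes>\<^bsub>wreath_hecke F G n\<^esub> hecke_gen F G n (GenG g)
      \<otimes>\<^bsub>wreath_hecke F G n\<^esub> hecke_perm F G n w)"

text \<open>The canonical maps from the three factors to the wreath Hecke algebra.\<close>

definition poly_to_hecke ::
    "('f, 'e) ring_scheme \<Rightarrow> ('g, 'c) monoid_scheme \<Rightarrow> nat \<Rightarrow> ((nat \<Rightarrow> nat) \<Rightarrow> 'f)
      \<Rightarrow> ('g wreath_gen list \<Rightarrow> 'f) set"
  where "poly_to_hecke F G n = linear_ext F (wreath_hecke F G n) (hecke_monom F G n)"

definition group_to_hecke ::
    "('f, 'e) ring_scheme \<Rightarrow> ('g, 'c) monoid_scheme \<Rightarrow> nat \<Rightarrow> ((nat \<Rightarrow> 'g) \<Rightarrow> 'f)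
      \<Rightarrow> ('g wreath_gen list \<Rightarrow> 'f) set"
  where "group_to_hecke F G n =
    linear_ext F (wreath_hecke F G n) (\<lambda>g. hecke_gen F G n (GenG g))"

definition perm_to_hecke ::
    "('f, 'e) ring_scheme \<Rightarrow> ('g, 'c) monoid_scheme \<Rightarrow> nat \<Rightarrow> ((nat \<Rightarrow> nat) \<Rightarrow> 'f)
      \<Rightarrow> ('g wreath_gen list \<Rightarrow> 'f) set"
  where "perm_to_hecke F G n = linear_ext F (wreath_hecke F G n) (hecke_perm F G n)"

end

theory Submission
  imports Defs "HOL-Library.Function_Algebras"
begin

text \<open>
  The proof is the standard one for algebras of this type: the ordered monomials \<open>x\<^sup>\<alpha> g w\<close> span because
  the relations let one sort every word, and they are independent because the algebra acts on a space
  that is large enough to tell them apart.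

  \<^bold>\<open>Spanning.\<close> The span of the ordered monomials is stable under left multiplication by every
  generator (\<open>span_map_surj\<close>). Only a reflection \<open>s\<^sub>i\<close> is not immediate: it is moved past the variables one
  at a time, each step costing a multiple of \<open>t\<^sub>i\<^sub>,\<^sub>i\<^sub>+\<^sub>1\<close>, by induction on the degree. That \<open>w\<close> has a
  well-defined image at all is the presentation of the symmetric group by the Coxeter relations. It is
  proved by bringing words into a normal form along the chain of symmetric groups
  (\<open>word_perm_determines\<close>).

  \<^bold>\<open>Independence.\<close> The algebra acts on polynomials tensored with the regular representation of the wreath
  product of \<open>G\<close> with the symmetric group. The reflection \<open>s\<^sub>i\<close> acts by \<open>f \<mapsto> s\<^sub>i(f) s\<^sub>i - t \<partial>\<^sub>i(f)\<close> with a divided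
  difference \<open>\<partial>\<^sub>i\<close>. This operator is determined by how it commutes with the variables and by its
  restriction to degree zero, and it is defined in this way, by recursion on the exponents. The
  relations follow from one principle (\<open>operator_eqI\<close>): the difference of the two sides of a relation
  intertwines variables with variables and vanishes in degree zero, so it vanishes. All structure
  constants are integers, so this is done over the integers, with transposed operators on functions,
  and only the matrix entries are mapped to the field. They yield linear functionals on the free
  algebra that kill the ideal of relations (\<open>wreath_ideal_annihilated\<close>). The word of \<open>x\<^sup>\<alpha> g w\<close> sends the
  unit vector to the basis vector with index \<open>(\<alpha>, g, w)\<close>, so these functionals separate the ordered
  monomials (\<open>span_map_inj\<close>).

  \<^bold>\<open>Tensor products.\<close> If two modules have bases, then the pure tensors of basis elements form a basis of
  the tensor product (\<open>based_module_tensor\<close>). Applied twice, this gives a basis of the source of the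
  multiplication map which that map matches with the ordered monomials.
\<close>

section \<open>Free modules and linear extension\<close>

lemma free_module_simps [simp]:
  "carrier (free_module F Y) = fin_supp F Y"
  "ring.zero (free_module F Y) = (\<lambda>x. \<zero>\<^bsub>F\<^esub>)"
  "ring.add (free_module F Y) = (\<lambda>f g x. f x \<oplus>\<^bsub>F\<^esub> g x)"
  "smult (free_module F Y) = (\<lambda>a f x. a \<otimes>\<^bsub>F\<^esub> f x)"
  by (simp_all add: free_module_def)

abbreviation support :: "('f, 'e) ring_scheme \<Rightarrow> ('x \<Rightarrow> 'f) \<Rightarrow> 'x set"
  where "support F f \<equiv> {x. f x \<noteq> \<zero>\<^bsub>F\<^esub>}"

lemma fin_suppD:
  assumes "f \<in> fin_supp F Y"
  shows "f x \<in> carrier F" "finite (support F f)" "support F f \<subseteq> Y"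
  using assms by (auto simp: fin_supp_def)

lemma fin_suppI:
  assumes "\<And>x. f x \<in> carrier F" "finite A" "\<And>x. x \<notin> A \<Longrightarrow> f x = \<zero>\<^bsub>F\<^esub>" "A \<subseteq> Y"
  shows "f \<in> fin_supp F Y"
proof -
  have "support F f \<subseteq> A" using assms(3) by auto
  with assms show ?thesis unfolding fin_supp_def by (auto intro: finite_subset)
qed

context cring
begin

lemma delta_mem [simp, intro]: "y \<in> Y \<Longrightarrow> delta R y \<in> fin_supp R Y"
  by (rule fin_suppI[where A="{y}"]) (auto simp: delta_def)

lemma module_free_module: "module R (free_module R Y)"
proof (rule module_criteria)
  show "cring R" by (rule is_cring)
  show "\<zero>\<^bsub>free_module R Y\<^esub> \<in> carrier (free_module R Y)"
    by (auto intro: fin_suppI[where A="{}"])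
  have add: "(\<lambda>x. v x \<oplus> w x) \<in> fin_supp R Y" if "v \<in> fin_supp R Y" "w \<in> fin_supp R Y" for v w
    using fin_suppD[OF that(1)] fin_suppD[OF that(2)]
    by (intro fin_suppI[where A="support R v \<union> support R w"]) auto
  have sm: "(\<lambda>x. a \<otimes> v x) \<in> fin_supp R Y" if "v \<in> fin_supp R Y" "a \<in> carrier R" for a v
    using fin_suppD[OF that(1)] that
    by (intro fin_suppI[where A="support R v"]) auto
  show "\<forall>v w. v \<in> carrier (free_module R Y) \<and> w \<in> carrier (free_module R Y) \<longrightarrow>
      v \<oplus>\<^bsub>free_module R Y\<^esub> w \<in> carrier (free_module R Y)"
    using add by simp
  show "\<forall>c v. c \<in> carrier R \<and> v \<in> carrier (free_module R Y) \<longrightarrow>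
      c \<odot>\<^bsub>free_module R Y\<^esub> v \<in> carrier (free_module R Y)"
    using sm by simp
  show "\<forall>v\<in>carrier (free_module R Y). \<exists>neg_v\<in>carrier (free_module R Y).
      v \<oplus>\<^bsub>free_module R Y\<^esub> neg_v = \<zero>\<^bsub>free_module R Y\<^esub>"
  proof
    fix v assume v: "v \<in> carrier (free_module R Y)"
    have "(\<lambda>x. \<ominus> v x) \<in> fin_supp R Y"
      using v fin_suppD[of v R Y] by (intro fin_suppI[where A="support R v"]) auto
    then show "\<exists>neg_v\<in>carrier (free_module R Y).
      v \<oplus>\<^bsub>free_module R Y\<^esub> neg_v = \<zero>\<^bsub>free_module R Y\<^esub>"
      using v by (intro bexI[of _ "\<lambda>x. \<ominus> v x"]) (auto simp: fin_suppD r_neg)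
  qed
qed (auto simp: fun_eq_iff fin_suppD a_ac m_ac l_distr r_distr)

lemma free_module_minus:
  assumes "f \<in> fin_supp R Y" "g \<in> fin_supp R Y"
  shows "f \<ominus>\<^bsub>free_module R Y\<^esub> g = (\<lambda>x. f x \<ominus> g x)"
proof -
  interpret M: module R "free_module R Y" by (rule module_free_module)
  have "\<ominus>\<^bsub>free_module R Y\<^esub> g = (\<lambda>x. \<ominus> g x)"
  proof (rule M.M.minus_equality)
    show "(\<lambda>x. \<ominus> g x) \<oplus>\<^bsub>free_module R Y\<^esub> g = \<zero>\<^bsub>free_module R Y\<^esub>"
      using assms by (auto simp: fin_suppD l_neg)
    show "(\<lambda>x. \<ominus> g x) \<in> carrier (free_module R Y)"
      using assms fin_suppD[of g R Y] by (auto intro!: fin_suppI[where A="support R g"])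
  qed (use assms in simp)
  then show ?thesis by (simp add: a_minus_def fun_eq_iff)
qed

lemma finsum_free_module:
  assumes "finite A" "\<And>a. a \<in> A \<Longrightarrow> f a \<in> fin_supp R Y"
  shows "(\<Oplus>\<^bsub>free_module R Y\<^esub>a\<in>A. f a) = (\<lambda>x. \<Oplus>a\<in>A. f a x)"
proof -
  interpret M: module R "free_module R Y" by (rule module_free_module)
  show ?thesis using assms
  proof (induction A)
    case (insert a A)
    then have "(\<Oplus>\<^bsub>free_module R Y\<^esub>a\<in>insert a A. f a)
        = f a \<oplus>\<^bsub>free_module R Y\<^esub> (\<Oplus>\<^bsub>free_module R Y\<^esub>a\<in>A. f a)"
      by (intro M.M.finsum_insert) auto
    also have "\<dots> = (\<lambda>x. \<Oplus>a\<in>insert a A. f a x)"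
      using insert fin_suppD(1)[OF insert.prems] by (subst finsum_insert) auto
    finally show ?case .
  qed simp
qed

end

lemma module_homI:
  assumes "\<And>x. x \<in> carrier M \<Longrightarrow> T x \<in> carrier N"
    and "\<And>x y. x \<in> carrier M \<Longrightarrow> y \<in> carrier M \<Longrightarrow> T (x \<oplus>\<^bsub>M\<^esub> y) = T x \<oplus>\<^bsub>N\<^esub> T y"
    and "\<And>a x. a \<in> carrier R \<Longrightarrow> x \<in> carrier M \<Longrightarrow> T (a \<odot>\<^bsub>M\<^esub> x) = a \<odot>\<^bsub>N\<^esub> T x"
  shows "T \<in> module_hom R M N"
  using assms by (auto simp: module_hom_def)

lemmas mod_hom_add = module_hom_add[OF mod_hom.f_hom]
lemmas mod_hom_smult = module_hom_smult[OF mod_hom.f_hom]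

lemma (in mod_hom) hom_finsum:
  assumes "\<And>a. a \<in> A \<Longrightarrow> g a \<in> carrier M"
  shows "f (\<Oplus>\<^bsub>M\<^esub>a\<in>A. g a) = (\<Oplus>\<^bsub>N\<^esub>a\<in>A. f (g a))"
  using assms
proof (induction A rule: infinite_finite_induct)
  case (insert a A)
  then have "f (\<Oplus>\<^bsub>M\<^esub>a\<in>insert a A. g a) = f (g a \<oplus>\<^bsub>M\<^esub> (\<Oplus>\<^bsub>M\<^esub>a\<in>A. g a))"
    by (subst M.M.finsum_insert) auto
  also have "\<dots> = f (g a) \<oplus>\<^bsub>N\<^esub> (\<Oplus>\<^bsub>N\<^esub>a\<in>A. f (g a))"
    using insert by (subst f_add) (auto intro!: M.M.finsum_closed)
  also have "\<dots> = (\<Oplus>\<^bsub>N\<^esub>a\<in>insert a A. f (g a))"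
    using insert by (subst N.M.finsum_insert) auto
  finally show ?case .
qed (auto simp: M.M.finsum_infinite N.M.finsum_infinite)

context module
begin

lemma linear_ext_superset:
  assumes "finite A" "support R f \<subseteq> A" "\<And>x. f x \<in> carrier R"
    and "\<And>x. x \<in> A \<Longrightarrow> \<phi> x \<in> carrier M"
  shows "linear_ext R M \<phi> f = (\<Oplus>\<^bsub>M\<^esub>x\<in>A. f x \<odot>\<^bsub>M\<^esub> \<phi> x)"
  unfolding linear_ext_def using assms
  by (intro M.add.finprod_mono_neutral_cong_left) auto

lemma linear_ext_closed [simp]:
  assumes "f \<in> fin_supp R Y" "\<And>y. y \<in> Y \<Longrightarrow> \<phi> y \<in> carrier M"
  shows "linear_ext R M \<phi> f \<in> carrier M"
  unfolding linear_ext_def using fin_suppD[OF assms(1)] assms(2)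
  by (intro M.finsum_closed) auto

lemma linear_ext_cong:
  assumes "f \<in> fin_supp R Y" "\<And>y. y \<in> Y \<Longrightarrow> \<phi> y = \<psi> y" "\<And>y. y \<in> Y \<Longrightarrow> \<psi> y \<in> carrier M"
  shows "linear_ext R M \<phi> f = linear_ext R M \<psi> f"
  unfolding linear_ext_def using fin_suppD[OF assms(1)] assms(2,3)
  by (intro M.finsum_cong') auto

lemma linear_ext_delta:
  assumes "\<phi> y \<in> carrier M"
  shows "linear_ext R M \<phi> (delta R y) = \<phi> y"
proof -
  have "linear_ext R M \<phi> (delta R y) = (\<Oplus>\<^bsub>M\<^esub>x\<in>{y}. delta R y x \<odot>\<^bsub>M\<^esub> \<phi> x)"
    using assms by (intro linear_ext_superset) (auto simp: delta_def)
  also have "\<dots> = \<phi> y"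
    using assms by (subst M.finsum_insert) (auto simp: delta_def)
  finally show ?thesis .
qed

lemma linear_ext_hom:
  assumes "\<And>y. y \<in> Y \<Longrightarrow> \<phi> y \<in> carrier M"
  shows "mod_hom R (free_module R Y) M (linear_ext R M \<phi>)"
proof (intro mod_hom.intro mod_hom_axioms.intro module_homI R.module_free_module module_axioms)
  fix f g assume f: "f \<in> carrier (free_module R Y)" and g: "g \<in> carrier (free_module R Y)"
  let ?A = "support R f \<union> support R g"
  have A: "finite ?A" "?A \<subseteq> Y" "\<And>x. x \<in> ?A \<Longrightarrow> \<phi> x \<in> carrier M"
    "\<And>x. f x \<in> carrier R" "\<And>x. g x \<in> carrier R"
    using f g assms fin_suppD[of f R Y] fin_suppD[of g R Y] by auto
  have "linear_ext R M \<phi> (f \<oplus>\<^bsub>free_module R Y\<^esub> g)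
      = (\<Oplus>\<^bsub>M\<^esub>x\<in>?A. (f x \<oplus> g x) \<odot>\<^bsub>M\<^esub> \<phi> x)"
    using A by (subst linear_ext_superset[where A="?A"]) auto
  also have "\<dots> = (\<Oplus>\<^bsub>M\<^esub>x\<in>?A. f x \<odot>\<^bsub>M\<^esub> \<phi> x \<oplus>\<^bsub>M\<^esub> g x \<odot>\<^bsub>M\<^esub> \<phi> x)"
    using A by (intro M.finsum_cong') (auto simp: smult_l_distr)
  also have "\<dots> = (\<Oplus>\<^bsub>M\<^esub>x\<in>?A. f x \<odot>\<^bsub>M\<^esub> \<phi> x) \<oplus>\<^bsub>M\<^esub> (\<Oplus>\<^bsub>M\<^esub>x\<in>?A. g x \<odot>\<^bsub>M\<^esub> \<phi> x)"
    using A by (intro M.finsum_addf) auto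
  also have "\<dots> = linear_ext R M \<phi> f \<oplus>\<^bsub>M\<^esub> linear_ext R M \<phi> g"
    using A by (subst (1 2) linear_ext_superset[where A="?A"]) auto
  finally show "linear_ext R M \<phi> (f \<oplus>\<^bsub>free_module R Y\<^esub> g)
    = linear_ext R M \<phi> f \<oplus>\<^bsub>M\<^esub> linear_ext R M \<phi> g" .
next
  fix a f assume a: "a \<in> carrier R" and f: "f \<in> carrier (free_module R Y)"
  let ?A = "support R f"
  have A: "finite ?A" "?A \<subseteq> Y" "\<And>x. x \<in> ?A \<Longrightarrow> \<phi> x \<in> carrier M" "\<And>x. f x \<in> carrier R"
    using f assms fin_suppD[of f R Y] by auto
  have "linear_ext R M \<phi> (a \<odot>\<^bsub>free_module R Y\<^esub> f) = (\<Oplus>\<^bsub>M\<^esub>x\<in>?A. (a \<otimes> f x) \<odot>\<^bsub>M\<^esub> \<phi> x)"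
    using A a by (subst linear_ext_superset[where A="?A"]) auto
  also have "\<dots> = (\<Oplus>\<^bsub>M\<^esub>x\<in>?A. a \<odot>\<^bsub>M\<^esub> (f x \<odot>\<^bsub>M\<^esub> \<phi> x))"
    using A a by (intro M.finsum_cong') (auto simp: smult_assoc1)
  also have "\<dots> = a \<odot>\<^bsub>M\<^esub> linear_ext R M \<phi> f"
    unfolding linear_ext_def using A a by (intro finsum_smult_ldistr[symmetric]) auto
  finally show "linear_ext R M \<phi> (a \<odot>\<^bsub>free_module R Y\<^esub> f) = a \<odot>\<^bsub>M\<^esub> linear_ext R M \<phi> f" .
qed (use assms in auto)

text \<open>A linear extension is a finite sum, so two of them commute. This is what makes convolution
  linear in its right argument and the annihilator below a right ideal.\<close>

lemma linear_ext_swap: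
  assumes f: "f \<in> fin_supp R Y" and g: "g \<in> fin_supp R Z"
    and \<phi>: "\<And>y z. y \<in> Y \<Longrightarrow> z \<in> Z \<Longrightarrow> \<phi> y z \<in> carrier M"
  shows "linear_ext R M (\<lambda>y. linear_ext R M (\<phi> y) g) f
    = linear_ext R M (\<lambda>z. linear_ext R M (\<lambda>y. \<phi> y z) f) g"
proof -
  let ?A = "support R f" and ?B = "support R g"
  have A: "finite ?A" "\<And>y. y \<in> ?A \<Longrightarrow> y \<in> Y" "\<And>x. f x \<in> carrier R"
    and B: "finite ?B" "\<And>y. y \<in> ?B \<Longrightarrow> y \<in> Z" "\<And>x. g x \<in> carrier R"
    using fin_suppD[OF f] fin_suppD[OF g] by auto
  have cl: "\<phi> y z \<in> carrier M" if "y \<in> ?A" "z \<in> ?B" for y z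
    using that A B \<phi> by blast
  have "linear_ext R M (\<lambda>y. linear_ext R M (\<phi> y) g) f
      = (\<Oplus>\<^bsub>M\<^esub>y\<in>?A. \<Oplus>\<^bsub>M\<^esub>z\<in>?B. f y \<odot>\<^bsub>M\<^esub> (g z \<odot>\<^bsub>M\<^esub> \<phi> y z))"
    unfolding linear_ext_def using A B cl
    by (intro M.finsum_cong' finsum_smult_ldistr Pi_I M.finsum_closed smult_closed) simp_all
  also have "\<dots> = (\<Oplus>\<^bsub>M\<^esub>z\<in>?B. \<Oplus>\<^bsub>M\<^esub>y\<in>?A. f y \<odot>\<^bsub>M\<^esub> (g z \<odot>\<^bsub>M\<^esub> \<phi> y z))"
    using A B cl by (intro M.add.finprod_finprod_swap) auto
  also have "\<dots> = (\<Oplus>\<^bsub>M\<^esub>z\<in>?B. \<Oplus>\<^bsub>M\<^esub>y\<in>?A. g z \<odot>\<^bsub>M\<^esub> (f y \<odot>\<^bsub>M\<^esub> \<phi> y z))"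
    using A B cl by (intro M.finsum_cong' Pi_I M.finsum_closed)
      (auto simp: smult_assoc1[symmetric] m_comm)
  also have "\<dots> = linear_ext R M (\<lambda>z. linear_ext R M (\<lambda>y. \<phi> y z) f) g"
    unfolding linear_ext_def using A B cl
    by (intro M.finsum_cong' finsum_smult_ldistr[symmetric] Pi_I M.finsum_closed smult_closed)
      simp_all
  finally show ?thesis .
qed

end

lemma (in mod_hom) linear_ext:
  assumes "x \<in> fin_supp R Y" "\<And>y. y \<in> Y \<Longrightarrow> \<phi> y \<in> carrier M"
  shows "f (linear_ext R M \<phi> x) = linear_ext R N (\<lambda>y. f (\<phi> y)) x"
proof -
  have "f (linear_ext R M \<phi> x) = (\<Oplus>\<^bsub>N\<^esub>y\<in>support R x. f (x y \<odot>\<^bsub>M\<^esub> \<phi> y))"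
    unfolding linear_ext_def using assms fin_suppD[OF assms(1)] by (intro hom_finsum) auto
  also have "\<dots> = linear_ext R N (\<lambda>y. f (\<phi> y)) x"
    unfolding linear_ext_def using assms fin_suppD[OF assms(1)]
    by (intro N.M.finsum_cong') auto
  finally show ?thesis .
qed

lemma (in cring) linear_ext_delta_id:
  assumes "f \<in> fin_supp R Y"
  shows "linear_ext R (free_module R Y) (delta R) f = f"
proof
  fix z
  interpret M: module R "free_module R Y" by (rule module_free_module)
  note f = fin_suppD[OF assms]
  have "linear_ext R (free_module R Y) (delta R) f z = (\<Oplus>x\<in>support R f. f x \<otimes> delta R x z)"
    unfolding linear_ext_def using f
    by (subst finsum_free_module) (auto intro!: M.smult_closed[simplified])
  also have "\<dots> = f z"
  proof (cases "z \<in> support R f")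
    case True
    then have "(\<Oplus>x\<in>support R f. f x \<otimes> delta R x z) = (\<Oplus>x\<in>support R f. if z = x then f x else \<zero>)"
      using f by (intro finsum_cong') (auto simp: delta_def)
    then show ?thesis using True f by (simp add: finsum_singleton)
  next
    case False
    then show ?thesis using f
      by (auto intro!: add.finprod_one_eqI simp: delta_def)
  qed
  finally show "linear_ext R (free_module R Y) (delta R) f z = f z" .
qed

text \<open>Hence two linear maps out of a free module agree as soon as they agree on the basis, and every
  element of a quotient is a combination of the classes of basis elements.\<close>

lemma mod_hom_free_eq:
  assumes "mod_hom R (free_module R Y) N T" "f \<in> fin_supp R Y"
  shows "T f = linear_ext R N (\<lambda>y. T (delta R y)) f"
proof -
  interpret mod_hom R "free_module R Y" N T by fact
  show ?thesis
    using linear_ext[OF assms(2), of "delta R"] M.R.linear_ext_delta_id[OF assms(2)] by auto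
qed

lemma (in cring) free_hom_inj_onI:
  assumes "mod_hom R (free_module R Y) N T"
    and ker: "\<And>c. c \<in> fin_supp R Y \<Longrightarrow> T c = \<zero>\<^bsub>N\<^esub> \<Longrightarrow> c = (\<lambda>_. \<zero>)"
  shows "inj_on T (fin_supp R Y)"
proof (rule inj_onI)
  interpret T: mod_hom R "free_module R Y" N T by fact
  fix c d assume c: "c \<in> fin_supp R Y" and d: "d \<in> fin_supp R Y" and eq: "T c = T d"
  have "T (c \<ominus>\<^bsub>free_module R Y\<^esub> d) = \<zero>\<^bsub>N\<^esub>"
    using T.f_minus[of c d] c d eq T.f_im[of d] by (simp add: a_minus_def T.N.M.r_neg)
  moreover have "c \<ominus>\<^bsub>free_module R Y\<^esub> d \<in> fin_supp R Y"
    using T.M.M.minus_closed[of c d] c d by simp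
  ultimately have "c \<ominus>\<^bsub>free_module R Y\<^esub> d = (\<lambda>_. \<zero>)" by (intro ker)
  then have "(\<lambda>x. c x \<ominus> d x) = (\<lambda>_. \<zero>)" using free_module_minus[OF c d] by simp
  then have "c x \<ominus> d x = \<zero>" for x by (rule fun_cong)
  then have "c x = d x" for x
    using r_right_minus_eq[OF fin_suppD(1)[OF c] fin_suppD(1)[OF d], of x x] by blast
  then show "c = d" by (rule ext)
qed

section \<open>Associative algebras and monoid algebras\<close>

text \<open>Unlike \<^locale>\<open>algebra\<close>, the multiplication need not be commutative.\<close>

locale assoc_algebra = module R M + A?: ring M for R and M (structure) +
  assumes smult_mult_l: "\<lbrakk>a \<in> carrier R; x \<in> carrier M; y \<in> carrier M\<rbrakk> \<Longrightarrow>
      (a \<odot> x) \<otimes> y = a \<odot> (x \<otimes> y)"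
    and smult_mult_r: "\<lbrakk>a \<in> carrier R; x \<in> carrier M; y \<in> carrier M\<rbrakk> \<Longrightarrow>
      x \<otimes> (a \<odot> y) = a \<odot> (x \<otimes> y)"
begin

lemma l_mult_hom: "x \<in> carrier M \<Longrightarrow> mod_hom R M M (\<lambda>y. x \<otimes> y)"
  by (intro mod_hom.intro mod_hom_axioms.intro module_homI module_axioms)
    (auto simp: A.r_distr smult_mult_r)

lemma r_mult_hom: "y \<in> carrier M \<Longrightarrow> mod_hom R M M (\<lambda>x. x \<otimes> y)"
  by (intro mod_hom.intro mod_hom_axioms.intro module_homI module_axioms)
    (auto simp: A.l_distr smult_mult_l)

end

text \<open>As a module, a monoid algebra is the free module that it extends.\<close>

lemma module_cong:
  fixes M N :: "('a, 'b, 'c) module_scheme"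
  assumes "module R M" and "carrier N = carrier M" "ring.add N = ring.add M"
    and "ring.zero N = ring.zero M" "smult N = smult M"
  shows "module R N"
proof -
  have "add_monoid N = add_monoid M" using assms by simp
  then show ?thesis
    using assms unfolding module_def module_axioms_def abelian_group_def abelian_monoid_def
      abelian_group_axioms_def by simp
qed

lemma monoid_algebra_simps [simp]:
  "carrier (monoid_algebra F N) = fin_supp F (carrier N)"
  "ring.zero (monoid_algebra F N) = (\<lambda>x. \<zero>\<^bsub>F\<^esub>)"
  "ring.add (monoid_algebra F N) = (\<lambda>f g x. f x \<oplus>\<^bsub>F\<^esub> g x)"
  "smult (monoid_algebra F N) = (\<lambda>a f x. a \<otimes>\<^bsub>F\<^esub> f x)"
  "one (monoid_algebra F N) = delta F \<one>\<^bsub>N\<^esub>"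
  by (simp_all add: monoid_algebra_def)

lemma linear_ext_monoid_algebra:
  "linear_ext F (monoid_algebra F N) \<phi> f = linear_ext F (free_module F (carrier N)) \<phi> f"
proof -
  have "add_monoid (monoid_algebra F N) = add_monoid (free_module F (carrier N))" by simp
  then show ?thesis unfolding linear_ext_def finsum_def by simp
qed

locale monoid_ring = cring R + N: monoid N for R (structure) and N (structure)
begin

abbreviation "MA \<equiv> monoid_algebra R N"

lemma module_monoid_algebra: "module R MA"
  by (rule module_cong[OF module_free_module[of "carrier N"]]) auto

lemma free_hom_iff: "mod_hom R (free_module R (carrier N)) V T \<longleftrightarrow> mod_hom R MA V T"
  using module_monoid_algebra module_free_module[of "carrier N"]
  by (auto simp: mod_hom_def mod_hom_axioms_def module_hom_def)

lemma linear_ext_hom_MA: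
  assumes "module R V" "\<And>y. y \<in> carrier N \<Longrightarrow> \<phi> y \<in> carrier V"
  shows "mod_hom R MA V (linear_ext R V \<phi>)"
  using module.linear_ext_hom[OF assms(1), of "carrier N" \<phi>] assms(2)
  unfolding free_hom_iff by simp

abbreviation translate :: "'c \<Rightarrow> ('c \<Rightarrow> 'a) \<Rightarrow> 'c \<Rightarrow> 'a"
  where "translate a g \<equiv> linear_ext R MA (\<lambda>b. delta R (a \<otimes>\<^bsub>N\<^esub> b)) g"

text \<open>Written with linear extensions, convolution is visibly bilinear and determined by the products
  of basis elements; all ring axioms are derived from this form.\<close>

lemma conv_eq_linear_ext:
  assumes f: "f \<in> carrier MA" and g: "g \<in> carrier MA"
  shows "f \<otimes>\<^bsub>MA\<^esub> g =
    linear_ext R MA (\<lambda>a. translate a g) f"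
proof
  fix m
  interpret FM: module R "free_module R (carrier N)" by (rule module_free_module)
  let ?A = "support R f" and ?B = "support R g"
  have A: "finite ?A" "?A \<subseteq> carrier N" "\<And>x. f x \<in> carrier R"
    and B: "finite ?B" "?B \<subseteq> carrier N" "\<And>x. g x \<in> carrier R"
    using f g fin_suppD[of f R "carrier N"] fin_suppD[of g R "carrier N"] by auto
  have d: "delta R x y \<in> carrier R" for x y :: 'c by (simp add: delta_def)
  have inner: "translate a g \<in> fin_supp R (carrier N)"
    if "a \<in> carrier N" for a
    using FM.linear_ext_closed[of g "carrier N" "\<lambda>b. delta R (a \<otimes>\<^bsub>N\<^esub> b)"] that g
    by (auto simp: linear_ext_monoid_algebra)
  have inner_eq: "translate a g m
      = (\<Oplus>b\<in>?B. g b \<otimes> delta R (a \<otimes>\<^bsub>N\<^esub> b) m)" if "a \<in> carrier N" for a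
    unfolding linear_ext_monoid_algebra using that B
    by (subst linear_ext_def, subst finsum_free_module)
      (auto intro!: FM.smult_closed[simplified])
  have "linear_ext R MA (\<lambda>a. translate a g) f m
      = (\<Oplus>a\<in>?A. f a \<otimes> translate a g m)"
    using A inner
    by (subst linear_ext_monoid_algebra, subst linear_ext_def, subst finsum_free_module)
      (auto intro!: FM.smult_closed[simplified])
  also have "\<dots> = (\<Oplus>a\<in>?A. \<Oplus>b\<in>?B. f a \<otimes> (g b \<otimes> delta R (a \<otimes>\<^bsub>N\<^esub> b) m))"
  proof (intro finsum_cong')
    fix a assume a: "a \<in> ?A"
    then have "translate a g m
        = (\<Oplus>b\<in>?B. g b \<otimes> delta R (a \<otimes>\<^bsub>N\<^esub> b) m)"
      using A inner_eq by blast
    then show "f a \<otimes> translate a g m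
        = (\<Oplus>b\<in>?B. f a \<otimes> (g b \<otimes> delta R (a \<otimes>\<^bsub>N\<^esub> b) m))"
      using A B d by (simp add: finsum_rdistr)
  qed (use A B d in auto)
  also have "\<dots> = (\<Oplus>p\<in>?A \<times> ?B. f (fst p) \<otimes> (g (snd p) \<otimes> delta R (fst p \<otimes>\<^bsub>N\<^esub> snd p) m))"
    using A B d by (subst add.finprod_finprod) (auto simp: case_prod_unfold)
  also have "\<dots> = (\<Oplus>p\<in>{(a, b). f a \<noteq> \<zero> \<and> g b \<noteq> \<zero> \<and> a \<otimes>\<^bsub>N\<^esub> b = m}. f (fst p) \<otimes> g (snd p))"
  proof (rule add.finprod_mono_neutral_cong_right)
    show "finite (?A \<times> ?B)" using A B by simp
    show "f (fst p) \<otimes> (g (snd p) \<otimes> delta R (fst p \<otimes>\<^bsub>N\<^esub> snd p) m) = \<zero>"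
      if "p \<in> ?A \<times> ?B - {(a, b). f a \<noteq> \<zero> \<and> g b \<noteq> \<zero> \<and> a \<otimes>\<^bsub>N\<^esub> b = m}" for p
      using that A(3) B(3) by (cases p) (auto simp: delta_def)
    show "f (fst p) \<otimes> (g (snd p) \<otimes> delta R (fst p \<otimes>\<^bsub>N\<^esub> snd p) m) = f (fst p) \<otimes> g (snd p)"
      if "p \<in> {(a, b). f a \<noteq> \<zero> \<and> g b \<noteq> \<zero> \<and> a \<otimes>\<^bsub>N\<^esub> b = m}" for p
      using that A(3) B(3) by (cases p) (auto simp: delta_def)
  qed (use A B d in auto)
  also have "\<dots> = (f \<otimes>\<^bsub>MA\<^esub> g) m"
    by (simp add: monoid_algebra_def case_prod_unfold)
  finally show "(f \<otimes>\<^bsub>MA\<^esub> g) m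
    = linear_ext R MA (\<lambda>a. translate a g) f m" by simp
qed

text \<open>With the algebra itself as target this rewrites both bracketings of a triple product to the same
  threefold extension. With the ground ring as target it evaluates a functional on a product.\<close>

lemma linear_ext_conv:
  assumes f: "f \<in> carrier MA" and g: "g \<in> carrier MA" and V: "module R V"
    and \<phi>: "\<And>a. a \<in> carrier N \<Longrightarrow> \<phi> a \<in> carrier V"
  shows "linear_ext R V \<phi> (f \<otimes>\<^bsub>MA\<^esub> g)
    = linear_ext R V (\<lambda>a. linear_ext R V (\<lambda>b. \<phi> (a \<otimes>\<^bsub>N\<^esub> b)) g) f"
proof -
  interpret V: module R V by fact
  interpret MA: module R MA by (rule module_monoid_algebra)
  interpret T: mod_hom R MA V "linear_ext R V \<phi>"
    by (rule linear_ext_hom_MA[OF V \<phi>])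
  have inner: "translate a g \<in> carrier MA" if "a \<in> carrier N" for a
    using that g by (intro MA.linear_ext_closed[of g "carrier N"]) auto
  have step: "linear_ext R V \<phi> (translate a g)
      = linear_ext R V (\<lambda>b. \<phi> (a \<otimes>\<^bsub>N\<^esub> b)) g" if a: "a \<in> carrier N" for a
  proof -
    have "linear_ext R V \<phi> (translate a g)
        = linear_ext R V (\<lambda>b. linear_ext R V \<phi> (delta R (a \<otimes>\<^bsub>N\<^esub> b))) g"
      using g a by (intro T.linear_ext[of g "carrier N"]) auto
    also have "\<dots> = linear_ext R V (\<lambda>b. \<phi> (a \<otimes>\<^bsub>N\<^esub> b)) g"
      using g a \<phi> by (intro V.linear_ext_cong[of g "carrier N"]) (auto simp: V.linear_ext_delta)
    finally show ?thesis .
  qed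
  have "linear_ext R V \<phi> (f \<otimes>\<^bsub>MA\<^esub> g)
      = linear_ext R V (\<lambda>a. linear_ext R V \<phi> (translate a g)) f"
    unfolding conv_eq_linear_ext[OF f g] using f inner by (intro T.linear_ext[of f "carrier N"]) auto
  also have "\<dots> = linear_ext R V (\<lambda>a. linear_ext R V (\<lambda>b. \<phi> (a \<otimes>\<^bsub>N\<^esub> b)) g) f"
  proof (rule V.linear_ext_cong[of f "carrier N"])
    show "linear_ext R V (\<lambda>b. \<phi> (a \<otimes>\<^bsub>N\<^esub> b)) g \<in> carrier V" if "a \<in> carrier N" for a
      using that g \<phi> by (intro V.linear_ext_closed[of g "carrier N"]) auto
  qed (use f step in auto)
  finally show ?thesis .
qed

lemma delta_conv:
  assumes "a \<in> carrier N" "b \<in> carrier N"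
  shows "delta R a \<otimes>\<^bsub>MA\<^esub> delta R b = delta R (a \<otimes>\<^bsub>N\<^esub> b)"
proof -
  interpret MA: module R MA by (rule module_monoid_algebra)
  show ?thesis using assms
    by (simp add: conv_eq_linear_ext MA.linear_ext_delta)
qed

lemma assoc_algebra_monoid_algebra: "assoc_algebra R MA"
proof -
  interpret MA: module R MA by (rule module_monoid_algebra)
  have id: "linear_ext R MA (delta R) f = f" if "f \<in> carrier MA" for f
    using that linear_ext_delta_id[of f "carrier N"] by (simp add: linear_ext_monoid_algebra)
  have cl: "translate a g \<in> carrier MA"
    if "a \<in> carrier N" "g \<in> carrier MA" for a g
    using that by (intro MA.linear_ext_closed[of g "carrier N"]) auto
  have closed: "f \<otimes>\<^bsub>MA\<^esub> g \<in> carrier MA" if "f \<in> carrier MA" "g \<in> carrier MA" for f g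
    unfolding conv_eq_linear_ext[OF that] using that cl
    by (intro MA.linear_ext_closed[of f "carrier N"]) auto
  have homL: "mod_hom R MA MA (\<lambda>f. f \<otimes>\<^bsub>MA\<^esub> g)" if g: "g \<in> carrier MA" for g
  proof -
    interpret T: mod_hom R MA MA "linear_ext R MA (\<lambda>a. translate a g)"
      by (rule linear_ext_hom_MA[OF MA.module_axioms cl[OF _ g]])
    show ?thesis
    proof (intro mod_hom.intro mod_hom_axioms.intro module_homI MA.module_axioms)
      fix x y assume xy: "x \<in> carrier MA" "y \<in> carrier MA"
      then show "(x \<oplus>\<^bsub>MA\<^esub> y) \<otimes>\<^bsub>MA\<^esub> g = x \<otimes>\<^bsub>MA\<^esub> g \<oplus>\<^bsub>MA\<^esub> y \<otimes>\<^bsub>MA\<^esub> g"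
        using T.f_add[OF xy] conv_eq_linear_ext[OF _ g] MA.M.add.m_closed[OF xy] by simp
    next
      fix a x assume ax: "a \<in> carrier R" "x \<in> carrier MA"
      then show "(a \<odot>\<^bsub>MA\<^esub> x) \<otimes>\<^bsub>MA\<^esub> g = a \<odot>\<^bsub>MA\<^esub> (x \<otimes>\<^bsub>MA\<^esub> g)"
        using T.f_smult[OF ax] conv_eq_linear_ext[OF _ g] MA.smult_closed[OF ax] by simp
    qed (use g closed in blast)
  qed
  have homR: "mod_hom R MA MA (\<lambda>g. f \<otimes>\<^bsub>MA\<^esub> g)" if f: "f \<in> carrier MA" for f
  proof -
    have conv: "f \<otimes>\<^bsub>MA\<^esub> g = linear_ext R MA (\<lambda>b. linear_ext R MA (\<lambda>a. delta R (a \<otimes>\<^bsub>N\<^esub> b)) f) g"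
      if g: "g \<in> carrier MA" for g
      unfolding conv_eq_linear_ext[OF f g]
      using f g by (intro MA.linear_ext_swap[of f "carrier N" g "carrier N"]) auto
    have cl': "linear_ext R MA (\<lambda>a. delta R (a \<otimes>\<^bsub>N\<^esub> b)) f \<in> carrier MA" if "b \<in> carrier N" for b
      using that f by (intro MA.linear_ext_closed[of f "carrier N"]) auto
    interpret T: mod_hom R MA MA "linear_ext R MA (\<lambda>b. linear_ext R MA (\<lambda>a. delta R (a \<otimes>\<^bsub>N\<^esub> b)) f)"
      by (rule linear_ext_hom_MA[OF MA.module_axioms cl'])
    show ?thesis
    proof (intro mod_hom.intro mod_hom_axioms.intro module_homI MA.module_axioms)
      fix x y assume xy: "x \<in> carrier MA" "y \<in> carrier MA"
      then show "f \<otimes>\<^bsub>MA\<^esub> (x \<oplus>\<^bsub>MA\<^esub> y) = f \<otimes>\<^bsub>MA\<^esub> x \<oplus>\<^bsub>MA\<^esub> f \<otimes>\<^bsub>MA\<^esub> y"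
        using T.f_add[OF xy] conv MA.M.add.m_closed[OF xy] by simp
    next
      fix a x assume ax: "a \<in> carrier R" "x \<in> carrier MA"
      then show "f \<otimes>\<^bsub>MA\<^esub> (a \<odot>\<^bsub>MA\<^esub> x) = a \<odot>\<^bsub>MA\<^esub> (f \<otimes>\<^bsub>MA\<^esub> x)"
        using T.f_smult[OF ax] conv MA.smult_closed[OF ax] by simp
    qed (use f closed in blast)
  qed
  have assoc: "(f \<otimes>\<^bsub>MA\<^esub> g) \<otimes>\<^bsub>MA\<^esub> h = f \<otimes>\<^bsub>MA\<^esub> (g \<otimes>\<^bsub>MA\<^esub> h)"
    if f: "f \<in> carrier MA" and g: "g \<in> carrier MA" and h: "h \<in> carrier MA" for f g h
  proof -
    let ?\<Psi> = "\<lambda>a. linear_ext R MA (\<lambda>b. linear_ext R MA (\<lambda>c. delta R (a \<otimes>\<^bsub>N\<^esub> (b \<otimes>\<^bsub>N\<^esub> c))) h) g"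
    have cl3: "linear_ext R MA (\<lambda>c. delta R (a \<otimes>\<^bsub>N\<^esub> (b \<otimes>\<^bsub>N\<^esub> c))) h \<in> carrier MA"
      if "a \<in> carrier N" "b \<in> carrier N" for a b
      using that h by (intro MA.linear_ext_closed[of h "carrier N"]) auto
    have cl2: "?\<Psi> a \<in> carrier MA" if "a \<in> carrier N" for a
      using that cl3 g by (intro MA.linear_ext_closed[of g "carrier N"]) auto
    have "(f \<otimes>\<^bsub>MA\<^esub> g) \<otimes>\<^bsub>MA\<^esub> h
        = linear_ext R MA (\<lambda>a. linear_ext R MA (\<lambda>b.
            linear_ext R MA (\<lambda>c. delta R ((a \<otimes>\<^bsub>N\<^esub> b) \<otimes>\<^bsub>N\<^esub> c)) h) g) f"
      unfolding conv_eq_linear_ext[OF closed[OF f g] h]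
      using f g h cl by (intro linear_ext_conv MA.module_axioms) auto
    also have "\<dots> = linear_ext R MA ?\<Psi> f"
      using f cl2
    proof (intro MA.linear_ext_cong[of f "carrier N"])
      fix a assume a: "a \<in> carrier N"
      show "linear_ext R MA (\<lambda>b. linear_ext R MA (\<lambda>c. delta R ((a \<otimes>\<^bsub>N\<^esub> b) \<otimes>\<^bsub>N\<^esub> c)) h) g = ?\<Psi> a"
      proof (intro MA.linear_ext_cong[of g "carrier N"])
        fix b assume b: "b \<in> carrier N"
        show "linear_ext R MA (\<lambda>c. delta R ((a \<otimes>\<^bsub>N\<^esub> b) \<otimes>\<^bsub>N\<^esub> c)) h
          = linear_ext R MA (\<lambda>c. delta R (a \<otimes>\<^bsub>N\<^esub> (b \<otimes>\<^bsub>N\<^esub> c))) h"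
          using a b h by (intro MA.linear_ext_cong[of h "carrier N"]) (auto simp: N.m_assoc)
      qed (use g a cl3 in auto)
    qed auto
    also have "\<dots> = f \<otimes>\<^bsub>MA\<^esub> (g \<otimes>\<^bsub>MA\<^esub> h)"
      unfolding conv_eq_linear_ext[OF f closed[OF g h]]
    proof (intro MA.linear_ext_cong[of f "carrier N", symmetric])
      fix a assume a: "a \<in> carrier N"
      show "linear_ext R MA (\<lambda>b. delta R (a \<otimes>\<^bsub>N\<^esub> b)) (g \<otimes>\<^bsub>MA\<^esub> h) = ?\<Psi> a"
        using g h a by (intro linear_ext_conv MA.module_axioms) auto
    qed (use f cl2 in auto)
    finally show ?thesis .
  qed
  have ring: "ring MA"
  proof (rule ringI)
    show "abelian_group MA" by (rule MA.abelian_group_axioms)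
    show "Group.monoid MA"
    proof (rule monoidI)
      have one: "delta R \<one>\<^bsub>N\<^esub> \<in> carrier MA" by simp
      show "\<one>\<^bsub>MA\<^esub> \<in> carrier MA" by simp
      fix f assume f: "f \<in> carrier MA"
      have "\<one>\<^bsub>MA\<^esub> \<otimes>\<^bsub>MA\<^esub> f = linear_ext R MA (\<lambda>b. delta R (\<one>\<^bsub>N\<^esub> \<otimes>\<^bsub>N\<^esub> b)) f"
        using conv_eq_linear_ext[OF one f] cl[OF N.one_closed f] by (simp add: MA.linear_ext_delta)
      also have "\<dots> = linear_ext R MA (\<lambda>b. delta R b) f"
        using f by (intro MA.linear_ext_cong[of f "carrier N"]) auto
      finally show "\<one>\<^bsub>MA\<^esub> \<otimes>\<^bsub>MA\<^esub> f = f" using id f by simp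
      have "f \<otimes>\<^bsub>MA\<^esub> \<one>\<^bsub>MA\<^esub> = linear_ext R MA (\<lambda>a. linear_ext R MA (\<lambda>b. delta R (a \<otimes>\<^bsub>N\<^esub> b)) (delta R \<one>\<^bsub>N\<^esub>)) f"
        using conv_eq_linear_ext[OF f one] by simp
      also have "\<dots> = linear_ext R MA (\<lambda>b. delta R b) f"
        using f by (intro MA.linear_ext_cong[of f "carrier N"]) (auto simp: MA.linear_ext_delta)
      finally show "f \<otimes>\<^bsub>MA\<^esub> \<one>\<^bsub>MA\<^esub> = f" using id f by simp
    qed (use closed assoc in \<open>auto simp del: monoid_algebra_simps(1)\<close>)
  next
    fix x y z assume xyz: "x \<in> carrier MA" "y \<in> carrier MA" "z \<in> carrier MA"
    show "(x \<oplus>\<^bsub>MA\<^esub> y) \<otimes>\<^bsub>MA\<^esub> z = x \<otimes>\<^bsub>MA\<^esub> z \<oplus>\<^bsub>MA\<^esub> y \<otimes>\<^bsub>MA\<^esub> z"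
      by (rule mod_hom_add[OF homL[OF xyz(3)] xyz(1,2)])
    show "z \<otimes>\<^bsub>MA\<^esub> (x \<oplus>\<^bsub>MA\<^esub> y) = z \<otimes>\<^bsub>MA\<^esub> x \<oplus>\<^bsub>MA\<^esub> z \<otimes>\<^bsub>MA\<^esub> y"
      by (rule mod_hom_add[OF homR[OF xyz(3)] xyz(1,2)])
  qed
  show ?thesis
  proof (intro assoc_algebra.intro assoc_algebra_axioms.intro MA.module_axioms ring)
    fix a x y assume axy: "a \<in> carrier R" "x \<in> carrier MA" "y \<in> carrier MA"
    show "(a \<odot>\<^bsub>MA\<^esub> x) \<otimes>\<^bsub>MA\<^esub> y = a \<odot>\<^bsub>MA\<^esub> (x \<otimes>\<^bsub>MA\<^esub> y)"
      by (rule mod_hom_smult[OF homL[OF axy(3)] axy(1,2)])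
    show "x \<otimes>\<^bsub>MA\<^esub> (a \<odot>\<^bsub>MA\<^esub> y) = a \<odot>\<^bsub>MA\<^esub> (x \<otimes>\<^bsub>MA\<^esub> y)"
      by (rule mod_hom_smult[OF homR[OF axy(2)] axy(1,3)])
  qed
qed

end

section \<open>Quotients\<close>

lemma quot_module_simps:
  "carrier (quot_module M N) = a_rcosets\<^bsub>M\<^esub> N"
  "ring.zero (quot_module M N) = N"
  "ring.add (quot_module M N) = set_add M"
  "monoid.mult (quot_module M N) = rcoset_mult M N"
  "one (quot_module M N) = N +>\<^bsub>M\<^esub> \<one>\<^bsub>M\<^esub>"
  "smult (quot_module M N) = (\<lambda>a C. \<Union>x\<in>C. N +>\<^bsub>M\<^esub> (a \<odot>\<^bsub>M\<^esub> x))"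
  by (simp_all add: quot_module_def ring.defs module.defs FactRing_def)

locale module_quotient = module R M + sub: submodule R N M for R and M (structure) and N
begin

abbreviation "Q \<equiv> quot_module M N"
abbreviation "\<pi> x \<equiv> N +>\<^bsub>M\<^esub> x"

sublocale abelian_subgroup N M
proof (rule abelian_subgroupI3)
  have "\<ominus> x \<in> N" if "x \<in> N" for x
  proof -
    have "\<ominus> x = (\<ominus>\<^bsub>R\<^esub> \<one>\<^bsub>R\<^esub>) \<odot> x"
      using that sub.subset by (simp add: smult_l_minus subset_eq)
    then show ?thesis using that by simp
  qed
  then show "additive_subgroup N M"
    using sub.subset by (intro additive_subgroupI subgroup.intro) (auto simp: a_inv_def)
qed (rule abelian_group_axioms)

lemma proj_eq_iff:
  assumes x: "x \<in> carrier M" and y: "y \<in> carrier M"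
  shows "\<pi> x = \<pi> y \<longleftrightarrow> x \<ominus> y \<in> N"
proof -
  have "\<pi> x = \<pi> y \<longleftrightarrow> x \<in> \<pi> y"
    using a_repr_independence'[OF _ y, of x] a_repr_independenceD[OF x, of y] by metis
  also have "\<dots> \<longleftrightarrow> x \<ominus> y \<in> N"
    unfolding a_minus_def by (rule a_rcos_module[OF y x])
  finally show ?thesis .
qed

lemma proj_eq_zero_iff: "x \<in> carrier M \<Longrightarrow> \<pi> x = \<zero>\<^bsub>Q\<^esub> \<longleftrightarrow> x \<in> N"
  using a_coset_join2[of x N] a_subgroup a_rcos_self[of x] by (auto simp: quot_module_simps)

lemma carrier_quot: "carrier Q = \<pi> ` carrier M"
  by (auto simp: quot_module_simps A_RCOSETS_def')

lemma proj_closed [simp, intro]: "x \<in> carrier M \<Longrightarrow> \<pi> x \<in> carrier Q"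
  by (auto simp: carrier_quot)

lemma quotE:
  assumes "C \<in> carrier Q" obtains x where "x \<in> carrier M" "C = \<pi> x"
  using assms by (auto simp: carrier_quot)

lemma proj_add: "x \<in> carrier M \<Longrightarrow> y \<in> carrier M \<Longrightarrow> \<pi> x \<oplus>\<^bsub>Q\<^esub> \<pi> y = \<pi> (x \<oplus> y)"
  by (simp add: quot_module_simps a_rcos_sum)

lemma proj_smult:
  assumes "a \<in> carrier R" "x \<in> carrier M"
  shows "a \<odot>\<^bsub>Q\<^esub> \<pi> x = \<pi> (a \<odot> x)"
proof -
  have "\<pi> (a \<odot> y) = \<pi> (a \<odot> x)" if y: "y \<in> \<pi> x" for y
  proof -
    have yc: "y \<in> carrier M" using y assms a_elemrcos_carrier by blast
    have "y \<ominus> x \<in> N"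
      unfolding a_minus_def using y a_rcos_module[OF assms(2) yc] by blast
    then have "a \<odot> (y \<ominus> x) \<in> N" using assms by simp
    moreover have "a \<odot> (y \<ominus> x) = (a \<odot> y) \<ominus> (a \<odot> x)"
      using assms yc by (simp add: a_minus_def smult_r_distr smult_r_minus)
    ultimately show ?thesis
      using assms yc by (subst proj_eq_iff) auto
  qed
  moreover have "x \<in> \<pi> x" using assms a_rcos_self by blast
  ultimately have "(\<Union>y\<in>\<pi> x. \<pi> (a \<odot> y)) = \<pi> (a \<odot> x)" by blast
  then show ?thesis by (simp only: quot_module_simps)
qed

lemma proj_zero: "\<pi> \<zero> = \<zero>\<^bsub>Q\<^esub>"
  by (simp add: proj_eq_zero_iff)

lemma module_quot: "module R Q"
proof (rule moduleI)
  show "abelian_group Q"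
  proof (rule abelian_groupI)
    fix C assume "C \<in> carrier Q"
    then obtain x where x: "x \<in> carrier M" "C = \<pi> x" by (rule quotE)
    then show "\<zero>\<^bsub>Q\<^esub> \<oplus>\<^bsub>Q\<^esub> C = C"
      by (simp add: proj_zero[symmetric] proj_add)
    from x show "\<exists>D\<in>carrier Q. D \<oplus>\<^bsub>Q\<^esub> C = \<zero>\<^bsub>Q\<^esub>"
      by (intro bexI[of _ "\<pi> (\<ominus> x)"]) (simp_all add: proj_add l_neg proj_zero)
    fix D assume "D \<in> carrier Q"
    then obtain y where y: "y \<in> carrier M" "D = \<pi> y" by (rule quotE)
    with x show "C \<oplus>\<^bsub>Q\<^esub> D \<in> carrier Q" "C \<oplus>\<^bsub>Q\<^esub> D = D \<oplus>\<^bsub>Q\<^esub> C"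
      by (simp_all add: proj_add a_comm)
    fix E assume "E \<in> carrier Q"
    then obtain z where "z \<in> carrier M" "E = \<pi> z" by (rule quotE)
    with x y show "(C \<oplus>\<^bsub>Q\<^esub> D) \<oplus>\<^bsub>Q\<^esub> E = C \<oplus>\<^bsub>Q\<^esub> (D \<oplus>\<^bsub>Q\<^esub> E)"
      by (simp add: proj_add a_assoc)
  qed (simp add: proj_zero[symmetric])
  fix a C assume a: "a \<in> carrier R" and "C \<in> carrier Q"
  then obtain x where x: "x \<in> carrier M" "C = \<pi> x" by (metis quotE)
  with a show "a \<odot>\<^bsub>Q\<^esub> C \<in> carrier Q" by (simp add: proj_smult)
next
  fix C assume "C \<in> carrier Q"
  then obtain x where "x \<in> carrier M" "C = \<pi> x" by (rule quotE)
  then show "\<one>\<^bsub>R\<^esub> \<odot>\<^bsub>Q\<^esub> C = C" by (simp add: proj_smult)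
next
  fix a b C assume a: "a \<in> carrier R" "b \<in> carrier R" and "C \<in> carrier Q"
  then obtain x where x: "x \<in> carrier M" "C = \<pi> x" by (metis quotE)
  with a show "(a \<oplus>\<^bsub>R\<^esub> b) \<odot>\<^bsub>Q\<^esub> C = a \<odot>\<^bsub>Q\<^esub> C \<oplus>\<^bsub>Q\<^esub> b \<odot>\<^bsub>Q\<^esub> C"
      and "(a \<otimes>\<^bsub>R\<^esub> b) \<odot>\<^bsub>Q\<^esub> C = a \<odot>\<^bsub>Q\<^esub> (b \<odot>\<^bsub>Q\<^esub> C)"
      by (simp_all add: proj_smult proj_add smult_l_distr smult_assoc1)
next
  fix a C D assume a: "a \<in> carrier R" and "C \<in> carrier Q" "D \<in> carrier Q"
  then obtain x y where "x \<in> carrier M" "C = \<pi> x" "y \<in> carrier M" "D = \<pi> y" by (metis quotE)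
  with a show "a \<odot>\<^bsub>Q\<^esub> (C \<oplus>\<^bsub>Q\<^esub> D) = a \<odot>\<^bsub>Q\<^esub> C \<oplus>\<^bsub>Q\<^esub> a \<odot>\<^bsub>Q\<^esub> D"
    by (simp add: proj_smult proj_add smult_r_distr)
qed (rule R.is_cring)

sublocale proj: mod_hom R M Q \<pi>
  by (intro mod_hom.intro mod_hom_axioms.intro module_homI module_axioms module_quot)
    (auto simp: proj_add proj_smult)

end

locale algebra_quotient = assoc_algebra R M + ideal I M for R and M (structure) and I
begin

sublocale module_quotient R M I
proof (intro module_quotient.intro module_axioms submodule.intro)
  show "a \<odot> x \<in> I" if "a \<in> carrier R" "x \<in> I" for a x
  proof -
    \<comment> \<open>Scalars act through multiples of the unit, and these stay in the ideal.\<close>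
    have "a \<odot> x = (a \<odot> \<one>) \<otimes> x"
      using that a_subset by (subst smult_mult_l) auto
    then show ?thesis using that I_l_closed by simp
  qed
qed (use a_subset in auto)

lemma proj_mult: "x \<in> carrier M \<Longrightarrow> y \<in> carrier M \<Longrightarrow> \<pi> x \<otimes>\<^bsub>Q\<^esub> \<pi> y = \<pi> (x \<otimes> y)"
  by (simp add: quot_module_simps rcoset_mult_add)

lemma proj_one: "\<pi> \<one> = \<one>\<^bsub>Q\<^esub>"
  by (simp add: quot_module_simps)

lemma assoc_algebra_quot: "assoc_algebra R Q"
proof (intro assoc_algebra.intro assoc_algebra_axioms.intro module_quot ringI)
  show "abelian_group Q" using module_quot by (simp add: module_def)
  show "Group.monoid Q"
  proof (rule monoidI)
    fix C assume "C \<in> carrier Q"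
    then obtain x where x: "x \<in> carrier M" "C = \<pi> x" by (rule quotE)
    then show "\<one>\<^bsub>Q\<^esub> \<otimes>\<^bsub>Q\<^esub> C = C" "C \<otimes>\<^bsub>Q\<^esub> \<one>\<^bsub>Q\<^esub> = C"
      by (simp_all add: proj_one[symmetric] proj_mult)
    fix D assume "D \<in> carrier Q"
    then obtain y where y: "y \<in> carrier M" "D = \<pi> y" by (rule quotE)
    with x show "C \<otimes>\<^bsub>Q\<^esub> D \<in> carrier Q" by (simp add: proj_mult)
    fix E assume "E \<in> carrier Q"
    then obtain z where "z \<in> carrier M" "E = \<pi> z" by (rule quotE)
    with x y show "(C \<otimes>\<^bsub>Q\<^esub> D) \<otimes>\<^bsub>Q\<^esub> E = C \<otimes>\<^bsub>Q\<^esub> (D \<otimes>\<^bsub>Q\<^esub> E)"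
      by (simp add: proj_mult A.m_assoc)
  qed (simp add: proj_one[symmetric])
next
  fix C D E assume "C \<in> carrier Q" "D \<in> carrier Q" "E \<in> carrier Q"
  then obtain x y z where x: "x \<in> carrier M" and C: "C = \<pi> x" and y: "y \<in> carrier M"
    and D: "D = \<pi> y" and z: "z \<in> carrier M" and E: "E = \<pi> z"
    by (metis quotE)
  note pm = proj_mult[OF M.add.m_closed[OF x y] z] proj_mult[OF z M.add.m_closed[OF x y]]
    proj_mult[OF x z] proj_mult[OF y z] proj_mult[OF z x] proj_mult[OF z y]
  show "(C \<oplus>\<^bsub>Q\<^esub> D) \<otimes>\<^bsub>Q\<^esub> E = C \<otimes>\<^bsub>Q\<^esub> E \<oplus>\<^bsub>Q\<^esub> D \<otimes>\<^bsub>Q\<^esub> E"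
    unfolding C D E proj_add[OF x y] pm A.l_distr[OF x y z]
      proj_add[OF A.m_closed[OF x z] A.m_closed[OF y z]] ..
  show "E \<otimes>\<^bsub>Q\<^esub> (C \<oplus>\<^bsub>Q\<^esub> D) = E \<otimes>\<^bsub>Q\<^esub> C \<oplus>\<^bsub>Q\<^esub> E \<otimes>\<^bsub>Q\<^esub> D"
    unfolding C D E proj_add[OF x y] pm A.r_distr[OF x y z]
      proj_add[OF A.m_closed[OF z x] A.m_closed[OF z y]] ..
next
  fix a C D assume a: "a \<in> carrier R" and "C \<in> carrier Q" "D \<in> carrier Q"
  then obtain x y where x: "x \<in> carrier M" and C: "C = \<pi> x" and y: "y \<in> carrier M" and D: "D = \<pi> y"
    by (metis quotE)
  note cl = smult_closed[OF a x] smult_closed[OF a y]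
  show "(a \<odot>\<^bsub>Q\<^esub> C) \<otimes>\<^bsub>Q\<^esub> D = a \<odot>\<^bsub>Q\<^esub> (C \<otimes>\<^bsub>Q\<^esub> D)"
    unfolding C D proj_smult[OF a x] proj_mult[OF cl(1) y] proj_mult[OF x y]
      proj_smult[OF a A.m_closed[OF x y]] smult_mult_l[OF a x y] ..
  show "C \<otimes>\<^bsub>Q\<^esub> (a \<odot>\<^bsub>Q\<^esub> D) = a \<odot>\<^bsub>Q\<^esub> (C \<otimes>\<^bsub>Q\<^esub> D)"
    unfolding C D proj_smult[OF a y] proj_mult[OF x cl(2)] proj_mult[OF x y]
      proj_smult[OF a A.m_closed[OF x y]] smult_mult_r[OF a x y] ..
qed

end

section \<open>Divided difference operators on dual functions\<close>

lemma inv_simple_refl [simp]: "inv' (simple_refl i) = simple_refl i"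
  by (rule inv_unique_comp) (auto simp: simple_refl_def)

lemma simple_refl_simps [simp]:
  "simple_refl i i = Suc i" "simple_refl i (Suc i) = i" "simple_refl i (simple_refl i k) = k"
  "k \<noteq> i \<Longrightarrow> k \<noteq> Suc i \<Longrightarrow> simple_refl i k = k"
  by (auto simp: simple_refl_def transpose_def)

lemma simple_refl_mem [simp]: "i \<in> {1..<n} \<Longrightarrow> k \<in> {1..n} \<Longrightarrow> simple_refl i k \<in> {1..n}"
  by (auto simp: simple_refl_def transpose_def)

lemma simple_refl_mem_iff: "i \<in> {1..<n} \<Longrightarrow> simple_refl i k \<in> {1..n} \<longleftrightarrow> k \<in> {1..n}"
  by (metis simple_refl_mem simple_refl_simps(3))

lemma simple_refl_inj: "simple_refl i j = simple_refl i k \<longleftrightarrow> j = k"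
  by (metis simple_refl_simps(3))

lemma simple_refl_comm:
  "Suc i < j \<Longrightarrow> simple_refl i (simple_refl j k) = simple_refl j (simple_refl i k)"
  by (auto simp: simple_refl_def transpose_def)

lemma simple_refl_braid:
  "simple_refl i (simple_refl (Suc i) (simple_refl i k))
    = simple_refl (Suc i) (simple_refl i (simple_refl (Suc i) k))"
  by (auto simp: simple_refl_def transpose_def)

lemma sum_fun_apply: "(\<Sum>h\<in>A. f h) x = (\<Sum>h\<in>A. f h x)" for f :: "'h \<Rightarrow> 'x \<Rightarrow> 'y :: comm_monoid_add"
  by (induction A rule: infinite_finite_induct) auto

text \<open>Multiplication by the \<open>j\<close>-th variable, seen on the exponents of monomials.\<close>

definition bump :: "nat \<Rightarrow> (nat \<Rightarrow> nat) \<Rightarrow> nat \<Rightarrow> nat"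
  where "bump j \<alpha> = \<alpha>(j := Suc (\<alpha> j))"

lemma bump_comm: "bump i (bump j \<alpha>) = bump j (bump i \<alpha>)"
  by (auto simp: bump_def fun_eq_iff)

text \<open>Only the exponents in \<open>J\<close> are reduced to zero; the others are arbitrary. A relation that involves
  a few variables is thus proved by induction on their degree alone.\<close>

lemma bump_induct [consumes 1, case_names zero bump]:
  assumes "finite J" "\<And>\<alpha>. (\<And>j. j \<in> J \<Longrightarrow> \<alpha> j = 0) \<Longrightarrow> P \<alpha>"
    and "\<And>\<alpha> j. j \<in> J \<Longrightarrow> P \<alpha> \<Longrightarrow> P (bump j \<alpha>)"
  shows "P \<alpha>"
proof (induction "\<Sum>j\<in>J. \<alpha> j" arbitrary: \<alpha>)
  case 0
  then show ?case using assms(1,2) by simp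
next
  case (Suc k)
  then obtain j where j: "j \<in> J" "\<alpha> j \<noteq> 0" by (metis nat.distinct(1) sum.neutral)
  let ?\<beta> = "\<alpha>(j := \<alpha> j - 1)"
  have \<alpha>: "\<alpha> = bump j ?\<beta>" using j by (auto simp: bump_def)
  have "(\<Sum>j\<in>J. \<alpha> j) = Suc (\<Sum>j\<in>J. ?\<beta> j)"
    using j assms(1) by (subst (1 2) sum.remove[of _ j]) auto
  then have "k = (\<Sum>j\<in>J. ?\<beta> j)" using Suc.hyps(2) by simp
  then have "P ?\<beta>" by (rule Suc.hyps(1))
  then show ?case using assms(3) j(1) \<alpha> by metis
qed

locale wreath_group =
  G: group G for G :: "('g, 'c) monoid_scheme" and n :: nat +
  assumes finite_G: "finite (carrier G)"
begin

abbreviation "GN \<equiv> group_pow G n"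

sublocale GN: group GN
  unfolding group_pow_def by (rule product_group) (rule G.group_axioms)

lemma bij_inv_G: "bij_betw (\<lambda>h. inv\<^bsub>G\<^esub> h) (carrier G) (carrier G)"
  by (rule bij_betw_byWitness[where f' = "\<lambda>h. inv\<^bsub>G\<^esub> h"]) auto

lemma GN_carrier: "carrier GN = {1..n} \<rightarrow>\<^sub>E carrier G"
  by (simp add: group_pow_def)

lemma GN_mult: "g \<otimes>\<^bsub>GN\<^esub> h = (\<lambda>k\<in>{1..n}. g k \<otimes>\<^bsub>G\<^esub> h k)"
  by (simp add: group_pow_def)

lemma GN_one: "\<one>\<^bsub>GN\<^esub> = (\<lambda>k\<in>{1..n}. \<one>\<^bsub>G\<^esub>)"
  by (simp add: group_pow_def)

text \<open>The action of the \<open>i\<close>-th simple reflection on the base group.\<close>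

definition sact :: "nat \<Rightarrow> (nat \<Rightarrow> 'g) \<Rightarrow> nat \<Rightarrow> 'g"
  where "sact i g = perm_act n (simple_refl i) g"

lemma sact_eq: "sact i g = (\<lambda>k\<in>{1..n}. g (simple_refl i k))"
  by (simp add: sact_def perm_act_def)

lemma sact_closed [simp]: "i \<in> {1..<n} \<Longrightarrow> g \<in> carrier GN \<Longrightarrow> sact i g \<in> carrier GN"
  by (auto simp: sact_eq GN_carrier simple_refl_mem_iff simp del: atLeastAtMost_iff One_nat_def)

lemma sact_sact [simp]: "i \<in> {1..<n} \<Longrightarrow> g \<in> carrier GN \<Longrightarrow> sact i (sact i g) = g"
  by (auto simp: sact_eq GN_carrier simple_refl_mem_iff fun_eq_iff PiE_def extensional_def
      simp del: atLeastAtMost_iff One_nat_def)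

text \<open>The summand of \<open>t\<^sub>i\<^sub>j\<close> that belongs to a group element.\<close>

definition tw :: "nat \<Rightarrow> nat \<Rightarrow> 'g \<Rightarrow> nat \<Rightarrow> 'g"
  where "tw i j h = in_factor G n i h \<otimes>\<^bsub>GN\<^esub> in_factor G n j (inv\<^bsub>G\<^esub> h)"

lemma tw_eq:
  assumes "i \<noteq> j" "h \<in> carrier G"
  shows "tw i j h = (\<lambda>k\<in>{1..n}. if k = i then h else if k = j then inv\<^bsub>G\<^esub> h else \<one>\<^bsub>G\<^esub>)"
  using assms by (auto simp: tw_def GN_mult in_factor_def fun_eq_iff)

lemma tw_closed [simp]:
  assumes "h \<in> carrier G"
  shows "tw i j h \<in> carrier GN"
  unfolding tw_def using assms
  by (intro GN.m_closed) (auto simp: in_factor_def GN_carrier)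

lemma tw_swap: "i \<noteq> j \<Longrightarrow> h \<in> carrier G \<Longrightarrow> tw j i h = tw i j (inv\<^bsub>G\<^esub> h)"
  by (auto simp: tw_eq fun_eq_iff)

lemma sact_tw:
  assumes "l \<in> {1..<n}" "i \<noteq> j" "h \<in> carrier G"
  shows "sact l (tw i j h) = tw (simple_refl l i) (simple_refl l j) h"
proof -
  have "simple_refl l k = i \<longleftrightarrow> k = simple_refl l i" for k i
    by (metis simple_refl_simps(3))
  then show ?thesis
    using assms by (auto simp: tw_eq sact_eq simple_refl_inj simple_refl_mem_iff fun_eq_iff
        simp del: atLeastAtMost_iff atLeastLessThan_iff One_nat_def)
qed

text \<open>Summed over \<open>h\<close>, this says that \<open>t g = (s\<^sub>i g) t\<close> for \<open>t = t\<^sub>i\<^sub>,\<^sub>i\<^sub>+\<^sub>1\<close>: the two sides differ by the bijective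
  substitution \<open>h \<mapsto> g\<^sub>i\<^sub>+\<^sub>1\<inverse> h g\<^sub>i\<close>.\<close>

lemma tw_mult:
  assumes "i \<in> {1..<n}" "g \<in> carrier GN" "h \<in> carrier G"
  shows "tw i (Suc i) h \<otimes>\<^bsub>GN\<^esub> g
    = sact i g \<otimes>\<^bsub>GN\<^esub> tw i (Suc i) (inv\<^bsub>G\<^esub> g (Suc i) \<otimes>\<^bsub>G\<^esub> h \<otimes>\<^bsub>G\<^esub> g i)"
proof -
  have g: "g k \<in> carrier G" if "k \<in> {1..n}" for k
    using that assms(2) by (auto simp: GN_carrier)
  have gi: "g i \<in> carrier G" "g (Suc i) \<in> carrier G" using assms by (auto intro!: g)
  have 1: "g (Suc i) \<otimes>\<^bsub>G\<^esub> (inv\<^bsub>G\<^esub> g (Suc i) \<otimes>\<^bsub>G\<^esub> h \<otimes>\<^bsub>G\<^esub> g i) = h \<otimes>\<^bsub>G\<^esub> g i"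
    using gi assms(3) by (simp add: G.m_assoc[symmetric])
  have 2: "g i \<otimes>\<^bsub>G\<^esub> inv\<^bsub>G\<^esub> (inv\<^bsub>G\<^esub> g (Suc i) \<otimes>\<^bsub>G\<^esub> h \<otimes>\<^bsub>G\<^esub> g i) = inv\<^bsub>G\<^esub> h \<otimes>\<^bsub>G\<^esub> g (Suc i)"
    using gi assms(3) by (simp add: G.m_assoc[symmetric] G.inv_mult_group)
  show ?thesis
    using gi assms g 1 2 by (auto simp: tw_eq GN_mult sact_eq fun_eq_iff)
qed

end

text \<open>A set \<open>M\<close> on which the wreath product of \<open>G\<close> with the symmetric group acts, given by generators:
  \<open>act g\<close> and \<open>sg i\<close> are the actions of \<open>g\<close> and of the \<open>i\<close>-th simple reflection. Polynomials with
  coefficients in the free module on \<open>M\<close> carry a left action of the wreath Hecke algebra, the module induced from \<open>M\<close>.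
  The operators below are the transposes of the generators on the dual of that module. The dual
  consists of all functions on pairs of an exponent and a point, so no finiteness of support has to
  be maintained. The structure constants are integers, so the functions take integer values and the
  relations are checked with the algebra of the type \<open>int\<close>. Transposition reverses products: the
  relation \<open>a b = c d\<close> of generators becomes \<open>b\<^sup>t (a\<^sup>t f) = d\<^sup>t (c\<^sup>t f)\<close>.\<close>

locale wreath_set = wreath_group +
  fixes act :: "(nat \<Rightarrow> 'a) \<Rightarrow> 'm \<Rightarrow> 'm" and sg :: "nat \<Rightarrow> 'm \<Rightarrow> 'm"
  assumes act_mult: "g \<in> carrier GN \<Longrightarrow> h \<in> carrier GN \<Longrightarrow> act g (act h m) = act (g \<otimes>\<^bsub>GN\<^esub> h) m"
    and act_one: "act \<one>\<^bsub>GN\<^esub> m = m"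
    and sg_sq: "i \<in> {1..<n} \<Longrightarrow> sg i (sg i m) = m"
    and sg_comm: "i \<in> {1..<n} \<Longrightarrow> j \<in> {1..<n} \<Longrightarrow> Suc i < j \<Longrightarrow> sg i (sg j m) = sg j (sg i m)"
    and sg_braid: "i \<in> {1..<n} \<Longrightarrow> Suc i \<in> {1..<n} \<Longrightarrow>
      sg i (sg (Suc i) (sg i m)) = sg (Suc i) (sg i (sg (Suc i) m))"
    and sg_act: "i \<in> {1..<n} \<Longrightarrow> g \<in> carrier GN \<Longrightarrow> sg i (act g m) = act (sact i g) (sg i m)"
begin

definition Xop :: "nat \<Rightarrow> ((nat \<Rightarrow> nat) \<Rightarrow> 'm \<Rightarrow> int) \<Rightarrow> (nat \<Rightarrow> nat) \<Rightarrow> 'm \<Rightarrow> int"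
  where "Xop j f = (\<lambda>\<alpha>. f (bump j \<alpha>))"

definition Gop :: "(nat \<Rightarrow> 'a) \<Rightarrow> ((nat \<Rightarrow> nat) \<Rightarrow> 'm \<Rightarrow> int) \<Rightarrow> (nat \<Rightarrow> nat) \<Rightarrow> 'm \<Rightarrow> int"
  where "Gop g f = (\<lambda>\<alpha> m. f \<alpha> (act g m))"

definition Top :: "nat \<Rightarrow> nat \<Rightarrow> ((nat \<Rightarrow> nat) \<Rightarrow> 'm \<Rightarrow> int) \<Rightarrow> (nat \<Rightarrow> nat) \<Rightarrow> 'm \<Rightarrow> int"
  where "Top i j f = (\<Sum>h\<in>carrier G. Gop (tw i j h) f)"

text \<open>The two recursive cases are forced by \<open>s\<^sub>i x\<^sub>i = x\<^sub>i\<^sub>+\<^sub>1 s\<^sub>i - t\<close> and \<open>s\<^sub>i x\<^sub>i\<^sub>+\<^sub>1 = x\<^sub>i s\<^sub>i + t\<close>, which move \<open>s\<^sub>i\<close>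
  past one variable. This describes recursively the transpose of \<open>f \<mapsto> s\<^sub>i(f) s\<^sub>i - t \<partial>\<^sub>i(f)\<close>, with the
  divided difference \<open>\<partial>\<^sub>i(f) = (f - s\<^sub>i(f)) / (x\<^sub>i - x\<^sub>i\<^sub>+\<^sub>1)\<close>. If both exponents are positive, the first
  case applies.\<close>

function Sop :: "nat \<Rightarrow> ((nat \<Rightarrow> nat) \<Rightarrow> 'm \<Rightarrow> int) \<Rightarrow> (nat \<Rightarrow> nat) \<Rightarrow> 'm \<Rightarrow> int"
  where "Sop i f \<alpha> m =
    (if 0 < \<alpha> i
     then Sop i (Xop (Suc i) f) (\<alpha>(i := \<alpha> i - 1)) m - Top i (Suc i) f (\<alpha>(i := \<alpha> i - 1)) m
     else if 0 < \<alpha> (Suc i)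
     then Sop i (Xop i f) (\<alpha>(Suc i := \<alpha> (Suc i) - 1)) m
       + Top i (Suc i) f (\<alpha>(Suc i := \<alpha> (Suc i) - 1)) m
     else f \<alpha> (sg i m))"
  by auto
termination by (relation "measure (\<lambda>(i, f, \<alpha>, m). \<alpha> i + \<alpha> (Suc i))") auto

declare Sop.simps [simp del]

lemma Xop_add: "Xop j (f + g) = Xop j f + Xop j g"
  by (auto simp: Xop_def fun_eq_iff)

lemma Gop_add: "Gop g (f + f') = Gop g f + Gop g f'"
  by (auto simp: Gop_def fun_eq_iff)

lemma Top_add: "Top i j (f + g) = Top i j f + Top i j g"
  by (simp add: Top_def Gop_add sum.distrib)

lemma Xop_comm: "Xop i (Xop j f) = Xop j (Xop i f)"
  by (simp add: Xop_def bump_comm)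

lemma Xop_Gop: "Xop i (Gop g f) = Gop g (Xop i f)"
  by (simp add: Xop_def Gop_def)

lemma Xop_sum: "Xop i (\<Sum>h\<in>A. f h) = (\<Sum>h\<in>A. Xop i (f h))"
  by (simp add: Xop_def sum_fun_apply fun_eq_iff)

lemma Xop_Top: "Xop k (Top i j f) = Top i j (Xop k f)"
  by (simp add: Top_def Xop_sum Xop_Gop)

lemma Top_Xop_apply: "Top i j (Xop k f) \<alpha> m = Top i j f (bump k \<alpha>) m"
  using fun_cong[OF fun_cong[OF Xop_Top[of k i j f]], of \<alpha> m] Xop_def[of k "Top i j f"] by metis

lemma Gop_Gop: "g \<in> carrier GN \<Longrightarrow> h \<in> carrier GN \<Longrightarrow> Gop h (Gop g f) = Gop (g \<otimes>\<^bsub>GN\<^esub> h) f"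
  by (simp add: Gop_def act_mult)

lemma Gop_one: "Gop \<one>\<^bsub>GN\<^esub> f = f"
  by (simp add: Gop_def act_one)

lemma Sop_zero: "\<alpha> i = 0 \<Longrightarrow> \<alpha> (Suc i) = 0 \<Longrightarrow> Sop i f \<alpha> m = f \<alpha> (sg i m)"
  by (simp add: Sop.simps)

lemma Sop_bump: "Sop i f (bump i \<alpha>) m = Sop i (Xop (Suc i) f) \<alpha> m - Top i (Suc i) f \<alpha> m"
  by (subst Sop.simps) (simp add: bump_def)

text \<open>The order in which the recursion strips the two variables does not matter: stripping \<open>x\<^sub>i\<close> first
  produces \<open>- t\<close> and then \<open>+ t\<close>, and these cancel because \<open>t\<close> commutes with the variables.\<close>

lemma Sop_bump_Suc: "Sop i f (bump (Suc i) \<alpha>) m = Sop i (Xop i f) \<alpha> m + Top i (Suc i) f \<alpha> m"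
proof -
  have "finite {i}" by simp
  then have "\<forall>f m. Sop i f (bump (Suc i) \<alpha>) m = Sop i (Xop i f) \<alpha> m + Top i (Suc i) f \<alpha> m"
  proof (induction \<alpha> rule: bump_induct)
    case (zero \<alpha>)
    then show ?case by (subst Sop.simps) (simp add: bump_def)
  next
    case (bump \<alpha> j)
    then have IH: "Sop i f (bump (Suc i) \<alpha>) m = Sop i (Xop i f) \<alpha> m + Top i (Suc i) f \<alpha> m" and j: "j = i"
      for f m by auto
    show ?case unfolding j
      by (auto simp: bump_comm[of "Suc i" i] Sop_bump IH Xop_comm[of "Suc i" i] Top_Xop_apply)
  qed
  then show ?thesis by blast
qed

lemma Xop_Sop:
  "Xop i (Sop i f) = Sop i (Xop (Suc i) f) - Top i (Suc i) f"
  "Xop (Suc i) (Sop i f) = Sop i (Xop i f) + Top i (Suc i) f"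
  by (simp_all add: fun_eq_iff Xop_def[of _ "Sop i f"] Sop_bump Sop_bump_Suc)

lemma Xop_Sop_far:
  assumes "j \<noteq> i" "j \<noteq> Suc i"
  shows "Xop j (Sop i f) = Sop i (Xop j f)"
proof -
  have "finite {i, Suc i}" by simp
  then have "\<forall>f m. Sop i f (bump j \<alpha>) m = Sop i (Xop j f) \<alpha> m" for \<alpha>
  proof (induction \<alpha> rule: bump_induct)
    case (zero \<alpha>)
    then have "bump j \<alpha> i = 0" "bump j \<alpha> (Suc i) = 0" "\<alpha> i = 0" "\<alpha> (Suc i) = 0"
      using assms by (auto simp: bump_def)
    then show ?case by (simp add: Sop_zero Xop_def)
  next
    case (bump \<alpha> k)
    show ?case using bump
      by (auto simp: bump_comm[of j] Sop_bump Sop_bump_Suc Xop_comm[of j] Top_Xop_apply)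
  qed
  then show ?thesis by (simp add: fun_eq_iff Xop_def[of _ "Sop i f"])
qed

lemma Sop_add: "Sop i (f + g) = Sop i f + Sop i g"
proof -
  let ?P = "\<lambda>\<alpha>. \<forall>f g m. Sop i (f + g) \<alpha> m = Sop i f \<alpha> m + Sop i g \<alpha> m"
  have "?P \<alpha>" for \<alpha>
  \<comment> \<open>Plain resolution keeps \<open>f + g\<close> eta-contracted, so that the additivity rules still apply.\<close>
  proof (rule bump_induct[of "{i, Suc i}" ?P])
    show "?P (bump j \<alpha>)" if "?P \<alpha>" "j \<in> {i, Suc i}" for \<alpha> j
      using that by (elim insertE) (simp_all add: Sop_bump Sop_bump_Suc Xop_add Top_add)
  qed (simp_all add: Sop_zero)
  then show ?thesis by (simp add: fun_eq_iff)
qed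

lemma Sop_null: "Sop i 0 = 0"
  using Sop_add[of i 0 0] by simp

lemma Sop_diff: "Sop i (f - g) = Sop i f - Sop i g"
  using Sop_add[of i "f - g" g] by (simp add: algebra_simps)

lemma Sop_sum: "Sop i (\<Sum>h\<in>A. f h) = (\<Sum>h\<in>A. Sop i (f h))"
  using sum_comp_morphism[of "Sop i" f A, OF Sop_null Sop_add] by (simp add: comp_def)

lemma Gop_Top:
  assumes i: "i \<in> {1..<n}" and g: "g \<in> carrier GN"
  shows "Gop g (Top i (Suc i) f) = Top i (Suc i) (Gop (sact i g) f)"
proof -
  let ?c = "\<lambda>h. inv\<^bsub>G\<^esub> g (Suc i) \<otimes>\<^bsub>G\<^esub> h \<otimes>\<^bsub>G\<^esub> g i"
  have gi: "g i \<in> carrier G" "g (Suc i) \<in> carrier G" using i g by (auto simp: GN_carrier)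
  have bij: "bij_betw ?c (carrier G) (carrier G)"
  proof (rule bij_betw_byWitness[where f' = "\<lambda>h. g (Suc i) \<otimes>\<^bsub>G\<^esub> h \<otimes>\<^bsub>G\<^esub> inv\<^bsub>G\<^esub> g i"])
    show "\<forall>a\<in>carrier G. g (Suc i) \<otimes>\<^bsub>G\<^esub> (?c a) \<otimes>\<^bsub>G\<^esub> inv\<^bsub>G\<^esub> g i = a"
    proof
      fix a assume a: "a \<in> carrier G"
      have "g (Suc i) \<otimes>\<^bsub>G\<^esub> (?c a) = a \<otimes>\<^bsub>G\<^esub> g i" using gi a by (simp add: G.m_assoc[symmetric])
      then show "g (Suc i) \<otimes>\<^bsub>G\<^esub> (?c a) \<otimes>\<^bsub>G\<^esub> inv\<^bsub>G\<^esub> g i = a" using gi a by (simp add: G.m_assoc)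
    qed
    show "\<forall>a\<in>carrier G. ?c (g (Suc i) \<otimes>\<^bsub>G\<^esub> a \<otimes>\<^bsub>G\<^esub> inv\<^bsub>G\<^esub> g i) = a"
    proof
      fix a assume a: "a \<in> carrier G"
      have "inv\<^bsub>G\<^esub> g (Suc i) \<otimes>\<^bsub>G\<^esub> (g (Suc i) \<otimes>\<^bsub>G\<^esub> a \<otimes>\<^bsub>G\<^esub> inv\<^bsub>G\<^esub> g i) = a \<otimes>\<^bsub>G\<^esub> inv\<^bsub>G\<^esub> g i"
        using gi a by (simp add: G.m_assoc[symmetric])
      then show "?c (g (Suc i) \<otimes>\<^bsub>G\<^esub> a \<otimes>\<^bsub>G\<^esub> inv\<^bsub>G\<^esub> g i) = a" using gi a by (simp add: G.m_assoc)
    qed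
  qed (use gi in auto)
  have "Gop g (Top i (Suc i) f) = (\<Sum>h\<in>carrier G. Gop g (Gop (tw i (Suc i) h) f))"
    by (simp add: Top_def Gop_def fun_eq_iff sum_fun_apply)
  also have "\<dots> = (\<Sum>h\<in>carrier G. Gop (sact i g \<otimes>\<^bsub>GN\<^esub> tw i (Suc i) (?c h)) f)"
    using i g by (intro sum.cong) (auto simp: Gop_Gop tw_mult)
  also have "\<dots> = (\<Sum>h\<in>carrier G. Gop (sact i g \<otimes>\<^bsub>GN\<^esub> tw i (Suc i) h) f)"
    by (rule sum.reindex_bij_betw[OF bij])
  also have "\<dots> = Top i (Suc i) (Gop (sact i g) f)"
    unfolding Top_def using i g by (intro sum.cong) (auto simp: Gop_Gop)
  finally show ?thesis .
qed

lemma Gop_Sop: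
  assumes i: "i \<in> {1..<n}" and g: "g \<in> carrier GN"
  shows "Gop g (Sop i f) = Sop i (Gop (sact i g) f)"
proof -
  have "finite {i, Suc i}" by simp
  then have "\<forall>f m. Sop i f \<alpha> (act g m) = Sop i (Gop (sact i g) f) \<alpha> m" for \<alpha>
  proof (induction \<alpha> rule: bump_induct)
    case (zero \<alpha>)
    then show ?case using i g by (auto simp: Sop_zero Gop_def sg_act)
  next
    case (bump \<alpha> k)
    have "Top i (Suc i) f \<alpha> (act g m) = Top i (Suc i) (Gop (sact i g) f) \<alpha> m" for f m
      using Gop_Top[OF i g, of f] by (simp add: fun_eq_iff Gop_def[of g "Top i (Suc i) f"])
    then show ?case using bump by (auto simp: Sop_bump Sop_bump_Suc Xop_Gop)
  qed
  then show ?thesis by (simp add: fun_eq_iff Gop_def[of g "Sop i f"])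
qed

lemma Top_swap:
  assumes "i \<noteq> j"
  shows "Top j i f = Top i j f"
proof -
  have "(\<Sum>h\<in>carrier G. Gop (tw i j (inv\<^bsub>G\<^esub> h)) f) = Top i j f"
    unfolding Top_def by (rule sum.reindex_bij_betw[OF bij_inv_G])
  moreover have "Top j i f = (\<Sum>h\<in>carrier G. Gop (tw i j (inv\<^bsub>G\<^esub> h)) f)"
    unfolding Top_def using assms by (intro sum.cong) (auto simp: tw_swap[of i j])
  ultimately show ?thesis by simp
qed

lemma Sop_Top:
  assumes "l \<in> {1..<n}" "i \<noteq> j"
  shows "Sop l (Top i j f) = Top (simple_refl l i) (simple_refl l j) (Sop l f)"
proof -
  have "Sop l (Gop (tw i j h) f) = Gop (tw (simple_refl l i) (simple_refl l j) h) (Sop l f)"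
    if h: "h \<in> carrier G" for h
  proof -
    have "sact l (tw (simple_refl l i) (simple_refl l j) h) = tw i j h"
      using sact_tw[OF assms(1), of "simple_refl l i" "simple_refl l j" h] assms h
      by (simp add: simple_refl_inj)
    then show ?thesis using Gop_Sop[OF assms(1), of "tw (simple_refl l i) (simple_refl l j) h"] h by simp
  qed
  then show ?thesis unfolding Top_def Sop_sum by (intro sum.cong) auto
qed

text \<open>The principle behind all relations between the reflection operators. If the difference of two
  operators intertwines each relevant variable with some variable, then it vanishes everywhere as
  soon as it vanishes in degree zero, where the operators only permute the points.\<close>

lemma operator_eqI:
  assumes "finite J" "\<And>f \<alpha> m. (\<And>j. j \<in> J \<Longrightarrow> \<alpha> j = 0) \<Longrightarrow> A f \<alpha> m = B f \<alpha> m"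
    and "\<And>j f. j \<in> J \<Longrightarrow> \<exists>j'. Xop j (A f) - Xop j (B f) = A (Xop j' f) - B (Xop j' f)"
  shows "A f = B f"
proof -
  have "\<forall>f m. A f \<alpha> m = B f \<alpha> m" for \<alpha>
    using assms(1)
  proof (induction \<alpha> rule: bump_induct)
    case (bump \<alpha> j)
    have "A f (bump j \<alpha>) m - B f (bump j \<alpha>) m = 0" for f m
    proof -
      obtain j' where "Xop j (A f) - Xop j (B f) = A (Xop j' f) - B (Xop j' f)" using assms(3) bump by blast
      then have "(Xop j (A f) - Xop j (B f)) \<alpha> m = (A (Xop j' f) - B (Xop j' f)) \<alpha> m" by simp
      then show ?thesis using bump by (simp add: Xop_def)
    qed
    then show ?case by simp
  qed (use assms(2) in auto)
  then show ?thesis by (simp add: fun_eq_iff)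
qed

lemma Sop_Sop:
  assumes i: "i \<in> {1..<n}"
  shows "Sop i (Sop i f) = f"
proof (rule operator_eqI[where J = "{i, Suc i}" and A = "\<lambda>f. Sop i (Sop i f)" and B = "\<lambda>f. f"])
  fix f \<alpha> m assume z: "\<And>j. j \<in> {i, Suc i} \<Longrightarrow> \<alpha> j = (0 :: nat)"
  then show "Sop i (Sop i f) \<alpha> m = f \<alpha> m" using i by (simp add: Sop_zero sg_sq)
next
  fix j f assume j: "j \<in> {i, Suc i}"
  have t: "Sop i (Top i (Suc i) f) = Top i (Suc i) (Sop i f)"
    using Sop_Top[OF i, of i "Suc i" f] Top_swap[of i "Suc i"] by simp
  have "Xop i (Sop i (Sop i f)) = Sop i (Sop i (Xop i f))" "Xop (Suc i) (Sop i (Sop i f)) = Sop i (Sop i (Xop (Suc i) f))"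
    by (simp_all add: Xop_Sop Sop_add Sop_diff t)
  then show "\<exists>j'. Xop j (Sop i (Sop i f)) - Xop j f = Sop i (Sop i (Xop j' f)) - Xop j' f"
    using j by auto
qed simp

lemma Sop_comm:
  assumes i: "i \<in> {1..<n}" and j: "j \<in> {1..<n}" and ij: "Suc i < j"
  shows "Sop i (Sop j f) = Sop j (Sop i f)"
proof (rule operator_eqI[where J = "{i, Suc i, j, Suc j}" and A = "\<lambda>f. Sop i (Sop j f)"
      and B = "\<lambda>f. Sop j (Sop i f)"])
  fix f \<alpha> m assume z: "\<And>k. k \<in> {i, Suc i, j, Suc j} \<Longrightarrow> \<alpha> k = (0 :: nat)"
  then show "Sop i (Sop j f) \<alpha> m = Sop j (Sop i f) \<alpha> m" using sg_comm[OF i j ij] by (simp add: Sop_zero)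
next
  fix k f assume k: "k \<in> {i, Suc i, j, Suc j}"
  have t: "Sop j (Top i (Suc i) f) = Top i (Suc i) (Sop j f)" "Sop i (Top j (Suc j) f) = Top j (Suc j) (Sop i f)" for f
    using Sop_Top[OF j, of i "Suc i" f] Sop_Top[OF i, of j "Suc j" f] ij by simp_all
  have "Xop i (Sop i (Sop j f)) = Sop i (Sop j (Xop (Suc i) f)) - Top i (Suc i) (Sop j f)"
    "Xop i (Sop j (Sop i f)) = Sop j (Sop i (Xop (Suc i) f)) - Top i (Suc i) (Sop j f)"
    "Xop (Suc i) (Sop i (Sop j f)) = Sop i (Sop j (Xop i f)) + Top i (Suc i) (Sop j f)"
    "Xop (Suc i) (Sop j (Sop i f)) = Sop j (Sop i (Xop i f)) + Top i (Suc i) (Sop j f)"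
    "Xop j (Sop i (Sop j f)) = Sop i (Sop j (Xop (Suc j) f)) - Top j (Suc j) (Sop i f)"
    "Xop j (Sop j (Sop i f)) = Sop j (Sop i (Xop (Suc j) f)) - Top j (Suc j) (Sop i f)"
    "Xop (Suc j) (Sop i (Sop j f)) = Sop i (Sop j (Xop j f)) + Top j (Suc j) (Sop i f)"
    "Xop (Suc j) (Sop j (Sop i f)) = Sop j (Sop i (Xop j f)) + Top j (Suc j) (Sop i f)"
    using ij by (simp_all add: Xop_Sop Xop_Sop_far Sop_add Sop_diff t)
  with k have "\<exists>k' \<in> {i, Suc i, j, Suc j}. Xop k (Sop i (Sop j f)) - Xop k (Sop j (Sop i f))
      = Sop i (Sop j (Xop k' f)) - Sop j (Sop i (Xop k' f))"
    by auto
  then show "\<exists>k'. Xop k (Sop i (Sop j f)) - Xop k (Sop j (Sop i f)) = Sop i (Sop j (Xop k' f)) - Sop j (Sop i (Xop k' f))"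
    by blast
qed simp

text \<open>Let \<open>D\<close> be the difference of the two sides. Moving a variable through either side produces the same
  correction terms in \<open>t\<^sub>1\<^sub>2\<close>, \<open>t\<^sub>2\<^sub>3\<close> and \<open>t\<^sub>1\<^sub>3\<close>, because the reflections permute the indices of the \<open>t\<^sub>i\<^sub>j\<close>.
  Hence \<open>D\<close> itself merely exchanges \<open>x\<^sub>i\<close> and \<open>x\<^sub>i\<^sub>+\<^sub>2\<close>, and the previous principle applies.\<close>

lemma Sop_braid:
  assumes i: "i \<in> {1..<n}" and j: "Suc i \<in> {1..<n}"
  shows "Sop i (Sop (Suc i) (Sop i f)) = Sop (Suc i) (Sop i (Sop (Suc i) f))"
proof (rule operator_eqI[where J = "{i, Suc i, Suc (Suc i)}"
      and A = "\<lambda>f. Sop i (Sop (Suc i) (Sop i f))" and B = "\<lambda>f. Sop (Suc i) (Sop i (Sop (Suc i) f))"])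
  fix f \<alpha> m assume z: "\<And>k. k \<in> {i, Suc i, Suc (Suc i)} \<Longrightarrow> \<alpha> k = (0 :: nat)"
  then show "Sop i (Sop (Suc i) (Sop i f)) \<alpha> m = Sop (Suc i) (Sop i (Sop (Suc i) f)) \<alpha> m"
    using sg_braid[OF i j] by (simp add: Sop_zero)
next
  fix k f assume k: "k \<in> {i, Suc i, Suc (Suc i)}"
  let ?t1 = "Top i (Suc i)" and ?t2 = "Top (Suc i) (Suc (Suc i))" and ?t3 = "Top i (Suc (Suc i))"
  let ?A = "\<lambda>f. Sop i (Sop (Suc i) (Sop i f))" and ?B = "\<lambda>f. Sop (Suc i) (Sop i (Sop (Suc i) f))"
  have t: "Sop i (?t1 f) = ?t1 (Sop i f)" "Sop i (?t2 f) = ?t3 (Sop i f)" "Sop i (?t3 f) = ?t2 (Sop i f)"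
    "Sop (Suc i) (?t1 f) = ?t3 (Sop (Suc i) f)" "Sop (Suc i) (?t2 f) = ?t2 (Sop (Suc i) f)"
    "Sop (Suc i) (?t3 f) = ?t1 (Sop (Suc i) f)" for f
    using Sop_Top[OF i, of i "Suc i" f] Sop_Top[OF i, of "Suc i" "Suc (Suc i)" f]
      Sop_Top[OF i, of i "Suc (Suc i)" f] Sop_Top[OF j, of i "Suc i" f]
      Sop_Top[OF j, of "Suc i" "Suc (Suc i)" f] Sop_Top[OF j, of i "Suc (Suc i)" f]
      Top_swap[of i "Suc i"] Top_swap[of "Suc i" "Suc (Suc i)"]
    by simp_all
  have "Xop i (?A f) - Xop i (?B f) = ?A (Xop (Suc (Suc i)) f) - ?B (Xop (Suc (Suc i)) f)"
    "Xop (Suc i) (?A f) - Xop (Suc i) (?B f) = ?A (Xop (Suc i) f) - ?B (Xop (Suc i) f)"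
    "Xop (Suc (Suc i)) (?A f) - Xop (Suc (Suc i)) (?B f) = ?A (Xop i f) - ?B (Xop i f)"
    using i j by (simp_all add: Xop_Sop Xop_Sop_far Sop_add Sop_diff t Sop_Sop)
  then show "\<exists>k'. Xop k (?A f) - Xop k (?B f) = ?A (Xop k' f) - ?B (Xop k' f)"
    using k by blast
qed simp

end

section \<open>The defining relations hold for the operators\<close>

lemma free_monoid_simps [simp]:
  "carrier (free_monoid Y) = lists Y"
  "u \<otimes>\<^bsub>free_monoid Y\<^esub> v = u @ v"
  "\<one>\<^bsub>free_monoid Y\<^esub> = []"
  by (simp_all add: free_monoid_def)

lemma monoid_free_monoid: "Group.monoid (free_monoid Y)"
  by (rule monoidI) auto

text \<open>Linear functionals are linear extensions into this module.\<close>

definition self_module :: "('f, 'e) ring_scheme \<Rightarrow> ('f, 'f) module"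
  where "self_module F = \<lparr>carrier = carrier F, monoid.mult = monoid.mult F, one = one F,
    ring.zero = ring.zero F, ring.add = ring.add F, smult = monoid.mult F\<rparr>"

lemma self_module_simps [simp]:
  "carrier (self_module F) = carrier F"
  "ring.zero (self_module F) = \<zero>\<^bsub>F\<^esub>"
  "ring.add (self_module F) = ring.add F"
  "smult (self_module F) = monoid.mult F"
  by (simp_all add: self_module_def)

lemma (in cring) module_self_module: "module R (self_module R)"
  by (rule moduleI)
    (auto intro!: abelian_groupI bexI[of _ "\<ominus> _"] is_cring simp: a_ac m_ac l_distr r_distr l_neg r_neg)

lemma (in cring) finsum_self_module:
  assumes "\<And>a. a \<in> A \<Longrightarrow> f a \<in> carrier R"
  shows "finsum (self_module R) f A = finsum R f A"
proof -
  interpret self: module R "self_module R" by (rule module_self_module)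
  show ?thesis using assms
  proof (induction A rule: infinite_finite_induct)
    case (insert a A)
    then show ?case using self.M.finsum_insert[of A a f] by (auto simp: Pi_def)
  qed (auto simp: self.M.finsum_infinite finsum_infinite)
qed

lemma (in module) linear_ext_null:
  assumes "\<And>y. y \<in> Y \<Longrightarrow> \<phi> y = \<zero>\<^bsub>M\<^esub>" "f \<in> fin_supp R Y"
  shows "linear_ext R M \<phi> f = \<zero>\<^bsub>M\<^esub>"
  unfolding linear_ext_def using assms fin_suppD[OF assms(2)]
  by (intro M.add.finprod_one_eqI) auto

text \<open>Carries the integer matrix entries of the operators into an arbitrary ground ring, in
  particular into one of positive characteristic.\<close>

definition (in cring) of_integer :: "int \<Rightarrow> 'a"
  where "of_integer k = [k] \<cdot> \<one>"

context cring
begin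

lemma of_integer_closed [simp]: "of_integer k \<in> carrier R"
  by (simp add: of_integer_def)

lemma of_integer_0 [simp]: "of_integer 0 = \<zero>" and of_integer_1 [simp]: "of_integer 1 = \<one>"
  by (simp_all add: of_integer_def add_pow_def add.int_pow_1[unfolded add_pow_def])

lemma of_integer_add: "of_integer (a + b) = of_integer a \<oplus> of_integer b"
  by (simp add: of_integer_def add.int_pow_mult)

lemma of_integer_sum:
  "finite A \<Longrightarrow> of_integer (\<Sum>h\<in>A. f h) = (\<Oplus>h\<in>A. of_integer (f h))"
  by (induction A rule: finite_induct) (auto simp: of_integer_add)

end

locale wreath_algebra = wreath_group G n + F: field F
  for F :: "('f, 'e) ring_scheme" and G :: "('g, 'c) monoid_scheme" and n :: nat
begin

abbreviation "FA \<equiv> wreath_free F G n"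
abbreviation "W \<equiv> lists (wreath_gens G n)"

sublocale FM: monoid_ring F "free_monoid (wreath_gens G n)"
  by (intro monoid_ring.intro F.is_cring monoid_free_monoid)

sublocale FA: assoc_algebra F FA
  unfolding free_algebra_def by (rule FM.assoc_algebra_monoid_algebra)

lemma FA_simps:
  "carrier FA = fin_supp F W"
  "\<one>\<^bsub>FA\<^esub> = delta F []"
  "\<zero>\<^bsub>FA\<^esub> = (\<lambda>x. \<zero>\<^bsub>F\<^esub>)"
  by (simp_all add: free_algebra_def)

abbreviation "functional \<equiv> linear_ext F (self_module F)"

lemma delta_W [simp]: "u \<in> W \<Longrightarrow> delta F u \<in> carrier FA"
  by (simp add: FA_simps)

lemma delta_mult [simp]:
  "u \<in> W \<Longrightarrow> v \<in> W \<Longrightarrow> delta F u \<otimes>\<^bsub>FA\<^esub> delta F v = delta F (u @ v)"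
  using FM.delta_conv[of u v] by (simp add: free_algebra_def)

lemma gens_W [simp]:
  "g \<in> carrier GN \<Longrightarrow> GenG g \<in> wreath_gens G n"
  "i \<in> {1..<n} \<Longrightarrow> GenS i \<in> wreath_gens G n"
  "i \<in> {1..n} \<Longrightarrow> GenX i \<in> wreath_gens G n"
  by (auto simp: wreath_gens_def)

lemma linear_ext_FA_hom:
  "module F V \<Longrightarrow> (\<And>u. u \<in> W \<Longrightarrow> \<phi> u \<in> carrier V) \<Longrightarrow> mod_hom F FA V (linear_ext F V \<phi>)"
  using FM.linear_ext_hom_MA[of V \<phi>] by (simp add: free_algebra_def)

lemma linear_ext_FA_mult:
  assumes "module F V" "\<And>u. u \<in> W \<Longrightarrow> \<phi> u \<in> carrier V" "p \<in> carrier FA" "q \<in> carrier FA"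
  shows "linear_ext F V \<phi> (p \<otimes>\<^bsub>FA\<^esub> q)
    = linear_ext F V (\<lambda>u. linear_ext F V (\<lambda>v. \<phi> (u @ v)) q) p"
  using FM.linear_ext_conv[of p q V \<phi>] assms by (simp add: free_algebra_def)

lemma free_t_eq: "free_t F G n i j = (\<Oplus>\<^bsub>FA\<^esub>h\<in>carrier G. delta F [GenG (tw i j h)])"
  by (simp add: free_t_def tw_def)

lemma free_t_closed [simp]: "free_t F G n i j \<in> carrier FA"
  unfolding free_t_eq by (intro FA.M.finsum_closed) auto

lemma wreath_rel_closed:
  assumes "wreath_rel F G n l r"
  shows "l \<in> carrier FA" "r \<in> carrier FA"
  using assms sact_closed
  by (induction rule: wreath_rel.induct)
    (auto simp: FA_simps(2) sact_def[symmetric] simp del: delta_mult One_nat_def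
      intro!: FA.A.m_closed FA.M.minus_closed)

definition relators :: "('g wreath_gen list \<Rightarrow> 'f) set"
  where "relators = {l \<ominus>\<^bsub>FA\<^esub> r | l r. wreath_rel F G n l r}"

lemma relators_closed: "relators \<subseteq> carrier FA"
  using wreath_rel_closed by (auto simp: relators_def)

lemma wreath_ideal_eq: "wreath_ideal F G n = Idl\<^bsub>FA\<^esub> relators"
  by (simp add: wreath_ideal_def relators_def)

lemma ideal_wreath_ideal: "ideal (wreath_ideal F G n) FA"
  unfolding wreath_ideal_eq by (rule FA.A.genideal_ideal[OF relators_closed])

lemma relator_mem: "wreath_rel F G n l r \<Longrightarrow> l \<ominus>\<^bsub>FA\<^esub> r \<in> wreath_ideal F G n"
  unfolding wreath_ideal_eq using FA.A.genideal_self[OF relators_closed] by (auto simp: relators_def)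

end

context wreath_set
begin

primrec gen_op :: "'a wreath_gen \<Rightarrow> ((nat \<Rightarrow> nat) \<Rightarrow> 'm \<Rightarrow> int) \<Rightarrow> (nat \<Rightarrow> nat) \<Rightarrow> 'm \<Rightarrow> int"
  where
    "gen_op (GenG g) = Gop g"
  | "gen_op (GenS i) = Sop i"
  | "gen_op (GenX j) = Xop j"

text \<open>The operators are transposes, so the first letter of a word acts first.\<close>

definition word_op :: "'a wreath_gen list \<Rightarrow> ((nat \<Rightarrow> nat) \<Rightarrow> 'm \<Rightarrow> int) \<Rightarrow> (nat \<Rightarrow> nat) \<Rightarrow> 'm \<Rightarrow> int"
  where "word_op = fold gen_op"

lemma word_op_simps [simp]:
  "word_op [] f = f" "word_op (z # u) f = word_op u (gen_op z f)"
  "word_op (u @ v) f = word_op v (word_op u f)"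
  by (simp_all add: word_op_def)

lemma gen_op_add: "gen_op z (f + g) = gen_op z f + gen_op z g"
  by (cases z) (simp_all add: Gop_add Sop_add Xop_add)

lemma word_op_add: "word_op u (f + g) = word_op u f + word_op u g"
  by (induct u arbitrary: f g) (simp_all add: gen_op_add)

lemma word_op_null: "word_op u 0 = 0"
  using word_op_add[of u 0 0] by simp

lemma word_op_sum: "word_op u (\<Sum>h\<in>A. f h) = (\<Sum>h\<in>A. word_op u (f h))"
  using sum_comp_morphism[of "word_op u" f A, OF word_op_null word_op_add] by (simp add: comp_def)

end

locale wreath_rep = wreath_algebra F G n + wreath_set G n act sg
  for F :: "('f, 'e) ring_scheme" and G :: "('g, 'c) monoid_scheme" and n :: nat
    and act :: "(nat \<Rightarrow> 'g) \<Rightarrow> 'm \<Rightarrow> 'm" and sg :: "nat \<Rightarrow> 'm \<Rightarrow> 'm"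
begin

abbreviation "matcoef f \<alpha> m \<equiv> (\<lambda>w. F.of_integer (word_op w f \<alpha> m))"

text \<open>On the polynomial module this is a matrix coefficient of a combination of words, multiplied on the
  right by \<open>v\<close>: it applies the product to the basis vector with index \<open>(\<alpha>, m)\<close> and evaluates \<open>f\<close> on the
  result.\<close>

definition pairing :: "'g wreath_gen list \<Rightarrow> ((nat \<Rightarrow> nat) \<Rightarrow> 'm \<Rightarrow> int) \<Rightarrow> (nat \<Rightarrow> nat) \<Rightarrow> 'm
    \<Rightarrow> ('g wreath_gen list \<Rightarrow> 'f) \<Rightarrow> 'f"
  where "pairing v f \<alpha> m =
    functional (\<lambda>w. F.of_integer (word_op (w @ v) f \<alpha> m))"

sublocale self: module F "self_module F"
  by (rule F.module_self_module)

lemma pairing_hom: "mod_hom F FA (self_module F) (pairing v f \<alpha> m)"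
  unfolding pairing_def by (rule linear_ext_FA_hom) (auto intro: self.module_axioms)

lemma pairing_delta: "pairing v f \<alpha> m (delta F w) = F.of_integer (word_op (w @ v) f \<alpha> m)"
  unfolding pairing_def by (rule self.linear_ext_delta) simp

lemma pairing_free_t:
  "pairing v f \<alpha> m (free_t F G n i j) = F.of_integer (word_op v (Top i j f) \<alpha> m)"
proof -
  interpret P: mod_hom F FA "self_module F" "pairing v f \<alpha> m" by (rule pairing_hom)
  have "pairing v f \<alpha> m (free_t F G n i j)
      = (\<Oplus>\<^bsub>self_module F\<^esub>h\<in>carrier G. pairing v f \<alpha> m (delta F [GenG (tw i j h)]))"
    unfolding free_t_eq by (intro P.hom_finsum) auto
  also have "\<dots> = (\<Oplus>\<^bsub>F\<^esub>h\<in>carrier G. F.of_integer (word_op v (Gop (tw i j h) f) \<alpha> m))"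
    unfolding pairing_delta by (simp add: F.finsum_self_module)
  also have "\<dots> = F.of_integer (word_op v (Top i j f) \<alpha> m)"
    unfolding Top_def word_op_sum sum_fun_apply by (rule F.of_integer_sum[OF finite_G, symmetric])
  finally show ?thesis .
qed

lemma pairing_rel:
  assumes "wreath_rel F G n l r"
  shows "pairing v f \<alpha> m l = pairing v f \<alpha> m r"
  using assms
proof cases
  case (g_mult g h)
  then show ?thesis by (simp add: pairing_delta Gop_Gop GN.m_closed)
next
  case g_one
  then show ?thesis by (simp add: pairing_delta Gop_one FA_simps)
next
  case (x_x i j)
  then show ?thesis by (simp add: pairing_delta Xop_comm[of i j] del: One_nat_def)
next
  case (x_g i g)
  then show ?thesis by (simp add: pairing_delta Xop_Gop del: One_nat_def)
next
  case (s_sq i)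
  then show ?thesis by (simp add: pairing_delta Sop_Sop FA_simps del: One_nat_def)
next
  case (s_comm i j)
  then have "Suc i < j \<or> Suc j < i" by auto
  then have "Sop j (Sop i f) = Sop i (Sop j f)" for f
    using Sop_comm[of i j] Sop_comm[of j i] s_comm by metis
  then show ?thesis using s_comm by (simp add: pairing_delta del: One_nat_def)
next
  case (s_braid i)
  then show ?thesis by (simp add: pairing_delta Sop_braid del: One_nat_def)
next
  case (s_x i)
  interpret P: mod_hom F FA "self_module F" "pairing v f \<alpha> m" by (rule pairing_hom)
  have gens: "GenX i \<in> wreath_gens G n" "GenX (Suc i) \<in> wreath_gens G n" "GenS i \<in> wreath_gens G n"
    using s_x by auto
  let ?c = "\<lambda>f. F.of_integer (word_op v f \<alpha> m)"
  have "Sop i (Xop (Suc i) f) = Xop i (Sop i f) + Top i (Suc i) f" by (simp add: Xop_Sop)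
  then have eq: "?c (Sop i (Xop (Suc i) f)) = ?c (Xop i (Sop i f)) \<oplus>\<^bsub>F\<^esub> ?c (Top i (Suc i) f)"
    by (simp add: word_op_add F.of_integer_add)
  have "pairing v f \<alpha> m r = pairing v f \<alpha> m (delta F [GenX (Suc i), GenS i])
      \<ominus>\<^bsub>self_module F\<^esub> pairing v f \<alpha> m (free_t F G n i (Suc i))"
    using s_x gens by (simp add: P.f_minus)
  also have "\<dots> = ?c (Sop i (Xop (Suc i) f)) \<ominus>\<^bsub>self_module F\<^esub> ?c (Top i (Suc i) f)"
    by (simp add: pairing_delta pairing_free_t)
  also have "\<dots> = ?c (Xop i (Sop i f))"
    unfolding eq using self.M.add.inv_solve_right' by (simp add: a_minus_def a_inv_def m_inv_def F.a_assoc)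
  also have "\<dots> = pairing v f \<alpha> m l"
    using s_x gens by (simp add: pairing_delta)
  finally show ?thesis by simp
next
  case (s_x_far i j)
  then show ?thesis by (simp add: pairing_delta Xop_Sop_far del: One_nat_def)
next
  case (s_g i g)
  then show ?thesis
    by (simp add: pairing_delta Gop_Sop sact_def[symmetric] del: One_nat_def)
qed

text \<open>The combinations that act as zero. Since \<open>f\<close> is arbitrary, a left factor can be absorbed into it;
  the words \<open>v\<close> absorb a right factor. This makes the set a two-sided ideal.\<close>

definition annihilator :: "('g wreath_gen list \<Rightarrow> 'f) set"
  where "annihilator = {p \<in> carrier FA. \<forall>v\<in>W. \<forall>f \<alpha> m. pairing v f \<alpha> m p = \<zero>\<^bsub>F\<^esub>}"

lemma ideal_annihilator: "ideal annihilator FA"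
proof (rule idealI[OF FA.A.ring_axioms])
  show "subgroup annihilator (add_monoid FA)"
  proof (rule FA.M.add.subgroupI)
    show "annihilator \<subseteq> carrier FA" by (auto simp: annihilator_def)
    have "\<zero>\<^bsub>FA\<^esub> \<in> annihilator"
      using mod_hom.f0_is_0[OF pairing_hom] by (auto simp: annihilator_def)
    then show "annihilator \<noteq> {}" by blast
    have neg0: "\<ominus>\<^bsub>self_module F\<^esub> \<zero>\<^bsub>F\<^esub> = \<zero>\<^bsub>F\<^esub>"
      by (rule self.M.minus_equality) simp_all
    fix p assume p: "p \<in> annihilator"
    then show "\<ominus>\<^bsub>FA\<^esub> p \<in> annihilator"
      using mod_hom.f_neg[OF pairing_hom] neg0 by (auto simp: annihilator_def)
    fix q assume "q \<in> annihilator"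
    with p show "p \<oplus>\<^bsub>FA\<^esub> q \<in> annihilator"
      using mod_hom_add[OF pairing_hom] by (auto simp: annihilator_def)
  qed
next
  fix p x assume "p \<in> annihilator" and x: "x \<in> carrier FA"
  then have p: "p \<in> carrier FA" and 0: "v \<in> W \<Longrightarrow> pairing v f \<alpha> m p = \<zero>\<^bsub>F\<^esub>" for v f \<alpha> m
    by (auto simp: annihilator_def)
  have "pairing v f \<alpha> m (x \<otimes>\<^bsub>FA\<^esub> p) = \<zero>\<^bsub>F\<^esub>" if v: "v \<in> W" for v f \<alpha> m
  proof -
    have "pairing v f \<alpha> m (x \<otimes>\<^bsub>FA\<^esub> p)
        = functional (\<lambda>u. pairing v (word_op u f) \<alpha> m p) x"
      using x p unfolding pairing_def
      by (subst linear_ext_FA_mult) (auto intro: self.module_axioms)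
    also have "\<dots> = \<zero>\<^bsub>self_module F\<^esub>"
      using x v 0 by (intro self.linear_ext_null[of W]) (auto simp: FA_simps)
    finally show ?thesis by simp
  qed
  then show "x \<otimes>\<^bsub>FA\<^esub> p \<in> annihilator" using x p by (auto simp: annihilator_def)
  have "pairing v f \<alpha> m (p \<otimes>\<^bsub>FA\<^esub> x) = \<zero>\<^bsub>F\<^esub>" if v: "v \<in> W" for v f \<alpha> m
  proof -
    have "pairing v f \<alpha> m (p \<otimes>\<^bsub>FA\<^esub> x)
        = functional (\<lambda>u. functional
            (\<lambda>w. F.of_integer (word_op ((u @ w) @ v) f \<alpha> m)) x) p"
      using x p unfolding pairing_def
      by (subst linear_ext_FA_mult) (auto intro: self.module_axioms)
    also have "\<dots> = functional (\<lambda>w. functional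
            (\<lambda>u. F.of_integer (word_op ((u @ w) @ v) f \<alpha> m)) p) x"
      using x p by (intro self.linear_ext_swap[of p W x W]) (auto simp: FA_simps)
    also have "\<dots> = functional (\<lambda>w. pairing (w @ v) f \<alpha> m p) x"
      by (simp add: pairing_def)
    also have "\<dots> = \<zero>\<^bsub>self_module F\<^esub>"
      using x v 0 by (intro self.linear_ext_null[of W]) (auto simp: FA_simps simp del: word_op_simps)
    finally show ?thesis by simp
  qed
  then show "p \<otimes>\<^bsub>FA\<^esub> x \<in> annihilator" using x p by (auto simp: annihilator_def)
qed

lemma wreath_ideal_annihilated:
  assumes "p \<in> wreath_ideal F G n"
  shows "functional (matcoef f \<alpha> m) p = \<zero>\<^bsub>F\<^esub>"
proof -
  have "l \<ominus>\<^bsub>FA\<^esub> r \<in> annihilator" if "wreath_rel F G n l r" for l r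
  proof -
    note lr = wreath_rel_closed[OF that]
    have "pairing v f \<alpha> m (l \<ominus>\<^bsub>FA\<^esub> r) = \<zero>\<^bsub>self_module F\<^esub>" for v f \<alpha> m
      using mod_hom.f_minus[OF pairing_hom lr] pairing_rel[OF that]
        mod_hom.f_im[OF pairing_hom lr(2)] self.M.r_neg by (simp add: a_minus_def)
    then show ?thesis using lr by (simp add: annihilator_def)
  qed
  then have "relators \<subseteq> annihilator" by (auto simp: relators_def)
  then have "wreath_ideal F G n \<subseteq> annihilator"
    unfolding wreath_ideal_eq by (rule FA.A.genideal_minimal[OF ideal_annihilator])
  then have "pairing [] f \<alpha> m p = \<zero>\<^bsub>F\<^esub>" using assms by (auto simp: annihilator_def)
  then show ?thesis by (simp add: pairing_def)
qed

end

section \<open>The word problem of the symmetric group\<close>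

definition word_perm :: "nat list \<Rightarrow> nat \<Rightarrow> nat"
  where "word_perm ks = foldr (\<circ>) (map simple_refl ks) id"

lemma word_perm_simps [simp]:
  "word_perm [] = id"
  "word_perm (k # ks) = simple_refl k \<circ> word_perm ks"
  by (simp_all add: word_perm_def)

lemma word_perm_append: "word_perm (u @ v) = word_perm u \<circ> word_perm v"
  by (induction u) (auto simp: comp_assoc)

lemma list_prod_sym_group: "list_prod (sym_group n) (map simple_refl ks) = word_perm ks"
  by (simp add: list_prod_def word_perm_def sym_group_def)

lemma simple_refl_permutes: "i \<in> {1..<n} \<Longrightarrow> simple_refl i permutes {1..n}"
  unfolding simple_refl_def by (intro permutes_swap_id) auto

lemma word_perm_permutes: "set ks \<subseteq> {1..<n} \<Longrightarrow> word_perm ks permutes {1..n}"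
  by (induction ks) (auto intro!: permutes_compose simple_refl_permutes
      simp: permutes_id[unfolded id_def] permutes_id simp del: One_nat_def)

lemma word_perm_rev: "word_perm (rev ks) \<circ> word_perm ks = id"
proof (induction ks)
  case (Cons k ks)
  have "word_perm (rev (k # ks)) \<circ> word_perm (k # ks)
      = word_perm (rev ks) \<circ> (simple_refl k \<circ> simple_refl k) \<circ> word_perm ks"
    by (simp add: word_perm_append comp_assoc)
  also have "simple_refl k \<circ> simple_refl k = id" by (simp add: fun_eq_iff)
  finally show ?case using Cons.IH by simp
qed simp

lemma word_perm_descending:
  assumes "j \<le> k" shows "word_perm (rev [j..<k]) j = k"
  using assms
proof (induction k)
  case (Suc k)
  then show ?case by (cases "j = Suc k") auto
qed simp

text \<open>The descending word \<open>k, \<dots>, j\<close> sends \<open>j\<close> to \<open>k + 1\<close>. Splitting it off, with \<open>j\<close> the preimage of \<open>k + 1\<close>, leaves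
  a permutation that fixes \<open>k + 1\<close>.\<close>

lemma word_perm_surj:
  assumes "\<pi> permutes {1..k}"
  obtains ks where "set ks \<subseteq> {1..<k}" "\<pi> = word_perm ks"
  using assms
proof (induction k arbitrary: \<pi> thesis)
  case 0
  then show ?case by (simp add: "0.prems"(1)[of "[]"])
next
  case (Suc k)
  define j where "j = inv' \<pi> (Suc k)"
  have j: "j \<in> {1..Suc k}" "\<pi> j = Suc k"
    using Suc.prems(2) permutes_in_image[OF permutes_inv[OF Suc.prems(2)], of "Suc k"]
    by (auto simp: j_def permutes_inverses)
  let ?c = "rev [j..<Suc k]"
  let ?d = "[j..<Suc k]"
  define \<sigma> where "\<sigma> = \<pi> \<circ> word_perm ?d"
  have dc: "word_perm ?d \<circ> word_perm ?c = id" "word_perm ?c \<circ> word_perm ?d = id"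
    using word_perm_rev[of ?c] word_perm_rev[of ?d] by simp_all
  have "word_perm ?c j = Suc k" using j by (intro word_perm_descending) auto
  then have dk: "word_perm ?d (Suc k) = j" using dc(1) by (metis comp_apply id_apply)
  have "\<sigma> permutes {1..Suc k}"
    unfolding \<sigma>_def using j by (intro permutes_compose[OF _ Suc.prems(2)] word_perm_permutes) auto
  moreover have "\<sigma> (Suc k) = Suc k" using dk j by (simp add: \<sigma>_def del: upt_Suc)
  moreover have "x = Suc k" if "x \<in> {1..Suc k} - {1..k}" for x using that by auto
  ultimately have "\<sigma> permutes {1..k}"
    using permutes_superset[of \<sigma> "{1..Suc k}" "{1..k}"] by metis
  then obtain as where as: "set as \<subseteq> {1..<k}" "\<sigma> = word_perm as" using Suc.IH by blast
  have "\<pi> = \<sigma> \<circ> word_perm ?c" unfolding \<sigma>_def comp_assoc dc by simp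
  also have "\<dots> = word_perm (as @ ?c)" using as by (simp only: word_perm_append)
  finally have eq: "\<pi> = word_perm (as @ ?c)" .
  have "set (as @ ?c) \<subseteq> {1..<Suc k}" using as(1) j by auto
  then show ?case using eq by (rule Suc.prems(1))
qed

text \<open>The word problem for the Coxeter presentation, phrased with lists only: the product map into a
  monoid that satisfies the Coxeter relations is an example of \<open>\<phi>\<close>.\<close>

locale coxeter_invariant =
  fixes n :: nat and \<phi> :: "nat list \<Rightarrow> 'b"
  assumes square: "\<lbrakk>set u \<subseteq> {1..<n}; set v \<subseteq> {1..<n}; i \<in> {1..<n}\<rbrakk> \<Longrightarrow>
      \<phi> (u @ [i, i] @ v) = \<phi> (u @ v)"
    and far: "\<lbrakk>set u \<subseteq> {1..<n}; set v \<subseteq> {1..<n}; i \<in> {1..<n}; j \<in> {1..<n}; Suc i < j\<rbrakk> \<Longrightarrow>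
      \<phi> (u @ [i, j] @ v) = \<phi> (u @ [j, i] @ v)"
    and braid: "\<lbrakk>set u \<subseteq> {1..<n}; set v \<subseteq> {1..<n}; i \<in> {1..<n}; Suc i \<in> {1..<n}\<rbrakk> \<Longrightarrow>
      \<phi> (u @ [i, Suc i, i] @ v) = \<phi> (u @ [Suc i, i, Suc i] @ v)"
begin

text \<open>Quantifying over all contexts makes this a congruence. The permutation is recorded as well, since
  \<open>\<phi>\<close> may identify words of different permutations.\<close>

definition eqv :: "nat list \<Rightarrow> nat list \<Rightarrow> bool" (infix \<open>\<bowtie>\<close> 50)
  where "w \<bowtie> w' \<longleftrightarrow> word_perm w = word_perm w' \<and>
    (\<forall>u v. set u \<subseteq> {1..<n} \<longrightarrow> set v \<subseteq> {1..<n} \<longrightarrow> \<phi> (u @ w @ v) = \<phi> (u @ w' @ v))"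

lemma eqv_refl [simp]: "w \<bowtie> w"
  by (simp add: eqv_def)

lemma eqv_sym: "w \<bowtie> w' \<Longrightarrow> w' \<bowtie> w"
  by (simp add: eqv_def)

lemma eqv_trans [trans]: "w \<bowtie> w' \<Longrightarrow> w' \<bowtie> w'' \<Longrightarrow> w \<bowtie> w''"
  by (simp add: eqv_def)

lemma eqv_ctxt:
  assumes "w \<bowtie> w'" "set a \<subseteq> {1..<n}" "set b \<subseteq> {1..<n}"
  shows "a @ w @ b \<bowtie> a @ w' @ b"
proof -
  have "\<phi> (u @ (a @ w @ b) @ v) = \<phi> (u @ (a @ w' @ b) @ v)"
    if "set u \<subseteq> {1..<n}" "set v \<subseteq> {1..<n}" for u v
  proof -
    have "set (u @ a) \<subseteq> {1..<n}" "set (b @ v) \<subseteq> {1..<n}" using that assms by auto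
    then have "\<phi> ((u @ a) @ w @ (b @ v)) = \<phi> ((u @ a) @ w' @ (b @ v))"
      using assms(1) unfolding eqv_def by blast
    then show ?thesis by simp
  qed
  moreover have "word_perm (a @ w @ b) = word_perm (a @ w' @ b)"
    using assms(1) by (simp add: word_perm_append eqv_def)
  ultimately show ?thesis by (simp add: eqv_def)
qed

lemmas eqv_left = eqv_ctxt[where b = "[]", simplified]
lemmas eqv_right = eqv_ctxt[where a = "[]", simplified]

lemma eqv_square: "i \<in> {1..<n} \<Longrightarrow> [i, i] \<bowtie> []"
  using square by (auto simp: eqv_def fun_eq_iff)

lemma eqv_far:
  assumes "i \<in> {1..<n}" "j \<in> {1..<n}" "Suc i < j \<or> Suc j < i"
  shows "[i, j] \<bowtie> [j, i]"
proof -
  have *: "[i, j] \<bowtie> [j, i]" if "i \<in> {1..<n}" "j \<in> {1..<n}" "Suc i < j" for i j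
    using far that by (auto simp: eqv_def fun_eq_iff simple_refl_def transpose_def)
  show ?thesis using assms *[of i j] *[of j i] eqv_sym by blast
qed

lemma eqv_braid:
  assumes "i \<in> {1..<n}" "Suc i \<in> {1..<n}"
  shows "[i, Suc i, i] \<bowtie> [Suc i, i, Suc i]"
  using braid assms by (auto simp: eqv_def fun_eq_iff simple_refl_def transpose_def)

lemma eqv_commute:
  assumes "set u \<subseteq> {1..<n}" "i \<in> {1..<n}" "\<And>x. x \<in> set u \<Longrightarrow> Suc i < x \<or> Suc x < i"
  shows "u @ [i] \<bowtie> i # u"
  using assms
proof (induction u)
  case (Cons x u)
  have "[x] @ (u @ [i]) \<bowtie> [x] @ (i # u)"
    using Cons by (intro eqv_left) auto
  also have "[x] @ (i # u) = [x, i] @ u" by simp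
  also have "[x, i] @ u \<bowtie> [i, x] @ u"
    using Cons.prems by (intro eqv_right eqv_far) auto
  finally show ?case by simp
qed simp

text \<open>Coming from the right, \<open>i\<close> commutes with the letters below \<open>i - 1\<close>; a braid relation turns the three
  letters \<open>i, i - 1, i\<close> into \<open>i - 1, i, i - 1\<close>; and \<open>i - 1\<close> commutes with the letters above \<open>i\<close>.\<close>

lemma eqv_slide:
  assumes "1 \<le> j" "j < i" "i < k" "k \<le> n"
  shows "rev [j..<k] @ [i] \<bowtie> (i - 1) # rev [j..<k]"
proof -
  obtain l where l: "i = Suc l" using assms by (cases i) auto
  let ?a = "rev [Suc i..<k]" and ?b = "rev [j..<l]"
  have "[j..<k] = [j..<l] @ [l, Suc l] @ [Suc i..<k]"
  proof -
    have "[j..<k] = [j..<l] @ [l..<k]" using assms l upt_add_eq_append[of j l "k - l"] by simp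
    also have "[l..<k] = l # Suc l # [Suc i..<k]"
      using assms l by (simp add: upt_conv_Cons)
    finally show ?thesis by simp
  qed
  then have c: "rev [j..<k] = ?a @ [Suc l, l] @ ?b" by simp
  have sets: "set ?a \<subseteq> {1..<n}" "set ?b \<subseteq> {1..<n}" "l \<in> {1..<n}" "Suc l \<in> {1..<n}"
    using assms l by auto
  have "rev [j..<k] @ [i] = (?a @ [Suc l, l]) @ (?b @ [Suc l])" using c l by simp
  also have "\<dots> \<bowtie> (?a @ [Suc l, l]) @ (Suc l # ?b)"
    using sets by (intro eqv_left eqv_commute) auto
  also have "\<dots> = ?a @ [Suc l, l, Suc l] @ ?b" by simp
  also have "\<dots> \<bowtie> ?a @ [l, Suc l, l] @ ?b"
    using sets by (intro eqv_ctxt eqv_sym[OF eqv_braid]) auto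
  also have "\<dots> = (?a @ [l]) @ ([Suc l, l] @ ?b)" by simp
  also have "\<dots> \<bowtie> (l # ?a) @ ([Suc l, l] @ ?b)"
    using sets l by (intro eqv_right eqv_commute) auto
  finally show ?thesis using c l by simp
qed

text \<open>The descending words are coset representatives for the symmetric group on \<open>k\<close> letters inside the one
  on \<open>k + 1\<close> letters. Appending a letter \<open>i\<close> to one of them lengthens it, shortens it, or passes through
  it as \<open>i\<close> or \<open>i - 1\<close>.\<close>

lemma eqv_normal_form:
  assumes "set w \<subseteq> {1..<Suc k}" "Suc k \<le> n"
  shows "\<exists>a j. set a \<subseteq> {1..<k} \<and> j \<in> {1..Suc k} \<and> w \<bowtie> a @ rev [j..<Suc k]"
  using assms
proof (induction w rule: rev_induct)
  case Nil
  show ?case by (intro exI[of _ "[]"] exI[of _ "Suc k"]) simp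
next
  case (snoc i w)
  then obtain a j where a: "set a \<subseteq> {1..<k}" and j: "j \<in> {1..Suc k}"
    and w: "w \<bowtie> a @ rev [j..<Suc k]" by auto
  let ?c = "\<lambda>j. rev [j..<Suc k]"
  have i: "i \<in> {1..k}" using snoc.prems by auto
  have an: "set a \<subseteq> {1..<n}" and cn: "set (?c j) \<subseteq> {1..<n}" using a j assms(2) by auto
  have "w @ [i] \<bowtie> (a @ ?c j) @ [i]"
    using w i assms(2) by (intro eqv_right) auto
  then have wi: "w @ [i] \<bowtie> a @ (?c j @ [i])" by simp
  consider "Suc i < j" | "Suc i = j" | "i = j" | "j < i" by linarith
  then show ?case
  proof cases
    case 1
    then have "a @ (?c j @ [i]) \<bowtie> a @ (i # ?c j)"
      using an cn i assms(2) by (intro eqv_left eqv_commute) auto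
    then have "w @ [i] \<bowtie> (a @ [i]) @ ?c j" using eqv_trans[OF wi] by simp
    moreover have "set (a @ [i]) \<subseteq> {1..<k}" using a i j 1 by auto
    ultimately show ?thesis using j by blast
  next
    case 2
    then have "?c j @ [i] = ?c i" using j by (simp add: upt_conv_Cons del: upt_Suc)
    then show ?thesis using wi a i by (metis (no_types, lifting) atLeastAtMost_iff le_SucI)
  next
    case 3
    then have "?c j @ [i] = ?c (Suc j) @ [j, j]" using i by (simp add: upt_conv_Cons del: upt_Suc)
    moreover have "(a @ ?c (Suc j)) @ [j, j] \<bowtie> (a @ ?c (Suc j)) @ []"
      using an j i 3 assms(2) by (intro eqv_left eqv_square) auto
    ultimately have "w @ [i] \<bowtie> a @ ?c (Suc j)" using eqv_trans[OF wi] by simp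
    moreover have "Suc j \<in> {1..Suc k}" using 3 i by auto
    ultimately show ?thesis using a by blast
  next
    case 4
    then have "a @ (?c j @ [i]) \<bowtie> a @ ((i - 1) # ?c j)"
      using an i j assms(2) by (intro eqv_left eqv_slide) auto
    then have "w @ [i] \<bowtie> (a @ [i - 1]) @ ?c j" using eqv_trans[OF wi] by simp
    moreover have "set (a @ [i - 1]) \<subseteq> {1..<k}" using a i j 4 by auto
    ultimately show ?thesis using j by blast
  qed
qed

text \<open>The permutation determines the descending factor of the normal form through the preimage of \<open>k + 1\<close>;
  the remaining factors are equivalent by induction.\<close>

lemma eqv_if_word_perm_eq:
  assumes "set w \<subseteq> {1..<k}" "set w' \<subseteq> {1..<k}" "k \<le> n" "word_perm w = word_perm w'"
  shows "w \<bowtie> w'"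
  using assms
proof (induction k arbitrary: w w')
  case 0
  then show ?case by simp
next
  case (Suc k)
  let ?c = "\<lambda>j. rev [j..<Suc k]"
  obtain a j where a: "set a \<subseteq> {1..<k}" "j \<in> {1..Suc k}" "w \<bowtie> a @ ?c j"
    using eqv_normal_form Suc.prems by blast
  obtain a' j' where a': "set a' \<subseteq> {1..<k}" "j' \<in> {1..Suc k}" "w' \<bowtie> a' @ ?c j'"
    using eqv_normal_form Suc.prems by blast
  have val: "(word_perm b \<circ> word_perm (?c i)) i = Suc k"
    if "set b \<subseteq> {1..<k}" "i \<in> {1..Suc k}" for b i
  proof -
    have "word_perm (?c i) i = Suc k" using that by (intro word_perm_descending) auto
    moreover have "word_perm b (Suc k) = Suc k"
      by (rule permutes_not_in[OF word_perm_permutes[OF that(1)]]) simp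
    ultimately show ?thesis by simp
  qed
  have eq: "word_perm a \<circ> word_perm (?c j) = word_perm a' \<circ> word_perm (?c j')"
    using a a' Suc.prems(4) by (simp add: eqv_def word_perm_append)
  have "word_perm a \<circ> word_perm (?c j) = word_perm w"
    using a by (simp add: eqv_def word_perm_append)
  then have "inj (word_perm a \<circ> word_perm (?c j))"
    using word_perm_permutes[OF Suc.prems(1)] permutes_inj by metis
  then have j: "j = j'"
    using val[OF a(1,2)] val[OF a'(1,2)] eq by (metis injD)
  have "word_perm a = word_perm a'"
  proof -
    have "(word_perm a \<circ> word_perm (?c j)) \<circ> word_perm (rev (?c j))
        = (word_perm a' \<circ> word_perm (?c j)) \<circ> word_perm (rev (?c j))" using eq j by simp
    then show ?thesis
      using word_perm_rev[of "rev (?c j)"] by (simp only: comp_assoc rev_rev_ident comp_id)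
  qed
  then have "a \<bowtie> a'" using Suc.IH a a' Suc.prems(3) by simp
  then have "a @ ?c j \<bowtie> a' @ ?c j"
    using a(2) Suc.prems(3) by (intro eqv_right) auto
  then show ?case using a(3) a'(3) j eqv_trans eqv_sym by blast
qed

theorem word_perm_determines:
  assumes "set w \<subseteq> {1..<n}" "set w' \<subseteq> {1..<n}" "word_perm w = word_perm w'"
  shows "\<phi> w = \<phi> w'"
proof -
  have "w \<bowtie> w'" using eqv_if_word_perm_eq[OF assms(1,2) _ assms(3)] by simp
  then have "\<phi> ([] @ w @ []) = \<phi> ([] @ w' @ [])"
    unfolding eqv_def by (metis empty_subsetI list.set(1))
  then show ?thesis by simp
qed

end

section \<open>Products over lists\<close>

context monoid
begin

lemma list_prod_simps [simp]:
  "list_prod G [] = \<one>" "list_prod G (x # xs) = x \<otimes> list_prod G xs"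
  by (simp_all add: list_prod_def)

lemma list_prod_closed [simp]: "set xs \<subseteq> carrier G \<Longrightarrow> list_prod G xs \<in> carrier G"
  by (induction xs) auto

lemma list_prod_append:
  "set xs \<subseteq> carrier G \<Longrightarrow> set ys \<subseteq> carrier G \<Longrightarrow>
    list_prod G (xs @ ys) = list_prod G xs \<otimes> list_prod G ys"
  by (induction xs) (auto simp: m_assoc)

lemma list_prod_replicate: "x \<in> carrier G \<Longrightarrow> list_prod G (replicate k x) = x [^] k"
  by (induction k) (auto simp: nat_pow_Suc2[symmetric] simp del: nat_pow_Suc)

lemma list_prod_commute:
  assumes "x \<in> carrier G" "set ys \<subseteq> carrier G" "\<And>y. y \<in> set ys \<Longrightarrow> x \<otimes> y = y \<otimes> x"
  shows "x \<otimes> list_prod G ys = list_prod G ys \<otimes> x"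
  using assms
proof (induction ys)
  case (Cons y ys)
  then have "x \<otimes> (y \<otimes> list_prod G ys) = (y \<otimes> x) \<otimes> list_prod G ys"
    by (simp add: m_assoc[symmetric])
  also have "\<dots> = y \<otimes> (list_prod G ys \<otimes> x)" using Cons by (simp add: m_assoc)
  also have "\<dots> = (y \<otimes> list_prod G ys) \<otimes> x" using Cons by (simp add: m_assoc)
  finally show ?case by simp
qed simp

lemma pow_commute:
  assumes "x \<in> carrier G" "y \<in> carrier G" "x \<otimes> y = y \<otimes> x"
  shows "x \<otimes> y [^] (k :: nat) = y [^] k \<otimes> x"
  using group_commutes_pow[of y x k] assms by simp

lemma list_prod_map_pow_bump:
  assumes x: "\<And>i. i \<in> set is \<Longrightarrow> x i \<in> carrier G"
    and comm: "\<And>i j. i \<in> set is \<Longrightarrow> j \<in> set is \<Longrightarrow> x i \<otimes> x j = x j \<otimes> x i"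
    and "distinct is" "j \<in> set is"
  shows "x j \<otimes> list_prod G (map (\<lambda>i. x i [^] \<alpha> i) is)
    = list_prod G (map (\<lambda>i. x i [^] bump j \<alpha> i) is)"
  using assms
proof (induction "is")
  case (Cons i "is")
  have cl: "x i \<in> carrier G" "x j \<in> carrier G" "set (map (\<lambda>i. x i [^] \<alpha> i) is) \<subseteq> carrier G"
    using Cons.prems by auto
  show ?case
  proof (cases "i = j")
    case True
    then have "list_prod G (map (\<lambda>i. x i [^] bump j \<alpha> i) is)
        = list_prod G (map (\<lambda>i. x i [^] \<alpha> i) is)"
      using Cons.prems(3) by (intro arg_cong[where f = "list_prod G"] map_cong) (auto simp: bump_def)
    moreover have "x j [^] bump j \<alpha> j = x j \<otimes> x j [^] \<alpha> j"
      using cl nat_pow_Suc2[of "x j" "\<alpha> j"] by (simp add: bump_def del: nat_pow_Suc)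
    ultimately show ?thesis
      using True cl by (simp add: m_assoc)
  next
    case False
    then have j: "j \<in> set is" using Cons.prems(4) by simp
    have "x j \<otimes> (x i [^] \<alpha> i \<otimes> list_prod G (map (\<lambda>i. x i [^] \<alpha> i) is))
        = x i [^] \<alpha> i \<otimes> (x j \<otimes> list_prod G (map (\<lambda>i. x i [^] \<alpha> i) is))"
      using cl Cons.prems(2)[of j i] j by (simp add: m_assoc[symmetric] pow_commute)
    also have "x j \<otimes> list_prod G (map (\<lambda>i. x i [^] \<alpha> i) is)
        = list_prod G (map (\<lambda>i. x i [^] bump j \<alpha> i) is)"
      using Cons.prems j by (intro Cons.IH) auto
    finally show ?thesis using False by (simp add: bump_def)
  qed
qed simp

end

section \<open>The ordered monomials span\<close>

lemma (in module) linear_ext_in_submodule: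
  assumes "submodule R N M" "f \<in> fin_supp R Y" "\<And>y. y \<in> Y \<Longrightarrow> \<phi> y \<in> N"
  shows "linear_ext R M \<phi> f \<in> N"
proof -
  interpret sub: submodule R N M by fact
  have "(\<Oplus>\<^bsub>M\<^esub>y\<in>A. f y \<odot>\<^bsub>M\<^esub> \<phi> y) \<in> N" if "finite A" "A \<subseteq> Y" for A
    using that
  proof (induction A)
    case (insert y A)
    have c: "f z \<odot>\<^bsub>M\<^esub> \<phi> z \<in> N" if "z \<in> Y" for z
      using that assms(3) fin_suppD(1)[OF assms(2)] by auto
    then have "(\<Oplus>\<^bsub>M\<^esub>y\<in>insert y A. f y \<odot>\<^bsub>M\<^esub> \<phi> y)
        = f y \<odot>\<^bsub>M\<^esub> \<phi> y \<oplus>\<^bsub>M\<^esub> (\<Oplus>\<^bsub>M\<^esub>y\<in>A. f y \<odot>\<^bsub>M\<^esub> \<phi> y)"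
      using insert sub.subset by (intro M.finsum_insert) (auto dest: c)
    then show ?case using insert c by auto
  qed simp
  then show ?thesis
    unfolding linear_ext_def using fin_suppD[OF assms(2)] by blast
qed

context wreath_algebra
begin

abbreviation "SG \<equiv> carrier (sym_group n)"
abbreviation "H \<equiv> wreath_hecke F G n"

definition proj :: "('g wreath_gen list \<Rightarrow> 'f) \<Rightarrow> ('g wreath_gen list \<Rightarrow> 'f) set"
  where "proj p = wreath_ideal F G n +>\<^bsub>FA\<^esub> p"

sublocale quo: algebra_quotient F FA "wreath_ideal F G n"
  by (intro algebra_quotient.intro FA.assoc_algebra_axioms ideal_wreath_ideal)

sublocale H: assoc_algebra F H
  unfolding wreath_hecke_def by (rule quo.assoc_algebra_quot)

abbreviation hmult (infixl \<open>\<star>\<close> 70) where "x \<star> y \<equiv> x \<otimes>\<^bsub>H\<^esub> y"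

lemma proj_hom: "mod_hom F FA H proj"
  unfolding wreath_hecke_def proj_def by (rule quo.proj.mod_hom_axioms)

lemma proj_closed [simp]: "p \<in> carrier FA \<Longrightarrow> proj p \<in> carrier H"
  by (rule mod_hom.f_im[OF proj_hom])

lemma proj_surj: "y \<in> carrier H \<Longrightarrow> \<exists>p\<in>carrier FA. y = proj p"
  unfolding wreath_hecke_def proj_def using quo.carrier_quot by auto

lemma proj_mult: "p \<in> carrier FA \<Longrightarrow> q \<in> carrier FA \<Longrightarrow> proj (p \<otimes>\<^bsub>FA\<^esub> q) = proj p \<star> proj q"
  unfolding wreath_hecke_def proj_def using quo.proj_mult by simp

lemma proj_one: "proj \<one>\<^bsub>FA\<^esub> = \<one>\<^bsub>H\<^esub>"
  unfolding wreath_hecke_def proj_def by (rule quo.proj_one)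

lemma proj_zero_iff: "p \<in> carrier FA \<Longrightarrow> proj p = \<zero>\<^bsub>H\<^esub> \<longleftrightarrow> p \<in> wreath_ideal F G n"
  unfolding wreath_hecke_def proj_def by (rule quo.proj_eq_zero_iff)

lemma proj_rel: "wreath_rel F G n l r \<Longrightarrow> proj l = proj r"
  unfolding proj_def using relator_mem wreath_rel_closed quo.proj_eq_iff by blast

abbreviation "hgen \<equiv> hecke_gen F G n"
abbreviation "xh i \<equiv> hgen (GenX i)"
abbreviation "gh g \<equiv> hgen (GenG g)"
abbreviation "sh i \<equiv> hgen (GenS i)"

lemma hecke_gen_eq: "hgen z = proj (delta F [z])"
  by (simp add: hecke_gen_def proj_def)

lemma hecke_gen_closed [simp]: "z \<in> wreath_gens G n \<Longrightarrow> hgen z \<in> carrier H"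
  by (simp add: hecke_gen_eq)

lemma proj_word: "u \<in> W \<Longrightarrow> proj (delta F u) = list_prod H (map (hgen) u)"
proof (induction u)
  case Nil
  then show ?case using proj_one by (simp add: FA_simps H.A.list_prod_simps)
next
  case (Cons z u)
  then have "proj (delta F (z # u)) = proj (delta F [z] \<otimes>\<^bsub>FA\<^esub> delta F u)" by simp
  also have "\<dots> = hgen z \<star> proj (delta F u)"
    using Cons by (subst proj_mult) (auto simp: hecke_gen_eq)
  finally show ?case using Cons by (simp add: H.A.list_prod_simps)
qed

lemma gh_mult: "g \<in> carrier GN \<Longrightarrow> h \<in> carrier GN \<Longrightarrow> gh g \<star> gh h = gh (g \<otimes>\<^bsub>GN\<^esub> h)"
  using proj_rel[OF wreath_rel.g_mult[of g G n h F]] by (simp add: hecke_gen_eq proj_mult[symmetric])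

lemma gh_one: "gh \<one>\<^bsub>GN\<^esub> = \<one>\<^bsub>H\<^esub>"
  using proj_rel[OF wreath_rel.g_one[of F G n]] proj_one by (simp add: hecke_gen_eq)

lemma xh_comm: "i \<in> {1..n} \<Longrightarrow> j \<in> {1..n} \<Longrightarrow> xh i \<star> xh j = xh j \<star> xh i"
  using proj_rel[OF wreath_rel.x_x[of i n j F G]]
  by (simp add: hecke_gen_eq proj_mult[symmetric] del: One_nat_def)

lemma xh_gh: "i \<in> {1..n} \<Longrightarrow> g \<in> carrier GN \<Longrightarrow> xh i \<star> gh g = gh g \<star> xh i"
  using proj_rel[OF wreath_rel.x_g[of i n g G F]]
  by (simp add: hecke_gen_eq proj_mult[symmetric] del: One_nat_def)

lemma sh_sq: "i \<in> {1..<n} \<Longrightarrow> sh i \<star> sh i = \<one>\<^bsub>H\<^esub>"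
  using proj_rel[OF wreath_rel.s_sq[of i n F G]] proj_one
  by (simp add: hecke_gen_eq proj_mult[symmetric] del: One_nat_def)

lemma sh_far: "i \<in> {1..<n} \<Longrightarrow> j \<in> {1..<n} \<Longrightarrow> Suc i < j \<Longrightarrow> sh i \<star> sh j = sh j \<star> sh i"
  using proj_rel[OF wreath_rel.s_comm[of i n j F G]]
  by (simp add: hecke_gen_eq proj_mult[symmetric] del: One_nat_def)

lemma sh_braid:
  "i \<in> {1..<n} \<Longrightarrow> Suc i \<in> {1..<n} \<Longrightarrow> sh i \<star> sh (Suc i) \<star> sh i = sh (Suc i) \<star> sh i \<star> sh (Suc i)"
  using proj_rel[OF wreath_rel.s_braid[of i n F G]]
  by (simp add: hecke_gen_eq proj_mult[symmetric] del: One_nat_def)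

lemma sh_xh_far:
  "i \<in> {1..<n} \<Longrightarrow> j \<in> {1..n} \<Longrightarrow> j \<noteq> i \<Longrightarrow> j \<noteq> Suc i \<Longrightarrow> sh i \<star> xh j = xh j \<star> sh i"
  using proj_rel[OF wreath_rel.s_x_far[of i n j F G]]
  by (simp add: hecke_gen_eq proj_mult[symmetric] del: One_nat_def)

lemma sh_gh: "i \<in> {1..<n} \<Longrightarrow> g \<in> carrier GN \<Longrightarrow> sh i \<star> gh g = gh (sact i g) \<star> sh i"
  using proj_rel[OF wreath_rel.s_g[of i n g G F]] sact_closed[of i g]
  by (simp add: hecke_gen_eq proj_mult[symmetric] sact_def[symmetric] del: One_nat_def)

text \<open>The image of \<open>t\<^sub>i\<^sub>,\<^sub>i\<^sub>+\<^sub>1\<close>.\<close>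

definition th :: "nat \<Rightarrow> ('g wreath_gen list \<Rightarrow> 'f) set"
  where "th i = (\<Oplus>\<^bsub>H\<^esub>h\<in>carrier G. gh (tw i (Suc i) h))"

lemma th_closed [simp]: "th i \<in> carrier H"
  unfolding th_def by (intro H.M.finsum_closed) auto

lemma proj_free_t: "proj (free_t F G n i (Suc i)) = th i"
  unfolding free_t_eq th_def hecke_gen_eq
  by (intro mod_hom.hom_finsum[OF proj_hom]) auto

lemma sh_xh: "i \<in> {1..<n} \<Longrightarrow> sh i \<star> xh i = xh (Suc i) \<star> sh i \<ominus>\<^bsub>H\<^esub> th i"
  using proj_rel[OF wreath_rel.s_x[of i n F G]]
    mod_hom.f_minus[OF proj_hom, of "delta F [GenX (Suc i), GenS i]" "free_t F G n i (Suc i)"]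
  by (simp add: hecke_gen_eq proj_mult[symmetric] proj_free_t del: One_nat_def)

lemma sh_th:
  assumes i: "i \<in> {1..<n}"
  shows "sh i \<star> th i = th i \<star> sh i"
proof -
  have s: "sh i \<in> carrier H" using i by simp
  have bij: "(\<lambda>h. inv\<^bsub>G\<^esub> h) ` carrier G = carrier G" "inj_on (\<lambda>h. inv\<^bsub>G\<^esub> h) (carrier G)"
    using bij_inv_G by (auto simp: bij_betw_def)
  have "sh i \<star> th i = (\<Oplus>\<^bsub>H\<^esub>h\<in>carrier G. sh i \<star> gh (tw i (Suc i) h))"
    unfolding th_def using s by (intro mod_hom.hom_finsum[OF H.l_mult_hom]) auto
  also have "\<dots> = (\<Oplus>\<^bsub>H\<^esub>h\<in>carrier G. gh (tw i (Suc i) (inv\<^bsub>G\<^esub> h)) \<star> sh i)"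
    using i s by (intro H.M.finsum_cong') (auto simp: sh_gh sact_tw tw_swap[of i "Suc i"])
  also have "\<dots> = (\<Oplus>\<^bsub>H\<^esub>h\<in>(\<lambda>h. inv\<^bsub>G\<^esub> h) ` carrier G. gh (tw i (Suc i) h) \<star> sh i)"
    using s bij by (intro H.M.finsum_reindex[symmetric]) auto
  also have "\<dots> = th i \<star> sh i"
    unfolding th_def bij using s by (intro mod_hom.hom_finsum[OF H.r_mult_hom, symmetric]) auto
  finally show ?thesis .
qed

text \<open>The second commutation relation is the first one, solved for \<open>x\<^sub>i\<^sub>+\<^sub>1 s\<^sub>i\<close> and conjugated by \<open>s\<^sub>i\<close>.\<close>

lemma sh_xh_Suc:
  assumes i: "i \<in> {1..<n}"
  shows "sh i \<star> xh (Suc i) = xh i \<star> sh i \<oplus>\<^bsub>H\<^esub> th i"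
proof -
  have c: "sh i \<in> carrier H" "xh i \<in> carrier H" "xh (Suc i) \<in> carrier H" using i by auto
  have eq: "xh (Suc i) \<star> sh i = sh i \<star> xh i \<oplus>\<^bsub>H\<^esub> th i"
    using sh_xh[OF i] c by (simp add: a_minus_def H.M.a_assoc H.M.l_neg)
  have "sh i \<star> xh (Suc i) = sh i \<star> (xh (Suc i) \<star> sh i) \<star> sh i"
    using c i by (simp add: H.A.m_assoc sh_sq)
  also have "\<dots> = (sh i \<star> sh i) \<star> xh i \<star> sh i \<oplus>\<^bsub>H\<^esub> (sh i \<star> th i) \<star> sh i"
    unfolding eq using c by (simp add: H.A.m_assoc H.A.l_distr H.A.r_distr)
  also have "\<dots> = xh i \<star> sh i \<oplus>\<^bsub>H\<^esub> th i \<star> (sh i \<star> sh i)"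
    unfolding sh_th[OF i] using c i by (simp add: sh_sq H.A.m_assoc)
  finally show ?thesis using c i by (simp add: sh_sq)
qed

abbreviation "xmon \<equiv> hecke_monom F G n"
abbreviation "hperm \<equiv> hecke_perm F G n"

lemma monom_closed [simp]: "xmon \<alpha> \<in> carrier H"
  unfolding hecke_monom_def by (rule H.A.list_prod_closed) auto

lemma xh_monom: "j \<in> {1..n} \<Longrightarrow> xh j \<star> xmon \<alpha> = xmon (bump j \<alpha>)"
  unfolding hecke_monom_def
  by (rule H.A.list_prod_map_pow_bump) (auto intro!: xh_comm simp del: One_nat_def)

lemma monom_zero:
  assumes "\<And>j. j \<in> {1..n} \<Longrightarrow> \<alpha> j = 0"
  shows "xmon \<alpha> = \<one>\<^bsub>H\<^esub>"
proof -
  have "list_prod H (map (\<lambda>i. xh i [^]\<^bsub>H\<^esub> \<alpha> i) is) = \<one>\<^bsub>H\<^esub>" if "set is \<subseteq> {1..n}" for "is"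
    using that
  proof (induction "is")
    case (Cons i "is")
    then show ?case using assms[of i] by simp
  qed simp
  from this[of "[1..<Suc n]"] show ?thesis unfolding hecke_monom_def by (simp add: atLeastLessThanSuc_atLeastAtMost del: upt_Suc)
qed

lemma gh_monom:
  assumes "g \<in> carrier GN"
  shows "gh g \<star> xmon \<alpha> = xmon \<alpha> \<star> gh g"
proof -
  have "gh g \<star> xh i [^]\<^bsub>H\<^esub> \<alpha> i = xh i [^]\<^bsub>H\<^esub> \<alpha> i \<star> gh g" if "i \<in> {1..n}" for i
    using assms that xh_gh[OF that assms] by (intro H.A.pow_commute) simp_all
  then show ?thesis
    unfolding hecke_monom_def using assms by (intro H.A.list_prod_commute) auto
qed

abbreviation "sprod ks \<equiv> list_prod H (map (\<lambda>i. sh i) ks)"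

sublocale cox: coxeter_invariant n sprod
proof
  have c: "set (map (\<lambda>i. sh i) u) \<subseteq> carrier H" if "set u \<subseteq> {1..<n}" for u
    using that by auto
  note app = H.A.list_prod_append
  fix u v i assume u: "set u \<subseteq> {1..<n}" and v: "set v \<subseteq> {1..<n}" and i: "i \<in> {1..<n}"
  have sq: "sprod [i, i] = \<one>\<^bsub>H\<^esub>" using i by (simp add: sh_sq)
  have "sprod (u @ [i, i] @ v)
      = sprod u \<star> (sprod [i, i]
        \<star> sprod v)"
    unfolding map_append using c[OF u] c[OF v] c[of "[i, i]"] i
    by (simp only: app set_append Un_subset_iff empty_subsetI insert_subset list.set simp_thms)
  also have "\<dots> = sprod (u @ v)"
    unfolding sq map_append using c[OF u] c[OF v] by (simp add: app)
  finally show "sprod (u @ [i, i] @ v) = sprod (u @ v)" .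
  have mid: "sprod (u @ w @ v) = sprod (u @ w' @ v)"
    if "set w \<subseteq> {1..<n}" "set w' \<subseteq> {1..<n}"
      "sprod w = sprod w'" for w w'
    unfolding map_append using c[OF u] c[OF v] c[OF that(1)] c[OF that(2)] that(3)
    by (simp add: app)
  fix j
  show "sprod (u @ [i, j] @ v) = sprod (u @ [j, i] @ v)"
    if "j \<in> {1..<n}" "Suc i < j"
    using that i sh_far[OF i that] by (intro mid) auto
  show "sprod (u @ [i, Suc i, i] @ v)
      = sprod (u @ [Suc i, i, Suc i] @ v)"
    if "Suc i \<in> {1..<n}"
    using that i sh_braid[OF i that] by (intro mid) (auto simp: H.A.m_assoc)
qed

text \<open>By the word problem the definite description picks out the product along any word for the
  permutation.\<close>

lemma hperm_word:
  assumes "set ks \<subseteq> {1..<n}"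
  shows "hperm (word_perm ks) = sprod ks"
  unfolding hecke_perm_def list_prod_sym_group
  by (rule the_equality) (use assms cox.word_perm_determines in blast)+

lemma hperm_closed [simp]: "w \<in> SG \<Longrightarrow> hperm w \<in> carrier H"
proof -
  assume "w \<in> SG"
  then obtain ks where "set ks \<subseteq> {1..<n}" "w = word_perm ks"
    using word_perm_surj by (auto simp: sym_group_carrier)
  moreover have "set (map (\<lambda>i. sh i) ks) \<subseteq> carrier H" using \<open>set ks \<subseteq> {1..<n}\<close> by auto
  ultimately show ?thesis by (simp add: hperm_word)
qed

lemma sh_hperm:
  assumes "i \<in> {1..<n}" "w \<in> SG"
  shows "sh i \<star> hperm w = hperm (simple_refl i \<circ> w)"
proof -
  obtain ks where ks: "set ks \<subseteq> {1..<n}" "w = word_perm ks"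
    using assms(2) word_perm_surj by (auto simp: sym_group_carrier)
  then have "hperm (word_perm (i # ks)) = sh i \<star> hperm w"
    using assms(1) by (simp add: hperm_word del: word_perm_simps)
  then show ?thesis using ks by simp
qed

abbreviation "EM \<equiv> exponent_monoid n"
abbreviation "B \<equiv> carrier EM \<times> carrier GN \<times> SG"
abbreviation "bas \<equiv> hecke_basis_elem F G n"

lemma EM_carrier: "carrier EM = extensional {1..n}"
  by (auto simp: exponent_monoid_def PiE_def)

lemma bas_eq: "bas (\<alpha>, g, w) = xmon \<alpha> \<star> gh g \<star> hperm w"
  by (simp add: hecke_basis_elem_def)

lemma bas_closed [simp]: "b \<in> B \<Longrightarrow> bas b \<in> carrier H"
  by (cases b) (auto simp: bas_eq)

definition span_map :: "((nat \<Rightarrow> nat) \<times> (nat \<Rightarrow> 'g) \<times> (nat \<Rightarrow> nat) \<Rightarrow> 'f)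
    \<Rightarrow> ('g wreath_gen list \<Rightarrow> 'f) set"
  where "span_map = linear_ext F H bas"

lemma span_map_hom: "mod_hom F (free_module F B) H span_map"
  unfolding span_map_def by (rule H.linear_ext_hom) (rule bas_closed)

definition monomial_span :: "('g wreath_gen list \<Rightarrow> 'f) set set"
  where "monomial_span = span_map ` fin_supp F B"

lemma submodule_monomial_span: "submodule F monomial_span H"
  using mod_hom.im_is_submodule[OF span_map_hom] by (simp add: monomial_span_def mod_hom.im_def[OF span_map_hom])

interpretation span: submodule F monomial_span H by (rule submodule_monomial_span)

lemma mem_closed: "y \<in> monomial_span \<Longrightarrow> y \<in> carrier H"
  using span.subset by blast

lemma bas_mem: "b \<in> B \<Longrightarrow> bas b \<in> monomial_span"
  unfolding monomial_span_def span_map_def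
  by (rule image_eqI[of _ _ "delta F b"]) (auto simp: H.linear_ext_delta)

text \<open>Left multiplication is linear, so stability has to be checked on the ordered monomials only.\<close>

lemma mem_stable:
  assumes z: "z \<in> carrier H" and "\<And>b. b \<in> B \<Longrightarrow> z \<star> bas b \<in> monomial_span" and "y \<in> monomial_span"
  shows "z \<star> y \<in> monomial_span"
proof -
  obtain c where c: "c \<in> fin_supp F B" "y = linear_ext F H bas c"
    using assms(3) by (auto simp: monomial_span_def span_map_def)
  have "z \<star> y = linear_ext F H (\<lambda>b. z \<star> bas b) c"
    unfolding c(2) by (rule mod_hom.linear_ext[OF H.l_mult_hom[OF z] c(1) bas_closed])
  also have "\<dots> \<in> monomial_span"
    by (rule H.linear_ext_in_submodule[OF submodule_monomial_span c(1) assms(2)])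
  finally show ?thesis .
qed

lemma mem_minus: "x \<in> monomial_span \<Longrightarrow> y \<in> monomial_span \<Longrightarrow> x \<ominus>\<^bsub>H\<^esub> y \<in> monomial_span"
proof -
  assume x: "x \<in> monomial_span" and y: "y \<in> monomial_span"
  have "(\<ominus>\<^bsub>F\<^esub> \<one>\<^bsub>F\<^esub>) \<odot>\<^bsub>H\<^esub> y = \<ominus>\<^bsub>H\<^esub> y" using y by (simp add: H.smult_l_minus mem_closed)
  moreover have "(\<ominus>\<^bsub>F\<^esub> \<one>\<^bsub>F\<^esub>) \<odot>\<^bsub>H\<^esub> y \<in> monomial_span" using y by simp
  ultimately show ?thesis using x by (simp add: a_minus_def)
qed

lemma xh_bas:
  assumes "j \<in> {1..n}" "g \<in> carrier GN" "w \<in> SG"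
  shows "xh j \<star> bas (\<alpha>, g, w) = bas (bump j \<alpha>, g, w)"
  using assms xh_monom[OF assms(1), of \<alpha>] by (simp add: bas_eq H.A.m_assoc[symmetric] del: One_nat_def)

lemma xh_mem: "j \<in> {1..n} \<Longrightarrow> y \<in> monomial_span \<Longrightarrow> xh j \<star> y \<in> monomial_span"
  by (rule mem_stable)
    (auto simp: xh_bas EM_carrier bump_def extensional_def intro!: bas_mem simp del: One_nat_def)

lemma gh_mem:
  assumes h: "h \<in> carrier GN" and y: "y \<in> monomial_span"
  shows "gh h \<star> y \<in> monomial_span"
proof (rule mem_stable[OF _ _ y])
  fix b assume "b \<in> B"
  then obtain \<alpha> g w where b: "b = (\<alpha>, g, w)" "\<alpha> \<in> carrier EM" "g \<in> carrier GN"
    "w \<in> SG" by auto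
  have "gh h \<star> bas b = (gh h \<star> xmon \<alpha>) \<star> gh g \<star> hperm w"
    using b h by (simp add: bas_eq H.A.m_assoc)
  also have "\<dots> = bas (\<alpha>, h \<otimes>\<^bsub>GN\<^esub> g, w)"
    unfolding gh_monom[OF h] using b h gh_mult[OF h b(3)] by (simp add: bas_eq H.A.m_assoc[symmetric])
      (simp add: H.A.m_assoc)
  finally show "gh h \<star> bas b \<in> monomial_span" using b h by (auto intro!: bas_mem)
qed (use h in simp)

lemma th_mem:
  assumes y: "y \<in> monomial_span"
  shows "th i \<star> y \<in> monomial_span"
proof -
  have yc: "y \<in> carrier H" using y by (rule mem_closed)
  have "(\<Oplus>\<^bsub>H\<^esub>h\<in>A. gh (tw i (Suc i) h) \<star> y) \<in> monomial_span" if "finite A" "A \<subseteq> carrier G" for A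
    using that
  proof (induction A)
    case (insert h A)
    then have "(\<Oplus>\<^bsub>H\<^esub>h\<in>insert h A. gh (tw i (Suc i) h) \<star> y)
        = gh (tw i (Suc i) h) \<star> y \<oplus>\<^bsub>H\<^esub> (\<Oplus>\<^bsub>H\<^esub>h\<in>A. gh (tw i (Suc i) h) \<star> y)"
      using yc by (intro H.M.finsum_insert) auto
    then show ?case using insert y gh_mem by auto
  qed simp
  moreover have "th i \<star> y = (\<Oplus>\<^bsub>H\<^esub>h\<in>carrier G. gh (tw i (Suc i) h) \<star> y)"
    unfolding th_def by (intro mod_hom.hom_finsum[OF H.r_mult_hom[OF yc]]) auto
  ultimately show ?thesis using finite_G by simp
qed

text \<open>Pull a variable out of the monomial. The reflection moves past it at the cost of a multiple of \<open>t\<close>;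
  both terms lie in the span by induction and by stability under the variables and the base group.
  Once the exponent is zero, the reflection passes the base group and meets the permutation.\<close>

lemma sh_bas_mem:
  assumes i: "i \<in> {1..<n}" and g: "g \<in> carrier GN" and w: "w \<in> SG"
    and "\<alpha> \<in> extensional {1..n}"
  shows "sh i \<star> bas (\<alpha>, g, w) \<in> monomial_span"
proof -
  have "finite {1..n}" by simp
  then have "\<alpha> \<in> extensional {1..n} \<longrightarrow> sh i \<star> bas (\<alpha>, g, w) \<in> monomial_span"
  proof (induction \<alpha> rule: bump_induct)
    case (zero \<alpha>)
    have mz: "xmon \<alpha> = \<one>\<^bsub>H\<^esub>" by (rule monom_zero[OF zero])
    have "sh i \<star> bas (\<alpha>, g, w) = sh i \<star> gh g \<star> hperm w"
      using i g w by (simp add: bas_eq mz H.A.m_assoc)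
    also have "\<dots> = gh (sact i g) \<star> hperm (simple_refl i \<circ> w)"
      unfolding sh_gh[OF i g] sh_hperm[OF i w, symmetric] using i g w
      by (simp add: H.A.m_assoc del: One_nat_def)
    also have "\<dots> = bas (\<alpha>, sact i g, simple_refl i \<circ> w)"
      using i g w by (simp add: bas_eq mz del: One_nat_def)
    finally show ?case
      using i g w by (auto intro!: bas_mem permutes_compose simple_refl_permutes
          simp: EM_carrier sym_group_carrier simp del: One_nat_def)
  next
    case (bump \<alpha> j)
    show ?case
    proof
      assume "bump j \<alpha> \<in> extensional {1..n}"
      then have \<alpha>: "\<alpha> \<in> extensional {1..n}" using bump.hyps by (auto simp: extensional_def bump_def)
      define y where "y = bas (\<alpha>, g, w)"
      have y: "y \<in> monomial_span" unfolding y_def using \<alpha> g w by (intro bas_mem) (auto simp: EM_carrier)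
      note yc = mem_closed[OF y]
      have sy: "sh i \<star> y \<in> monomial_span" unfolding y_def using bump.IH \<alpha> by blast
      have c: "sh i \<in> carrier H" "xh j \<in> carrier H" using i bump.hyps by auto
      have "sh i \<star> bas (bump j \<alpha>, g, w) = (sh i \<star> xh j) \<star> y"
        unfolding y_def xh_bas[OF bump.hyps g w, symmetric]
        using c yc by (simp add: H.A.m_assoc y_def)
      also have "\<dots> \<in> monomial_span"
      proof -
        consider "j = i" | "j = Suc i" | "j \<noteq> i" "j \<noteq> Suc i" by blast
        then show ?thesis
        proof cases
          case 1
          have k: "Suc i \<in> {1..n}" using i by simp
          have "(sh i \<star> xh j) \<star> y = xh (Suc i) \<star> (sh i \<star> y) \<ominus>\<^bsub>H\<^esub> th i \<star> y"
            unfolding 1 sh_xh[OF i] using c k yc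
            by (simp add: a_minus_def H.A.l_distr H.A.l_minus H.A.m_assoc del: One_nat_def)
          then show ?thesis using mem_minus xh_mem[OF k sy] th_mem[OF y] by simp
        next
          case 2
          have k: "i \<in> {1..n}" using i by simp
          have "(sh i \<star> xh j) \<star> y = xh i \<star> (sh i \<star> y) \<oplus>\<^bsub>H\<^esub> th i \<star> y"
            unfolding 2 sh_xh_Suc[OF i] using c k yc
            by (simp add: H.A.l_distr H.A.m_assoc del: One_nat_def)
          then show ?thesis using xh_mem[OF k sy] th_mem[OF y] by simp
        next
          case 3
          then have "(sh i \<star> xh j) \<star> y = xh j \<star> (sh i \<star> y)"
            using sh_xh_far[OF i bump.hyps] c yc by (simp add: H.A.m_assoc)
          then show ?thesis using xh_mem[OF bump.hyps sy] by simp
        qed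
      qed
      finally show "sh i \<star> bas (bump j \<alpha>, g, w) \<in> monomial_span" .
    qed
  qed
  then show ?thesis using assms by blast
qed

lemma sh_mem: "i \<in> {1..<n} \<Longrightarrow> y \<in> monomial_span \<Longrightarrow> sh i \<star> y \<in> monomial_span"
  by (rule mem_stable) (auto intro!: sh_bas_mem simp: EM_carrier simp del: One_nat_def)

lemma proj_word_mem: "u \<in> W \<Longrightarrow> proj (delta F u) \<in> monomial_span"
proof (induction u)
  case Nil
  let ?\<alpha> = "\<lambda>k\<in>{1..n}. 0 :: nat"
  have id: "id \<in> SG" by (simp add: sym_group_carrier permutes_id)
  have "hperm id = \<one>\<^bsub>H\<^esub>" using hperm_word[of "[]"] by simp
  then have "bas (?\<alpha>, \<one>\<^bsub>GN\<^esub>, id) = \<one>\<^bsub>H\<^esub>"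
    using monom_zero[of ?\<alpha>] by (simp add: bas_eq gh_one)
  then have "\<one>\<^bsub>H\<^esub> \<in> monomial_span" using bas_mem[of "(?\<alpha>, \<one>\<^bsub>GN\<^esub>, id)"] id by (simp add: EM_carrier)
  then show ?case using proj_one by (simp add: FA_simps)
next
  case (Cons z u)
  then have "proj (delta F (z # u)) = hgen z \<star> proj (delta F u)"
    using proj_word[of "z # u"] proj_word[of u] by simp
  moreover have "hgen z \<star> proj (delta F u) \<in> monomial_span"
    using Cons gh_mem sh_mem xh_mem by (auto simp: wreath_gens_def simp del: One_nat_def)
  ultimately show ?case by simp
qed

text \<open>The span contains the unit and is stable under left multiplication by generators, so it contains
  all words.\<close>

theorem span_map_surj: "span_map ` fin_supp F B = carrier H"
proof
  show "span_map ` fin_supp F B \<subseteq> carrier H" using span.subset by (simp add: monomial_span_def)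
  show "carrier H \<subseteq> span_map ` fin_supp F B"
  proof
    fix y assume "y \<in> carrier H"
    then obtain p where p: "p \<in> carrier FA" "y = proj p" using proj_surj by blast
    have "mod_hom F (free_module F W) H proj"
      using proj_hom F.module_free_module[of W] unfolding free_algebra_def
      by (simp add: mod_hom_def mod_hom_axioms_def module_hom_def)
    then have "y = linear_ext F H (\<lambda>u. proj (delta F u)) p"
      unfolding p(2) using p(1) by (intro mod_hom_free_eq) (simp_all add: FA_simps)
    also have "\<dots> \<in> monomial_span"
      using p(1) proj_word_mem by (intro H.linear_ext_in_submodule[OF submodule_monomial_span]) (auto simp: FA_simps)
    finally show "y \<in> span_map ` fin_supp F B" by (simp add: monomial_span_def)
  qed
qed

end

section \<open>Linear independence of the ordered monomials\<close>

context module
begin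

context
  fixes e :: "'x \<Rightarrow> 'c" and B :: "'x set"
  assumes bij: "bij_betw (linear_ext R M e) (fin_supp R B) (carrier M)"
    and e: "\<And>b. b \<in> B \<Longrightarrow> e b \<in> carrier M" and nontriv: "\<one> \<noteq> \<zero>"
begin

lemma linear_ext_bij_inj: "inj_on e B"
proof (rule inj_onI)
  fix b b' assume b: "b \<in> B" "b' \<in> B" "e b = e b'"
  then have "linear_ext R M e (delta R b) = linear_ext R M e (delta R b')"
    using e by (simp add: linear_ext_delta)
  then have "delta R b = delta R b'"
    using bij b R.delta_mem by (metis bij_betw_def inj_onD)
  then have "delta R b b' = delta R b' b'" by simp
  then show "b = b'" using nontriv by (auto simp: delta_def split: if_splits)
qed

text \<open>A vanishing combination of the elements, indexed by the elements themselves, is pulled back along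
  \<open>e\<close> to one indexed by \<open>B\<close>.\<close>

lemma linear_ext_bij_lin_indpt: "lin_indpt (e ` B)"
proof
  assume "lin_dep (e ` B)"
  then obtain A a v where A: "finite A" "A \<subseteq> e ` B" "a \<in> A \<rightarrow> carrier R"
    and 0: "lincomb a A = \<zero>\<^bsub>M\<^esub>" and v: "v \<in> A" "a v \<noteq> \<zero>"
    unfolding lin_dep_def by blast
  define A' where "A' = {b \<in> B. e b \<in> A}"
  have inj: "inj_on e A'" using linear_ext_bij_inj by (rule inj_on_subset) (auto simp: A'_def)
  have img: "e ` A' = A" using A(2) by (auto simp: A'_def)
  have fin: "finite A'" using A(1) img inj by (metis finite_imageD)
  define c where "c = (\<lambda>b. if b \<in> A' then a (e b) else \<zero>)"
  have c: "c \<in> fin_supp R B"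
    using A(3) fin by (intro fin_suppI[where A=A']) (auto simp: c_def A'_def)
  have "linear_ext R M e c = (\<Oplus>\<^bsub>M\<^esub>b\<in>A'. c b \<odot>\<^bsub>M\<^esub> e b)"
    using fin fin_suppD[OF c] e by (intro linear_ext_superset) (auto simp: c_def A'_def)
  also have "\<dots> = (\<Oplus>\<^bsub>M\<^esub>b\<in>A'. a (e b) \<odot>\<^bsub>M\<^esub> e b)"
    using A(3) e by (intro M.finsum_cong') (auto simp: c_def A'_def)
  also have "\<dots> = (\<Oplus>\<^bsub>M\<^esub>v\<in>e ` A'. a v \<odot>\<^bsub>M\<^esub> v)"
    using inj A(3) e by (intro M.finsum_reindex[symmetric]) (auto simp: A'_def)
  also have "\<dots> = \<zero>\<^bsub>M\<^esub>" using 0 by (simp add: img lincomb_def)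
  finally have "linear_ext R M e c = \<zero>\<^bsub>M\<^esub>" .
  moreover have z: "(\<lambda>_. \<zero>) \<in> fin_supp R B" by (rule fin_suppI[where A="{}"]) auto
  moreover have "linear_ext R M e (\<lambda>_. \<zero>) = \<zero>\<^bsub>M\<^esub>" by (simp add: linear_ext_def)
  ultimately have "c = (\<lambda>_. \<zero>)" using bij c by (metis bij_betw_def inj_onD)
  then have "c b = \<zero>" for b by (rule fun_cong)
  moreover obtain b where "b \<in> A'" "v = e b" using v(1) img by blast
  ultimately show False using v(2) by (metis c_def)
qed

lemma linear_ext_bij_span: "span (e ` B) = carrier M"
proof
  show "span (e ` B) \<subseteq> carrier M" using e by (intro span_is_subset2) auto
  show "carrier M \<subseteq> span (e ` B)"
  proof
    fix y assume "y \<in> carrier M"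
    then obtain c where c: "c \<in> fin_supp R B" "y = linear_ext R M e c"
      using bij by (auto simp: bij_betw_def)
    have "y \<in> span (e ` B)" if "submodule R (span (e ` B)) M"
      unfolding c(2) using e in_own_span[of "e ` B"]
      by (intro linear_ext_in_submodule[OF that c(1)]) blast
    then show "y \<in> span (e ` B)" using span_is_submodule[of "e ` B"] e by blast
  qed
qed

end

end

context wreath_algebra
begin

text \<open>The left regular action of the wreath product on its elements, as pairs of a base element and a
  permutation. Other points are fixed, so that the relations hold on the whole type.\<close>

definition reg_act :: "(nat \<Rightarrow> 'g) \<Rightarrow> (nat \<Rightarrow> 'g) \<times> (nat \<Rightarrow> nat) \<Rightarrow> (nat \<Rightarrow> 'g) \<times> (nat \<Rightarrow> nat)"
  where "reg_act h m = (if m \<in> carrier GN \<times> SG then (h \<otimes>\<^bsub>GN\<^esub> fst m, snd m) else m)"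

definition reg_refl :: "nat \<Rightarrow> (nat \<Rightarrow> 'g) \<times> (nat \<Rightarrow> nat) \<Rightarrow> (nat \<Rightarrow> 'g) \<times> (nat \<Rightarrow> nat)"
  where "reg_refl i m = (if m \<in> carrier GN \<times> SG
    then (sact i (fst m), simple_refl i \<circ> snd m) else m)"

lemma sact_mult:
  "i \<in> {1..<n} \<Longrightarrow> g \<in> carrier GN \<Longrightarrow> h \<in> carrier GN \<Longrightarrow> sact i (g \<otimes>\<^bsub>GN\<^esub> h) = sact i g \<otimes>\<^bsub>GN\<^esub> sact i h"
  by (auto simp: sact_eq GN_mult fun_eq_iff simple_refl_mem_iff simp del: atLeastAtMost_iff One_nat_def)

lemma sact_one: "i \<in> {1..<n} \<Longrightarrow> sact i \<one>\<^bsub>GN\<^esub> = \<one>\<^bsub>GN\<^esub>"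
  by (auto simp: sact_eq GN_one fun_eq_iff simple_refl_mem_iff simp del: atLeastAtMost_iff One_nat_def)

lemma refl_sym_group: "i \<in> {1..<n} \<Longrightarrow> w \<in> SG \<Longrightarrow> simple_refl i \<circ> w \<in> SG"
  by (auto simp: sym_group_carrier intro!: permutes_compose simple_refl_permutes simp del: One_nat_def)

lemma reg_refl_eq:
  "g \<in> carrier GN \<Longrightarrow> w \<in> SG \<Longrightarrow> reg_refl i (g, w) = (sact i g, simple_refl i \<circ> w)"
  by (simp add: reg_refl_def)

lemma reg_act_eq:
  "g \<in> carrier GN \<Longrightarrow> w \<in> SG \<Longrightarrow> reg_act h (g, w) = (h \<otimes>\<^bsub>GN\<^esub> g, w)"
  by (simp add: reg_act_def)

lemma sact_comm:
  "i \<in> {1..<n} \<Longrightarrow> j \<in> {1..<n} \<Longrightarrow> Suc i < j \<Longrightarrow> sact i (sact j g) = sact j (sact i g)"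
  by (auto simp: sact_eq fun_eq_iff simple_refl_mem_iff simple_refl_comm[of i j]
      simp del: atLeastAtMost_iff atLeastLessThan_iff One_nat_def)

lemma sact_braid:
  "i \<in> {1..<n} \<Longrightarrow> Suc i \<in> {1..<n} \<Longrightarrow>
    sact i (sact (Suc i) (sact i g)) = sact (Suc i) (sact i (sact (Suc i) g))"
  by (auto simp: sact_eq fun_eq_iff simple_refl_mem_iff simple_refl_braid
      simp del: atLeastAtMost_iff atLeastLessThan_iff One_nat_def)

sublocale reg: wreath_rep F G n reg_act reg_refl
proof (intro wreath_rep.intro wreath_algebra_axioms wreath_set.intro wreath_group_axioms
    wreath_set_axioms.intro)
  fix m :: "(nat \<Rightarrow> 'g) \<times> (nat \<Rightarrow> nat)"
  show "reg_act \<one>\<^bsub>GN\<^esub> m = m"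
    by (cases m) (auto simp: reg_act_def)
  {
    fix g h assume "g \<in> carrier GN" "h \<in> carrier GN"
    then show "reg_act g (reg_act h m) = reg_act (g \<otimes>\<^bsub>GN\<^esub> h) m"
      by (cases m) (auto simp: reg_act_def GN.m_assoc)
  }
  fix i assume i: "i \<in> {1..<n}"
  show "reg_refl i (reg_refl i m) = m"
  proof (cases "m \<in> carrier GN \<times> SG")
    case True
    then obtain g w where m: "m = (g, w)" "g \<in> carrier GN" "w \<in> SG" by auto
    then show ?thesis unfolding m(1) using i m(2,3)
      by (simp add: reg_refl_eq refl_sym_group fun_eq_iff del: One_nat_def)
  qed (auto simp: reg_refl_def)
  show "reg_refl i (reg_act g m) = reg_act (sact i g) (reg_refl i m)" if "g \<in> carrier GN" for g
  proof (cases "m \<in> carrier GN \<times> SG")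
    case True
    then obtain h w where m: "m = (h, w)" "h \<in> carrier GN" "w \<in> SG" by auto
    then show ?thesis unfolding m(1) using i m(2,3) that
      by (simp add: reg_refl_eq reg_act_eq refl_sym_group sact_mult del: One_nat_def)
  qed (auto simp: reg_refl_def reg_act_def)
  fix j
  show "reg_refl i (reg_refl j m) = reg_refl j (reg_refl i m)" if j: "j \<in> {1..<n}" "Suc i < j"
  proof (cases "m \<in> carrier GN \<times> SG")
    case True
    then obtain g w where m: "m = (g, w)" "g \<in> carrier GN" "w \<in> SG" by auto
    then show ?thesis unfolding m(1) using i j m(2,3)
      by (simp add: reg_refl_eq refl_sym_group sact_comm[OF i j] simple_refl_comm[of i j] fun_eq_iff del: One_nat_def)
  qed (auto simp: reg_refl_def)
  show "reg_refl i (reg_refl (Suc i) (reg_refl i m)) = reg_refl (Suc i) (reg_refl i (reg_refl (Suc i) m))"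
    if j: "Suc i \<in> {1..<n}"
  proof (cases "m \<in> carrier GN \<times> SG")
    case True
    then obtain g w where m: "m = (g, w)" "g \<in> carrier GN" "w \<in> SG" by auto
    then show ?thesis unfolding m(1) using i j m(2,3)
      by (simp add: reg_refl_eq refl_sym_group sact_braid[OF i j] simple_refl_braid fun_eq_iff del: One_nat_def)
  qed (auto simp: reg_refl_def)
qed

definition x_word :: "(nat \<Rightarrow> nat) \<Rightarrow> nat list \<Rightarrow> 'g wreath_gen list"
  where "x_word \<alpha> is = concat (map (\<lambda>i. replicate (\<alpha> i) (GenX i)) is)"

lemma x_word_simps [simp]:
  "x_word \<alpha> [] = []"
  "x_word \<alpha> (i # is) = replicate (\<alpha> i) (GenX i) @ x_word \<alpha> is"
  by (simp_all add: x_word_def)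

lemma set_x_word: "set (x_word \<alpha> is) \<subseteq> GenX ` set is"
  by (induction "is") auto

lemma set_x_word_gens: "set is \<subseteq> {1..n} \<Longrightarrow> set (x_word \<alpha> is) \<subseteq> wreath_gens G n"
proof -
  assume "set is \<subseteq> {1..n}"
  then have "GenX ` set is \<subseteq> GenX ` {1..n}" by (rule image_mono)
  also have "\<dots> \<subseteq> wreath_gens G n" unfolding wreath_gens_def by (rule Un_upper2)
  finally show ?thesis using set_x_word[of \<alpha> "is"] by (rule order_trans[rotated])
qed

lemma word_op_x_word:
  "distinct is \<Longrightarrow> reg.word_op (x_word \<alpha> is) f \<beta> m
    = f (\<lambda>k. if k \<in> set is then \<beta> k + \<alpha> k else \<beta> k) m"
proof (induction "is" arbitrary: f)
  case (Cons i "is")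
  have rep: "reg.word_op (replicate k (GenX i)) f \<gamma> m = f (\<gamma>(i := \<gamma> i + k)) m" for k f \<gamma>
    by (induction k arbitrary: f) (auto simp: reg.Xop_def bump_def)
  have "(\<lambda>k. if k \<in> set is then \<beta> k + \<alpha> k else \<beta> k)(i := \<beta> i + \<alpha> i)
      = (\<lambda>k. if k \<in> set (i # is) then \<beta> k + \<alpha> k else \<beta> k)"
    by auto
  then show ?case using Cons by (simp add: rep)
qed simp

lemma list_prod_x_word:
  assumes "set is \<subseteq> {1..n}"
  shows "list_prod H (map (hgen) (x_word \<alpha> is))
    = list_prod H (map (\<lambda>i. xh i [^]\<^bsub>H\<^esub> \<alpha> i) is)"
  using assms
proof (induction "is")
  case (Cons i "is")
  have "set (map (hgen) (x_word \<alpha> is)) \<subseteq> carrier H"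
    using set_x_word_gens[of "is" \<alpha>] Cons.prems by auto
  moreover have "set (replicate (\<alpha> i) (xh i)) \<subseteq> carrier H" using Cons.prems by auto
  moreover have "xh i \<in> carrier H" using Cons.prems by simp
  ultimately show ?case
    using Cons by (simp add: H.A.list_prod_append H.A.list_prod_replicate del: set_replicate_conv_if)
qed simp

definition perm_word :: "(nat \<Rightarrow> nat) \<Rightarrow> nat list"
  where "perm_word w = (SOME ks. set ks \<subseteq> {1..<n} \<and> w = word_perm ks)"

lemma perm_word:
  assumes "w \<in> SG"
  shows "set (perm_word w) \<subseteq> {1..<n}" "word_perm (perm_word w) = w"
proof -
  have "\<exists>ks. set ks \<subseteq> {1..<n} \<and> w = word_perm ks"
    using assms word_perm_surj by (auto simp: sym_group_carrier)
  from someI_ex[OF this] show "set (perm_word w) \<subseteq> {1..<n}" "word_perm (perm_word w) = w"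
    by (simp_all add: perm_word_def)
qed

text \<open>Lifts the ordered monomial to the free algebra, where functionals can be evaluated on it.\<close>

definition basis_word :: "(nat \<Rightarrow> nat) \<times> (nat \<Rightarrow> 'g) \<times> (nat \<Rightarrow> nat) \<Rightarrow> 'g wreath_gen list"
  where "basis_word = (\<lambda>(\<alpha>, g, w). x_word \<alpha> [1..<Suc n] @ [GenG g] @ map GenS (perm_word w))"

lemma basis_word_W: "b \<in> B \<Longrightarrow> basis_word b \<in> W"
proof -
  assume "b \<in> B"
  then obtain \<alpha> g w where b: "b = (\<alpha>, g, w)" "g \<in> carrier GN" "w \<in> SG" by auto
  have "set (x_word \<alpha> [1..<Suc n]) \<subseteq> wreath_gens G n"
    by (rule set_x_word_gens) auto
  then have "set (basis_word b) \<subseteq> wreath_gens G n"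
    using b perm_word(1)[OF b(3)] by (auto simp: basis_word_def simp del: upt_Suc)
  then show ?thesis by blast
qed

lemma proj_basis_word: "b \<in> B \<Longrightarrow> proj (delta F (basis_word b)) = bas b"
proof -
  assume bB: "b \<in> B"
  then obtain \<alpha> g w where b: "b = (\<alpha>, g, w)" "g \<in> carrier GN" "w \<in> SG" by auto
  have c: "set (map (hgen) (x_word \<alpha> [1..<Suc n])) \<subseteq> carrier H"
      "set (map (\<lambda>i. sh i) (perm_word w)) \<subseteq> carrier H"
  proof -
    have "set (x_word \<alpha> [1..<Suc n]) \<subseteq> wreath_gens G n" by (rule set_x_word_gens) auto
    then show "set (map (hgen) (x_word \<alpha> [1..<Suc n])) \<subseteq> carrier H" by (auto simp del: upt_Suc)
    show "set (map (\<lambda>i. sh i) (perm_word w)) \<subseteq> carrier H" using perm_word(1)[OF b(3)] by auto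
  qed
  have "list_prod H (map (hgen) (x_word \<alpha> [1..<Suc n])) = xmon \<alpha>"
    unfolding hecke_monom_def by (rule list_prod_x_word) auto
  moreover have "sprod (perm_word w) = hperm w"
    using hperm_word[OF perm_word(1)[OF b(3)]] perm_word(2)[OF b(3)] by simp
  moreover have "proj (delta F (basis_word b))
      = list_prod H (map (hgen) (x_word \<alpha> [1..<Suc n])
          @ (gh g # map (\<lambda>i. sh i) (perm_word w)))"
    using proj_word[OF basis_word_W[OF bB]] by (simp add: basis_word_def b(1) comp_def del: upt_Suc)
  ultimately show ?thesis
    using c b by (simp add: H.A.list_prod_append bas_eq H.A.m_assoc del: upt_Suc)
qed

text \<open>Applied to the unit monomial at the identity, the word of \<open>x\<^sup>\<alpha> g w\<close> builds up exactly the point \<open>(g, w)\<close> and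
  then the exponent \<open>\<alpha>\<close>: in degree zero a reflection operator only moves the point, so no correction
  terms appear.\<close>

lemma word_op_basis_word:
  assumes "b \<in> B"
  shows "reg.word_op (basis_word b) f (\<lambda>k\<in>{1..n}. 0) (\<one>\<^bsub>GN\<^esub>, id) = f (fst b) (snd b)"
proof -
  obtain \<alpha> g w where b: "b = (\<alpha>, g, w)" "\<alpha> \<in> extensional {1..n}" "g \<in> carrier GN" "w \<in> SG"
    using assms by (auto simp: EM_carrier)
  \<comment> \<open>Constants, so that the induction below does not eta-expand them.\<close>
  define z :: "nat \<Rightarrow> nat" where "z = (\<lambda>k\<in>{1..n}. 0)"
  define m\<^sub>0 :: "(nat \<Rightarrow> 'g) \<times> (nat \<Rightarrow> nat)" where "m\<^sub>0 = (\<one>\<^bsub>GN\<^esub>, id)"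
  have s: "reg.word_op (map GenS ks) f' z m\<^sub>0 = f' z (\<one>\<^bsub>GN\<^esub>, word_perm ks)"
    if "set ks \<subseteq> {1..<n}" for ks f'
    using that
  proof (induction ks arbitrary: f')
    case (Cons k ks)
    have w: "word_perm ks \<in> SG"
      using word_perm_permutes[of ks n] Cons.prems by (simp add: sym_group_carrier)
    have "reg.word_op (map GenS (k # ks)) f' z m\<^sub>0
        = reg.Sop k f' z (\<one>\<^bsub>GN\<^esub>, word_perm ks)"
      using Cons by simp
    also have "\<dots> = f' z (reg_refl k (\<one>\<^bsub>GN\<^esub>, word_perm ks))"
      using Cons.prems by (intro reg.Sop_zero) (auto simp: z_def)
    also have "\<dots> = f' z (\<one>\<^bsub>GN\<^esub>, word_perm (k # ks))"
      using Cons.prems w by (simp add: reg_refl_eq sact_one del: One_nat_def)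
    finally show ?case .
  qed (simp add: m\<^sub>0_def)
  have x: "reg.word_op (x_word \<alpha> [1..<Suc n]) f z m = f \<alpha> m" for m
  proof -
    have "(\<lambda>k. if k \<in> set [1..<Suc n] then z k + \<alpha> k else z k) = \<alpha>"
      using b(2) by (auto simp: z_def extensional_def fun_eq_iff)
    then show ?thesis by (subst word_op_x_word) simp_all
  qed
  show ?thesis unfolding b(1) z_def[symmetric] m\<^sub>0_def[symmetric]
    using b(3,4) perm_word[OF b(4)]
    by (simp add: basis_word_def s reg.Gop_def reg_act_eq x del: upt_Suc One_nat_def)
qed

text \<open>If a combination of ordered monomials vanishes in the quotient, then the corresponding combination
  of words lies in the ideal and is killed by every matrix coefficient. The one given by the indicator
  function of an index \<open>b\<close> reads off the coefficient at \<open>b\<close>.\<close>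

lemma span_map_inj: "inj_on span_map (fin_supp F B)"
proof -
  have zero: "c = (\<lambda>_. \<zero>\<^bsub>F\<^esub>)" if c: "c \<in> fin_supp F B" and 0: "span_map c = \<zero>\<^bsub>H\<^esub>" for c
  proof
    fix b
    let ?z = "\<lambda>k\<in>{1..n}. 0 :: nat"
    define p where "p = linear_ext F FA (\<lambda>b. delta F (basis_word b)) c"
    have p: "p \<in> carrier FA"
      unfolding p_def using basis_word_W by (intro FA.linear_ext_closed[OF c]) auto
    have "proj p = linear_ext F H (\<lambda>b. proj (delta F (basis_word b))) c"
      unfolding p_def using basis_word_W by (intro mod_hom.linear_ext[OF proj_hom c]) auto
    also have "\<dots> = span_map c"
      unfolding span_map_def by (rule H.linear_ext_cong[OF c proj_basis_word bas_closed])
    finally have ideal: "p \<in> wreath_ideal F G n" using 0 p by (simp add: proj_zero_iff)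
    show "c b = \<zero>\<^bsub>F\<^esub>"
    proof (cases "b \<in> B")
      case True
      define f :: "(nat \<Rightarrow> nat) \<Rightarrow> (nat \<Rightarrow> 'g) \<times> (nat \<Rightarrow> nat) \<Rightarrow> int"
        where "f = (\<lambda>\<alpha> m. if (\<alpha>, m) = b then 1 else 0)"
      let ?\<mu> = "reg.matcoef f ?z (\<one>\<^bsub>GN\<^esub>, id)"
      have hom: "mod_hom F FA (self_module F) (functional ?\<mu>)"
        by (rule linear_ext_FA_hom) (auto intro: reg.self.module_axioms)
      have "\<zero>\<^bsub>F\<^esub> = functional ?\<mu> p"
        by (rule reg.wreath_ideal_annihilated[OF ideal, symmetric])
      also have "\<dots> = functional
          (\<lambda>b'. functional ?\<mu> (delta F (basis_word b'))) c"
        unfolding p_def using basis_word_W by (intro mod_hom.linear_ext[OF hom c]) auto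
      also have "\<dots> = functional (\<lambda>b'. delta F b b') c"
      proof (rule reg.self.linear_ext_cong[OF c])
        fix b' assume "b' \<in> B"
        then show "functional ?\<mu> (delta F (basis_word b')) = delta F b b'"
          using word_op_basis_word[of b' f]
          by (subst reg.self.linear_ext_delta) (auto simp: f_def delta_def)
      qed (auto simp: delta_def)
      also have "\<dots> = (\<Oplus>\<^bsub>F\<^esub>b'\<in>insert b (support F c). c b' \<otimes>\<^bsub>F\<^esub> delta F b b')"
        using fin_suppD[OF c]
        by (subst reg.self.linear_ext_superset[where A="insert b (support F c)"])
          (auto simp: delta_def F.finsum_self_module)
      also have "\<dots> = (\<Oplus>\<^bsub>F\<^esub>b'\<in>insert b (support F c). if b = b' then c b' else \<zero>\<^bsub>F\<^esub>)"
        using fin_suppD[OF c] by (intro F.finsum_cong') (auto simp: delta_def)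
      also have "\<dots> = c b"
        using fin_suppD[OF c] by (intro F.finsum_singleton) auto
      finally show ?thesis by simp
    next
      case False
      then show ?thesis using fin_suppD(3)[OF c] by auto
    qed
  qed
  show ?thesis by (rule F.free_hom_inj_onI[OF span_map_hom zero])
qed

lemma span_map_bij: "bij_betw span_map (fin_supp F B) (carrier H)"
  using span_map_inj span_map_surj by (simp add: bij_betw_def)

lemma vectorspace_H: "vectorspace F H"
  by (intro vectorspace.intro H.module_axioms F.field_axioms)

theorem ordered_monomials_basis:
  "inj_on bas B" "vectorspace.basis F H (bas ` B)"
proof -
  interpret V: vectorspace F H by (rule vectorspace_H)
  note * = span_map_bij[unfolded span_map_def] bas_closed F.one_not_zero
  show "inj_on bas B" by (rule H.linear_ext_bij_inj[OF *])
  show "V.basis (bas ` B)"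
    unfolding V.basis_def
    by (intro conjI image_subsetI H.linear_ext_bij_lin_indpt[OF *] H.linear_ext_bij_span[OF *] bas_closed)
qed

end

section \<open>Tensor products of based modules\<close>

lemma mod_hom_inv_into:
  assumes "mod_hom R M N T" "bij_betw T (carrier M) (carrier N)"
  shows "mod_hom R N M (inv_into (carrier M) T)"
proof -
  interpret T: mod_hom R M N T by fact
  let ?S = "inv_into (carrier M) T"
  have S: "?S y \<in> carrier M" "T (?S y) = y" if "y \<in> carrier N" for y
    using that assms(2) by (auto simp: bij_betw_def inv_into_into f_inv_into_f)
  have eq: "?S y = x" if "x \<in> carrier M" "T x = y" for x y
    using that assms(2) by (auto simp: bij_betw_def)
  show ?thesis
  proof (intro mod_hom.intro mod_hom_axioms.intro module_homI T.N.module_axioms T.M.module_axioms)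
    fix x y assume "x \<in> carrier N" "y \<in> carrier N"
    then show "?S (x \<oplus>\<^bsub>N\<^esub> y) = ?S x \<oplus>\<^bsub>M\<^esub> ?S y" using S by (intro eq) auto
  next
    fix a x assume "a \<in> carrier R" "x \<in> carrier N"
    then show "?S (a \<odot>\<^bsub>N\<^esub> x) = a \<odot>\<^bsub>M\<^esub> ?S x" using S by (intro eq) auto
  qed (use S in auto)
qed

lemma mod_hom_comp:
  assumes "mod_hom R M N T" "mod_hom R N P S"
  shows "mod_hom R M P (\<lambda>x. S (T x))"
proof -
  interpret T: mod_hom R M N T by fact
  interpret S: mod_hom R N P S by fact
  show ?thesis
    by (intro mod_hom.intro mod_hom_axioms.intro module_homI T.M.module_axioms S.N.module_axioms) auto
qed

lemma (in cring) fin_supp_times: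
  assumes "f \<in> fin_supp R Y" "g \<in> fin_supp R Z"
  shows "(\<lambda>(y, z). f y \<otimes> g z) \<in> fin_supp R (Y \<times> Z)"
  using fin_suppD[OF assms(1)] fin_suppD[OF assms(2)]
  by (intro fin_suppI[where A = "support R f \<times> support R g"]) auto

context module
begin

lemma linear_ext_pair:
  assumes f: "f \<in> fin_supp R Y" and g: "g \<in> fin_supp R Z"
    and \<phi>: "\<And>y z. y \<in> Y \<Longrightarrow> z \<in> Z \<Longrightarrow> \<phi> y z \<in> carrier M"
  shows "linear_ext R M (\<lambda>y. linear_ext R M (\<phi> y) g) f
    = linear_ext R M (\<lambda>(y, z). \<phi> y z) (\<lambda>(y, z). f y \<otimes> g z)"
proof -
  let ?A = "support R f" and ?B = "support R g"
  have A: "finite ?A" "\<And>y. y \<in> ?A \<Longrightarrow> y \<in> Y" "\<And>x. f x \<in> carrier R"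
    and B: "finite ?B" "\<And>y. y \<in> ?B \<Longrightarrow> y \<in> Z" "\<And>x. g x \<in> carrier R"
    using fin_suppD[OF f] fin_suppD[OF g] by auto
  have cl: "\<phi> y z \<in> carrier M" if "y \<in> ?A" "z \<in> ?B" for y z
    using that A B \<phi> by blast
  have "linear_ext R M (\<lambda>y. linear_ext R M (\<phi> y) g) f
      = (\<Oplus>\<^bsub>M\<^esub>y\<in>?A. \<Oplus>\<^bsub>M\<^esub>z\<in>?B. (f y \<otimes> g z) \<odot>\<^bsub>M\<^esub> \<phi> y z)"
    unfolding linear_ext_def
  proof (intro M.finsum_cong')
    fix y assume y: "y \<in> ?A"
    have "f y \<odot>\<^bsub>M\<^esub> (\<Oplus>\<^bsub>M\<^esub>z\<in>?B. g z \<odot>\<^bsub>M\<^esub> \<phi> y z) = (\<Oplus>\<^bsub>M\<^esub>z\<in>?B. f y \<odot>\<^bsub>M\<^esub> (g z \<odot>\<^bsub>M\<^esub> \<phi> y z))"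
      using A B cl y by (intro finsum_smult_ldistr Pi_I smult_closed) simp_all
    also have "\<dots> = (\<Oplus>\<^bsub>M\<^esub>z\<in>?B. (f y \<otimes> g z) \<odot>\<^bsub>M\<^esub> \<phi> y z)"
      using A B cl y by (intro M.finsum_cong' Pi_I smult_closed) (simp_all add: smult_assoc1)
    finally show "f y \<odot>\<^bsub>M\<^esub> (\<Oplus>\<^bsub>M\<^esub>z\<in>?B. g z \<odot>\<^bsub>M\<^esub> \<phi> y z) = (\<Oplus>\<^bsub>M\<^esub>z\<in>?B. (f y \<otimes> g z) \<odot>\<^bsub>M\<^esub> \<phi> y z)" .
  qed (use A B cl in \<open>auto intro!: M.finsum_closed\<close>)
  also have "\<dots> = finsum M (\<lambda>(y, z). (f y \<otimes> g z) \<odot>\<^bsub>M\<^esub> \<phi> y z) (?A \<times> ?B)"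
    using A B cl by (intro M.add.finprod_finprod) auto
  also have "\<dots> = (\<Oplus>\<^bsub>M\<^esub>p\<in>?A \<times> ?B. (case p of (y, z) \<Rightarrow> f y \<otimes> g z) \<odot>\<^bsub>M\<^esub> (case p of (y, z) \<Rightarrow> \<phi> y z))"
    by (rule arg_cong[where f = "\<lambda>h. finsum M h (?A \<times> ?B)"]) auto
  also have "\<dots> = linear_ext R M (\<lambda>(y, z). \<phi> y z) (\<lambda>(y, z). f y \<otimes> g z)"
    using A B cl by (intro linear_ext_superset[symmetric]) auto
  finally show ?thesis .
qed

text \<open>Used for the pure tensors as well as for the product of the Hecke algebra, which is why the two
  sides of the multiplication map can be compared.\<close>

lemma linear_ext_bilinear:
  assumes "mod_hom R (free_module R Y) V (linear_ext R V e)" "\<And>y. y \<in> Y \<Longrightarrow> e y \<in> carrier V"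
    and "mod_hom R (free_module R Z) W (linear_ext R W d)" "\<And>z. z \<in> Z \<Longrightarrow> d z \<in> carrier W"
    and l: "\<And>w. w \<in> carrier W \<Longrightarrow> mod_hom R V M (\<lambda>v. \<beta> v w)"
    and r: "\<And>v. v \<in> carrier V \<Longrightarrow> mod_hom R W M (\<lambda>w. \<beta> v w)"
    and f: "f \<in> fin_supp R Y" and g: "g \<in> fin_supp R Z"
  shows "\<beta> (linear_ext R V e f) (linear_ext R W d g)
    = linear_ext R M (\<lambda>(y, z). \<beta> (e y) (d z)) (\<lambda>(y, z). f y \<otimes> g z)"
proof -
  have w: "linear_ext R W d g \<in> carrier W"
    using mod_hom.f_im[OF assms(3), of g] g by simp
  have cl: "\<beta> v w \<in> carrier M" if "v \<in> carrier V" "w \<in> carrier W" for v w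
    using mod_hom.f_im[OF l[OF that(2)] that(1)] .
  have "\<beta> (linear_ext R V e f) (linear_ext R W d g)
      = linear_ext R M (\<lambda>y. \<beta> (e y) (linear_ext R W d g)) f"
    by (rule mod_hom.linear_ext[OF l[OF w] f assms(2)])
  also have "\<dots> = linear_ext R M (\<lambda>y. linear_ext R M (\<lambda>z. \<beta> (e y) (d z)) g) f"
  proof (rule linear_ext_cong[OF f])
    fix y assume y: "y \<in> Y"
    show "\<beta> (e y) (linear_ext R W d g) = linear_ext R M (\<lambda>z. \<beta> (e y) (d z)) g"
      by (rule mod_hom.linear_ext[OF r[OF assms(2)[OF y]] g assms(4)])
    show "linear_ext R M (\<lambda>z. \<beta> (e y) (d z)) g \<in> carrier M"
      using y assms(2,4) cl by (intro linear_ext_closed[OF g]) auto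
  qed
  also have "\<dots> = linear_ext R M (\<lambda>(y, z). \<beta> (e y) (d z)) (\<lambda>(y, z). f y \<otimes> g z)"
    using assms(2,4) cl by (intro linear_ext_pair[OF f g]) auto
  finally show ?thesis .
qed

end

text \<open>A basis, expressed by coordinates: the family \<open>e\<close> identifies \<open>V\<close> with the free module on its index set.\<close>

locale based_module = module R V for R and V (structure) +
  fixes e :: "'x \<Rightarrow> 'c" and I :: "'x set"
  assumes e_closed: "x \<in> I \<Longrightarrow> e x \<in> carrier V"
    and bij: "bij_betw (linear_ext R V e) (fin_supp R I) (carrier V)"
begin

lemma combination_hom: "mod_hom R (free_module R I) V (linear_ext R V e)"
  by (rule linear_ext_hom) (rule e_closed)

definition coords :: "'c \<Rightarrow> 'x \<Rightarrow> 'a"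
  where "coords = inv_into (fin_supp R I) (linear_ext R V e)"

lemma coords_hom: "mod_hom R V (free_module R I) coords"
  unfolding coords_def using mod_hom_inv_into[OF combination_hom] bij by simp

lemma coords_linear_ext: "f \<in> fin_supp R I \<Longrightarrow> coords (linear_ext R V e f) = f"
  unfolding coords_def using bij by (auto simp: bij_betw_def)

lemma coords_closed: "v \<in> carrier V \<Longrightarrow> coords v \<in> fin_supp R I"
  using mod_hom.f_im[OF coords_hom] by simp

lemma linear_ext_coords: "v \<in> carrier V \<Longrightarrow> linear_ext R V e (coords v) = v"
  unfolding coords_def using bij by (auto simp: bij_betw_def f_inv_into_f)

lemma coords_e: "x \<in> I \<Longrightarrow> coords (e x) = delta R x"
  using coords_linear_ext[of "delta R x"] e_closed[of x] by (simp add: linear_ext_delta)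

end

locale tensor_based = V: based_module R V e I + W: based_module R W d J
  for R :: "('f, 'r) ring_scheme" (structure) and V :: "('f, 'v, 'a) module_scheme"
    and e :: "'x \<Rightarrow> 'v" and I :: "'x set"
    and W :: "('f, 'w, 'b) module_scheme" and d :: "'y \<Rightarrow> 'w" and J :: "'y set"
begin

abbreviation "FVW \<equiv> free_module R (carrier V \<times> carrier W)"
abbreviation "FXY \<equiv> free_module R (I \<times> J)"
abbreviation "T \<equiv> tensor R V W"
abbreviation "pure \<equiv> pure_tensor R V W"

sublocale FVW: module R FVW by (rule V.R.module_free_module)
sublocale FXY: module R FXY by (rule V.R.module_free_module)

lemma delta_FVW [simp]: "v \<in> carrier V \<Longrightarrow> w \<in> carrier W \<Longrightarrow> delta R (v, w) \<in> carrier FVW"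
  by simp

lemma bilinear_relators_closed: "bilinear_relators R V W \<subseteq> carrier FVW"
  unfolding bilinear_relators_def Let_def
  by (intro Un_least) (auto simp del: free_module_simps
      intro!: FVW.M.minus_closed FVW.M.add.m_closed FVW.smult_closed delta_FVW)

sublocale quo: module_quotient R FVW "bilinear_kernel R V W"
  unfolding bilinear_kernel_def
  by (intro module_quotient.intro FVW.module_axioms FVW.span_is_submodule bilinear_relators_closed)

lemma module_tensor: "module R T"
  unfolding tensor_def by (rule quo.module_quot)

sublocale T: module R T by (rule module_tensor)

lemma quo_hom: "mod_hom R FVW T (\<lambda>f. bilinear_kernel R V W +>\<^bsub>FVW\<^esub> f)"
  unfolding tensor_def by (rule quo.proj.mod_hom_axioms)

lemma pure_closed [simp]: "v \<in> carrier V \<Longrightarrow> w \<in> carrier W \<Longrightarrow> pure v w \<in> carrier T"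
  unfolding pure_tensor_def by (rule mod_hom.f_im[OF quo_hom]) simp

abbreviation "cls f \<equiv> bilinear_kernel R V W +>\<^bsub>FVW\<^esub> f"

lemma relator_proj:
  assumes "f \<in> carrier FVW" "g \<in> carrier FVW" "f \<ominus>\<^bsub>FVW\<^esub> g \<in> bilinear_relators R V W"
  shows "cls f = cls g"
proof -
  have "f \<ominus>\<^bsub>FVW\<^esub> g \<in> bilinear_kernel R V W"
    unfolding bilinear_kernel_def using FVW.in_own_span[OF bilinear_relators_closed] assms(3) by blast
  then show ?thesis using quo.proj_eq_iff assms by blast
qed

lemma pure_hom_l:
  assumes w: "w \<in> carrier W"
  shows "mod_hom R V T (\<lambda>v. pure v w)"
proof (intro mod_hom.intro mod_hom_axioms.intro module_homI V.module_axioms module_tensor)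
  fix v v' assume v: "v \<in> carrier V" "v' \<in> carrier V"
  have "pure (v \<oplus>\<^bsub>V\<^esub> v') w
      = cls (delta R (v, w) \<oplus>\<^bsub>FVW\<^esub> delta R (v', w))"
    unfolding pure_tensor_def using v w
    by (intro relator_proj delta_FVW FVW.M.add.m_closed V.M.add.m_closed)
      (auto simp: bilinear_relators_def Let_def simp del: free_module_simps)
  also have "\<dots> = pure v w \<oplus>\<^bsub>T\<^esub> pure v' w"
    unfolding pure_tensor_def using v w
    by (intro mod_hom_add[OF quo_hom] delta_FVW)
  finally show "pure (v \<oplus>\<^bsub>V\<^esub> v') w = pure v w \<oplus>\<^bsub>T\<^esub> pure v' w" .
next
  fix a v assume a: "a \<in> carrier R" and v: "v \<in> carrier V"
  have "pure (a \<odot>\<^bsub>V\<^esub> v) w = cls (a \<odot>\<^bsub>FVW\<^esub> delta R (v, w))"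
    unfolding pure_tensor_def using a v w
    by (intro relator_proj delta_FVW FVW.smult_closed V.smult_closed)
      (auto simp: bilinear_relators_def Let_def simp del: free_module_simps)
  also have "\<dots> = a \<odot>\<^bsub>T\<^esub> pure v w"
    unfolding pure_tensor_def using a v w
    by (intro mod_hom_smult[OF quo_hom] delta_FVW)
  finally show "pure (a \<odot>\<^bsub>V\<^esub> v) w = a \<odot>\<^bsub>T\<^esub> pure v w" .
qed (use w in simp)

lemma pure_hom_r:
  assumes v: "v \<in> carrier V"
  shows "mod_hom R W T (\<lambda>w. pure v w)"
proof (intro mod_hom.intro mod_hom_axioms.intro module_homI W.module_axioms module_tensor)
  fix w w' assume w: "w \<in> carrier W" "w' \<in> carrier W"
  have "pure v (w \<oplus>\<^bsub>W\<^esub> w')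
      = cls (delta R (v, w) \<oplus>\<^bsub>FVW\<^esub> delta R (v, w'))"
    unfolding pure_tensor_def using v w
    by (intro relator_proj delta_FVW FVW.M.add.m_closed W.M.add.m_closed)
      (auto simp: bilinear_relators_def Let_def simp del: free_module_simps)
  also have "\<dots> = pure v w \<oplus>\<^bsub>T\<^esub> pure v w'"
    unfolding pure_tensor_def using v w
    by (intro mod_hom_add[OF quo_hom] delta_FVW)
  finally show "pure v (w \<oplus>\<^bsub>W\<^esub> w') = pure v w \<oplus>\<^bsub>T\<^esub> pure v w'" .
next
  fix a w assume a: "a \<in> carrier R" and w: "w \<in> carrier W"
  have "pure v (a \<odot>\<^bsub>W\<^esub> w) = cls (a \<odot>\<^bsub>FVW\<^esub> delta R (v, w))"
    unfolding pure_tensor_def using a v w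
    by (intro relator_proj delta_FVW FVW.smult_closed W.smult_closed)
      (auto simp: bilinear_relators_def Let_def simp del: free_module_simps)
  also have "\<dots> = a \<odot>\<^bsub>T\<^esub> pure v w"
    unfolding pure_tensor_def using a v w
    by (intro mod_hom_smult[OF quo_hom] delta_FVW)
  finally show "pure v (a \<odot>\<^bsub>W\<^esub> w) = a \<odot>\<^bsub>T\<^esub> pure v w" .
qed (use v in simp)

abbreviation "tbasis \<equiv> (\<lambda>(x, y). pure (e x) (d y))"

abbreviation "tcomb \<equiv> linear_ext R T tbasis"

lemma pure_linear_ext:
  assumes "f \<in> fin_supp R I" "g \<in> fin_supp R J"
  shows "pure (linear_ext R V e f) (linear_ext R W d g)
    = tcomb (\<lambda>(x, y). f x \<otimes> g y)"
  by (rule T.linear_ext_bilinear[OF V.combination_hom V.e_closed W.combination_hom W.e_closed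
        pure_hom_l pure_hom_r assms])

text \<open>The coordinates that the pure tensor of \<open>v\<close> and \<open>w\<close> is going to have.\<close>

definition tcoords :: "'v \<Rightarrow> 'w \<Rightarrow> 'x \<times> 'y \<Rightarrow> 'f"
  where "tcoords v w = (\<lambda>(x, y). V.coords v x \<otimes> W.coords w y)"

lemma tcoords_closed: "v \<in> carrier V \<Longrightarrow> w \<in> carrier W \<Longrightarrow> tcoords v w \<in> carrier FXY"
  unfolding tcoords_def using V.fin_supp_times[OF V.coords_closed W.coords_closed] by simp

lemma coords_carrier [simp]:
  "v \<in> carrier V \<Longrightarrow> V.coords v x \<in> carrier R" "w \<in> carrier W \<Longrightarrow> W.coords w y \<in> carrier R"
  using fin_suppD(1)[OF V.coords_closed] fin_suppD(1)[OF W.coords_closed] by auto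

lemma tcoords_add_l:
  "\<lbrakk>v \<in> carrier V; v' \<in> carrier V; w \<in> carrier W\<rbrakk> \<Longrightarrow>
    tcoords (v \<oplus>\<^bsub>V\<^esub> v') w = tcoords v w \<oplus>\<^bsub>FXY\<^esub> tcoords v' w"
  using mod_hom_add[OF V.coords_hom]
  by (auto simp: tcoords_def fun_eq_iff V.R.l_distr)

lemma tcoords_add_r:
  "\<lbrakk>v \<in> carrier V; w \<in> carrier W; w' \<in> carrier W\<rbrakk> \<Longrightarrow>
    tcoords v (w \<oplus>\<^bsub>W\<^esub> w') = tcoords v w \<oplus>\<^bsub>FXY\<^esub> tcoords v w'"
  using mod_hom_add[OF W.coords_hom]
  by (auto simp: tcoords_def fun_eq_iff V.R.r_distr)

lemma tcoords_smult_l: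
  "\<lbrakk>a \<in> carrier R; v \<in> carrier V; w \<in> carrier W\<rbrakk> \<Longrightarrow>
    tcoords (a \<odot>\<^bsub>V\<^esub> v) w = a \<odot>\<^bsub>FXY\<^esub> tcoords v w"
  using mod_hom_smult[OF V.coords_hom]
  by (auto simp: tcoords_def fun_eq_iff V.R.m_assoc)

lemma tcoords_smult_r:
  "\<lbrakk>a \<in> carrier R; v \<in> carrier V; w \<in> carrier W\<rbrakk> \<Longrightarrow>
    tcoords v (a \<odot>\<^bsub>W\<^esub> w) = a \<odot>\<^bsub>FXY\<^esub> tcoords v w"
  using mod_hom_smult[OF W.coords_hom]
  by (auto simp: tcoords_def fun_eq_iff V.R.m_lcomm)

abbreviation "coord_map \<equiv> linear_ext R FXY (\<lambda>(v, w). tcoords v w)"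

lemma coord_map_hom: "mod_hom R FVW FXY coord_map"
  by (rule FXY.linear_ext_hom) (auto intro: tcoords_closed[simplified])

lemma coord_map_delta:
  "v \<in> carrier V \<Longrightarrow> w \<in> carrier W \<Longrightarrow> coord_map (delta R (v, w)) = tcoords v w"
  by (subst FXY.linear_ext_delta) (auto intro: tcoords_closed[simplified])

text \<open>The coordinates of a pure tensor are bilinear, so every bilinearity relator is mapped to zero.\<close>

lemma coord_map_kernel:
  assumes "f \<in> bilinear_kernel R V W"
  shows "coord_map f = \<zero>\<^bsub>FXY\<^esub>"
proof -
  interpret C: mod_hom R FVW FXY coord_map by (rule coord_map_hom)
  have diff: "coord_map (f \<ominus>\<^bsub>FVW\<^esub> g) = \<zero>\<^bsub>FXY\<^esub>"
    if "f \<in> carrier FVW" "g \<in> carrier FVW" "coord_map f = coord_map g" for f g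
  proof -
    have "coord_map (f \<ominus>\<^bsub>FVW\<^esub> g) = coord_map g \<ominus>\<^bsub>FXY\<^esub> coord_map g"
      using C.f_minus[OF that(1,2)] that(3) by (simp only:)
    then show ?thesis
      using FXY.M.r_neg[OF C.f_im[OF that(2)]] by (simp only: a_minus_def)
  qed
  have "bilinear_relators R V W \<subseteq> C.ker"
  proof
    fix f assume f: "f \<in> bilinear_relators R V W"
    then have fc: "f \<in> carrier FVW" using bilinear_relators_closed by blast
    from f have "coord_map f = \<zero>\<^bsub>FXY\<^esub>"
      unfolding bilinear_relators_def Let_def
    proof (elim UnE CollectE exE conjE; hypsubst; intro diff)
    qed (auto simp: C.f_add C.f_smult coord_map_delta tcoords_add_l tcoords_add_r tcoords_smult_l
        tcoords_smult_r simp del: free_module_simps intro!: FVW.M.add.m_closed FVW.smult_closed)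
    then show "f \<in> C.ker" using fc by (simp add: C.ker_def del: free_module_simps)
  qed
  then have "bilinear_kernel R V W \<subseteq> C.ker"
    unfolding bilinear_kernel_def by (rule FVW.span_is_subset[OF _ C.ker_is_submodule])
  then show ?thesis using assms C.f_ker by blast
qed

lemma tbasis_closed: "p \<in> I \<times> J \<Longrightarrow> tbasis p \<in> carrier T"
  by (auto simp: V.e_closed W.e_closed)

text \<open>A combination of the \<open>e x \<otimes> d y\<close> lifts to the same combination of pairs in the free module, and the
  coordinate map, which does not see the relators, recovers the coefficients from the lift.\<close>

lemma tbasis_inj: "inj_on tcomb (fin_supp R (I \<times> J))"
proof -
  interpret L: mod_hom R FXY T "tcomb"
    by (rule T.linear_ext_hom) (rule tbasis_closed)
  interpret C: mod_hom R FVW FXY coord_map by (rule coord_map_hom)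
  have lift: "\<exists>p\<in>carrier FVW. tcomb c = cls p \<and> coord_map p = c"
    if c: "c \<in> fin_supp R (I \<times> J)" for c
  proof
    let ?\<epsilon> = "\<lambda>(x, y). delta R (e x, d y)"
    let ?p = "linear_ext R FVW ?\<epsilon> c"
    have \<epsilon>: "?\<epsilon> b \<in> carrier FVW" if "b \<in> I \<times> J" for b
      using that V.e_closed W.e_closed by auto
    show "?p \<in> carrier FVW" by (rule FVW.linear_ext_closed[OF c \<epsilon>])
    have "cls ?p
        = linear_ext R T (\<lambda>b. cls (?\<epsilon> b)) c"
      by (rule mod_hom.linear_ext[OF quo_hom c \<epsilon>])
    moreover have "(\<lambda>b. cls (?\<epsilon> b)) = tbasis"
      by (auto simp: pure_tensor_def)
    moreover have "coord_map ?p = c"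
    proof -
      have "coord_map ?p = linear_ext R FXY (\<lambda>b. coord_map (?\<epsilon> b)) c"
        by (rule C.linear_ext[OF c \<epsilon>])
      also have "\<dots> = linear_ext R FXY (delta R) c"
      proof (rule FXY.linear_ext_cong[OF c])
        fix b assume "b \<in> I \<times> J"
        then obtain x y where b: "b = (x, y)" "x \<in> I" "y \<in> J" by auto
        have "coord_map (?\<epsilon> b) = tcoords (e x) (d y)"
          using b V.e_closed W.e_closed by (simp add: coord_map_delta)
        also have "\<dots> = delta R b"
          unfolding tcoords_def V.coords_e[OF b(2)] W.coords_e[OF b(3)] b(1)
          by (auto simp: delta_def fun_eq_iff)
        finally show "coord_map (?\<epsilon> b) = delta R b" .
      qed auto
      also have "\<dots> = c" by (rule V.R.linear_ext_delta_id[OF c])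
      finally show ?thesis .
    qed
    ultimately show "tcomb c = cls ?p \<and> coord_map ?p = c"
      by simp
  qed
  show ?thesis
  proof (rule V.R.free_hom_inj_onI[OF L.mod_hom_axioms])
    fix c assume "c \<in> fin_supp R (I \<times> J)" and "tcomb c = \<zero>\<^bsub>T\<^esub>"
    then obtain p where p: "p \<in> carrier FVW" "cls p = \<zero>\<^bsub>T\<^esub>" "coord_map p = c"
      using lift by metis
    then have "p \<in> bilinear_kernel R V W"
      using quo.proj_eq_zero_iff unfolding tensor_def by blast
    then show "c = (\<lambda>_. \<zero>)" using coord_map_kernel p(3) by simp
  qed
qed

text \<open>Pure tensors generate, and expanding both factors in their bases expands a pure tensor.\<close>

lemma tbasis_surj: "tcomb ` fin_supp R (I \<times> J) = carrier T"
proof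
  interpret L: mod_hom R FXY T "tcomb"
    by (rule T.linear_ext_hom) (rule tbasis_closed)
  have im: "L.im = tcomb ` fin_supp R (I \<times> J)" by (simp add: L.im_def)
  show "tcomb ` fin_supp R (I \<times> J) \<subseteq> carrier T"
    using L.f_im by auto
  show "carrier T \<subseteq> tcomb ` fin_supp R (I \<times> J)"
  proof
    fix t assume "t \<in> carrier T"
    then obtain p where p: "p \<in> carrier FVW" "t = cls p"
      unfolding tensor_def by (rule quo.quotE)
    have "t = linear_ext R T (\<lambda>b. cls (delta R b)) p"
      unfolding p(2) using p(1) by (intro mod_hom_free_eq[OF quo_hom]) simp
    also have "\<dots> \<in> L.im"
    proof (rule T.linear_ext_in_submodule[OF L.im_is_submodule])
      show "p \<in> fin_supp R (carrier V \<times> carrier W)" using p(1) by simp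
      fix b assume "b \<in> carrier V \<times> carrier W"
      then obtain v w where b: "b = (v, w)" "v \<in> carrier V" "w \<in> carrier W" by auto
      have "pure v w = tcomb (\<lambda>(x, y). V.coords v x \<otimes> W.coords w y)"
        using pure_linear_ext[OF V.coords_closed[OF b(2)] W.coords_closed[OF b(3)]]
        by (simp add: V.linear_ext_coords[OF b(2)] W.linear_ext_coords[OF b(3)])
      moreover have "(\<lambda>(x, y). V.coords v x \<otimes> W.coords w y) \<in> fin_supp R (I \<times> J)"
        by (rule V.fin_supp_times[OF V.coords_closed[OF b(2)] W.coords_closed[OF b(3)]])
      ultimately have "pure v w \<in> L.im" unfolding im by blast
      moreover have "cls (delta R b) = pure v w"
        unfolding b(1) pure_tensor_def ..
      ultimately show "cls (delta R b) \<in> L.im" by (simp only:)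
    qed
    finally show "t \<in> tcomb ` fin_supp R (I \<times> J)" by (simp add: im)
  qed
qed

theorem based_module_tensor: "based_module R T tbasis (I \<times> J)"
  by (intro based_module.intro based_module_axioms.intro module_tensor tbasis_closed)
    (auto simp: bij_betw_def tbasis_inj tbasis_surj)

end

lemma (in monoid_ring) based_monoid_algebra: "based_module R MA (delta R) (carrier N)"
proof (intro based_module.intro based_module_axioms.intro module_monoid_algebra)
  have "linear_ext R MA (delta R) f = f" if "f \<in> fin_supp R (carrier N)" for f
    using linear_ext_delta_id[OF that] by (simp add: linear_ext_monoid_algebra)
  then show "bij_betw (linear_ext R MA (delta R)) (fin_supp R (carrier N)) (carrier MA)"
    by (intro bij_betwI[where g = "\<lambda>f. f"]) auto
qed simp

section \<open>The basis theorem\<close>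

lemma (in wreath_algebra) based_H: "based_module F H bas B"
  using span_map_bij by (intro based_module.intro based_module_axioms.intro H.module_axioms bas_closed)
    (auto simp: span_map_def)

lemma fin_supp_reindex:
  assumes "c \<in> fin_supp F J" "bij r"
  shows "(\<lambda>x. c (r x)) \<in> fin_supp F (r -` J)"
proof -
  have "support F (\<lambda>x. c (r x)) = r -` support F c" by auto
  moreover have "finite (r -` support F c)"
    using fin_suppD(2)[OF assms(1)] assms(2) by (intro finite_vimageI) (auto simp: bij_def)
  ultimately show ?thesis
    using fin_suppD[OF assms(1)] unfolding fin_supp_def by auto
qed

text \<open>Needed to reassociate the index triples of a twofold tensor product.\<close>

lemma (in based_module) based_module_reindex:
  assumes r: "bij r"
  shows "based_module R V (\<lambda>y. e (r y)) (r -` I)"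
proof (intro based_module.intro based_module_axioms.intro module_axioms)
  show "e (r y) \<in> carrier V" if "y \<in> r -` I" for y using that e_closed by simp
  let ?r' = "inv' r"
  have r': "bij ?r'" "r (?r' x) = x" "?r' (r y) = y" for x y
    using r by (simp_all add: bij_imp_bij_inv bij_is_surj surj_f_inv_f bij_is_inj)
  have pull: "linear_ext R V (\<lambda>y. e (r y)) (\<lambda>y. c (r y)) = linear_ext R V e c"
    if c: "c \<in> fin_supp R I" for c
  proof -
    have img: "support R c = r ` support R (\<lambda>y. c (r y))"
      using r'(2) by (auto simp: image_iff) metis
    have "linear_ext R V e c = (\<Oplus>\<^bsub>V\<^esub>x\<in>r ` support R (\<lambda>y. c (r y)). c x \<odot>\<^bsub>V\<^esub> e x)"
      unfolding linear_ext_def img ..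
    also have "\<dots> = linear_ext R V (\<lambda>y. e (r y)) (\<lambda>y. c (r y))"
      unfolding linear_ext_def using fin_suppD[OF c] e_closed r
      by (intro M.finsum_reindex) (auto simp: bij_def inj_on_def)
    finally show ?thesis by simp
  qed
  have "bij_betw (\<lambda>c y. c (r y)) (fin_supp R I) (fin_supp R (r -` I))"
  proof (rule bij_betwI[where g = "\<lambda>c x. c (?r' x)"])
    show "(\<lambda>c y. c (r y)) \<in> fin_supp R I \<rightarrow> fin_supp R (r -` I)"
      using fin_supp_reindex[OF _ r] by blast
    have "?r' -` (r -` I) = I" using r'(2) by auto
    then show "(\<lambda>c x. c (?r' x)) \<in> fin_supp R (r -` I) \<rightarrow> fin_supp R I"
      using fin_supp_reindex[OF _ r'(1), of _ R "r -` I"] by auto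
  qed (auto simp: r')
  moreover have "bij_betw (linear_ext R V (\<lambda>y. e (r y)) \<circ> (\<lambda>c y. c (r y))) (fin_supp R I) (carrier V)"
    using bij pull by (simp cong: bij_betw_cong)
  ultimately show "bij_betw (linear_ext R V (\<lambda>y. e (r y))) (fin_supp R (r -` I)) (carrier V)"
    by (metis bij_betw_comp_iff)
qed

lemma monoid_exponent_monoid: "Group.monoid (exponent_monoid n)"
  by (rule monoidI) (auto simp: exponent_monoid_def PiE_def fun_eq_iff extensional_def)

theorem theorem2p8:
  fixes F :: "'f ring" and G :: "'g monoid" and n :: nat
  assumes "algebraically_closed F"
    and "group G" and "finite (carrier G)"
    and "n \<ge> 1"
  defines "H \<equiv> wreath_hecke F G n"
    and "P \<equiv> poly_algebra F n"
    and "A \<equiv> monoid_algebra F (group_pow G n)"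
    and "S \<equiv> monoid_algebra F (sym_group n)"
    and "B \<equiv> carrier (exponent_monoid n) \<times> carrier (group_pow G n) \<times> carrier (sym_group n)"
  shows "(\<exists>\<mu>. linear_map F (tensor F (tensor F P A) S) H \<mu>
            \<and> bij_betw \<mu> (carrier (tensor F (tensor F P A) S)) (carrier H)
            \<and> (\<forall>p \<in> carrier P. \<forall>a \<in> carrier A. \<forall>u \<in> carrier S.
                 \<mu> (pure_tensor F (tensor F P A) S (pure_tensor F P A p a) u)
                   = poly_to_hecke F G n p \<otimes>\<^bsub>H\<^esub> group_to_hecke F G n a \<otimes>\<^bsub>H\<^esub> perm_to_hecke F G n u))
       \<and> inj_on (hecke_basis_elem F G n) B
       \<and> vectorspace.basis F H (hecke_basis_elem F G n ` B)"
proof -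
  interpret F: field F using assms(1) by (simp add: algebraically_closed_def)
  interpret wreath_algebra F G n
    using assms(2,3) F.field_axioms
    by (intro wreath_algebra.intro wreath_group.intro wreath_group_axioms.intro)
  let ?X = "carrier (exponent_monoid n)" and ?Y = "carrier (group_pow G n)" and ?Z = "carrier (sym_group n)"
  let ?T1 = "tensor F P A" and ?T2 = "tensor F (tensor F P A) S"
  have RP: "monoid_ring F (exponent_monoid n)"
    by (intro monoid_ring.intro F.is_cring monoid_exponent_monoid)
  have RA: "monoid_ring F (group_pow G n)"
    by (intro monoid_ring.intro F.is_cring GN.monoid_axioms)
  have RS: "monoid_ring F (sym_group n)"
    using group.is_monoid[OF sym_group_is_group[of n]] by (intro monoid_ring.intro F.is_cring)
  have bP: "based_module F P (delta F) ?X"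
    unfolding P_def poly_algebra_def by (rule monoid_ring.based_monoid_algebra[OF RP])
  have bA: "based_module F A (delta F) ?Y"
    unfolding A_def by (rule monoid_ring.based_monoid_algebra[OF RA])
  have bS: "based_module F S (delta F) ?Z"
    unfolding S_def by (rule monoid_ring.based_monoid_algebra[OF RS])
  interpret t1: tensor_based F P "delta F" ?X A "delta F" ?Y
    by (intro tensor_based.intro bP bA)
  interpret t2: tensor_based F ?T1 t1.tbasis "?X \<times> ?Y" S "delta F" ?Z
    by (intro tensor_based.intro t1.based_module_tensor bS)
  interpret T2: based_module F ?T2 t2.tbasis "(?X \<times> ?Y) \<times> ?Z"
    by (rule t2.based_module_tensor)
  define r :: "((nat \<Rightarrow> nat) \<times> (nat \<Rightarrow> 'g)) \<times> (nat \<Rightarrow> nat) \<Rightarrow> (nat \<Rightarrow> nat) \<times> (nat \<Rightarrow> 'g) \<times> (nat \<Rightarrow> nat)"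
    where "r = (\<lambda>((x, y), z). (x, y, z))"
  have "bij r" unfolding r_def by (rule bij_betwI[where g = "\<lambda>(x, y, z). ((x, y), z)"]) auto
  moreover have vim: "r -` (?X \<times> ?Y \<times> ?Z) = (?X \<times> ?Y) \<times> ?Z" by (auto simp: r_def)
  ultimately have bH: "based_module F H (\<lambda>b. bas (r b)) ((?X \<times> ?Y) \<times> ?Z)"
    using based_module.based_module_reindex[OF based_H] unfolding H_def by metis
  interpret H': based_module F H "\<lambda>b. bas (r b)" "(?X \<times> ?Y) \<times> ?Z" by (rule bH)
  \<comment> \<open>The map that matches the basis of the tensor product with the ordered monomials.\<close>
  define \<mu> where "\<mu> = (\<lambda>t. linear_ext F H (\<lambda>b. bas (r b)) (T2.coords t))"
  have hom: "mod_hom F ?T2 H \<mu>"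
    unfolding \<mu>_def by (rule mod_hom_comp[OF T2.coords_hom H'.combination_hom])
  have "bij_betw T2.coords (carrier ?T2) (fin_supp F ((?X \<times> ?Y) \<times> ?Z))"
    unfolding T2.coords_def by (rule bij_betw_inv_into[OF T2.bij])
  then have bij: "bij_betw \<mu> (carrier ?T2) (carrier H)"
    using bij_betw_trans[OF _ H'.bij] unfolding \<mu>_def comp_def by blast
  have "\<mu> (t2.pure (t1.pure p a) u)
      = poly_to_hecke F G n p \<otimes>\<^bsub>H\<^esub> group_to_hecke F G n a \<otimes>\<^bsub>H\<^esub> perm_to_hecke F G n u"
    if p: "p \<in> carrier P" and a: "a \<in> carrier A" and u: "u \<in> carrier S" for p a u
  proof -
    have p': "p \<in> fin_supp F ?X" and a': "a \<in> fin_supp F ?Y" and u': "u \<in> fin_supp F ?Z"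
      using p a u by (simp_all add: P_def poly_algebra_def A_def S_def)
    let ?pa = "\<lambda>(x, y). p x \<otimes>\<^bsub>F\<^esub> a y"
    let ?pau = "\<lambda>(b, z). ?pa b \<otimes>\<^bsub>F\<^esub> u z"
    have pa: "?pa \<in> fin_supp F (?X \<times> ?Y)" by (rule F.fin_supp_times[OF p' a'])
    have pau: "?pau \<in> fin_supp F ((?X \<times> ?Y) \<times> ?Z)" by (rule F.fin_supp_times[OF pa u'])
    have id: "linear_ext F P (delta F) p = p" "linear_ext F A (delta F) a = a" "linear_ext F S (delta F) u = u"
      using F.linear_ext_delta_id[OF p'] F.linear_ext_delta_id[OF a'] F.linear_ext_delta_id[OF u']
      by (simp_all add: P_def poly_algebra_def A_def S_def linear_ext_monoid_algebra)
    have "t2.pure (t1.pure p a) u = linear_ext F ?T2 t2.tbasis ?pau"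
      using t1.pure_linear_ext[OF p' a'] t2.pure_linear_ext[OF pa u'] by (simp add: id)
    then have "\<mu> (t2.pure (t1.pure p a) u) = linear_ext F H (\<lambda>b. bas (r b)) ?pau"
      unfolding \<mu>_def by (simp add: T2.coords_linear_ext[OF pau])
    also have "\<dots> = linear_ext F H (\<lambda>(b, z). (case b of (x, y) \<Rightarrow> xmon x \<star> gh y) \<star> hperm z) ?pau"
      by (rule arg_cong[where f = "\<lambda>\<phi>. linear_ext F H \<phi> ?pau"]) (auto simp: r_def bas_eq)
    also have "\<dots> = linear_ext F H (\<lambda>(x, y). xmon x \<star> gh y) ?pa \<star> linear_ext F H hperm u"
      unfolding H_def using pa u'
      by (intro H.linear_ext_bilinear[symmetric, where Y = "?X \<times> ?Y" and Z = ?Z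
            and \<beta> = "\<lambda>x y. x \<star> y"] H.linear_ext_hom H.l_mult_hom H.r_mult_hom) auto
    also have "linear_ext F H (\<lambda>(x, y). xmon x \<star> gh y) ?pa = linear_ext F H xmon p \<star> linear_ext F H (\<lambda>g. gh g) a"
      unfolding H_def using p' a'
      by (intro H.linear_ext_bilinear[symmetric, where Y = ?X and Z = ?Y
            and \<beta> = "\<lambda>x y. x \<star> y"] H.linear_ext_hom H.l_mult_hom H.r_mult_hom) auto
    finally show ?thesis
      by (simp add: H_def poly_to_hecke_def group_to_hecke_def perm_to_hecke_def)
  qed
  moreover have "linear_map F ?T2 H \<mu>"
  proof (intro linear_map.intro hom)
    show "vectorspace F ?T2" by (intro vectorspace.intro t2.module_tensor F.field_axioms)
    show "vectorspace F H" unfolding H_def by (rule vectorspace_H)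
  qed
  ultimately have "\<exists>\<mu>. linear_map F ?T2 H \<mu> \<and> bij_betw \<mu> (carrier ?T2) (carrier H)
      \<and> (\<forall>p \<in> carrier P. \<forall>a \<in> carrier A. \<forall>u \<in> carrier S. \<mu> (t2.pure (t1.pure p a) u)
          = poly_to_hecke F G n p \<otimes>\<^bsub>H\<^esub> group_to_hecke F G n a \<otimes>\<^bsub>H\<^esub> perm_to_hecke F G n u)"
    using bij by blast
  then show ?thesis
    using ordered_monomials_basis unfolding H_def B_def by blast
qed

end
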